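(* Let $H$ be a real separable Hilbert space, $T>0$, and $\phi=\phi_1+\phi_2:H\to(-\infty,\infty]$ with $\phi_1$ proper, convex, lower semicontinuous and $\partial\phi_1$ single-valued (where nonempty), $\phi_2\in C^{1,1}(H)$, such that $\phi$ has compact sublevel sets and satisfies the chain rule stated in the context. Let $y_0\in D(\phi)$, $U\ne\emptyset$ compact in $L^2(0,T;H)$, $X:=L^2(0,T;H)\times H^1(0,T;H)$ with $\tau$ = strong $\times$ weak topology, $F:X\to[0,\infty]$ $\tau$-lower semicontinuous with $F(u,y)<\infty$ only if $u\in U$, and $E_\varepsilon:=F+\varepsilon^{-1}G_{\rm DG}$. Then $\min E_\varepsilon$ admits a solution for all $\varepsilon>0$; $E_\varepsilon$ $\Gamma$-converges w.r.t. $\tau$ to $E_0$, with $E_0=F$ on $\{G_{\rm DG}=0\}$ and $E_0=\infty$ otherwise; every sequence of quasiminimizers has a subsequence $\tau$-converging to a minimizer of $E_0$; and if $E_0$ has a unique minimizer, every sequence of quasiminimizers $\tau$-converges to it.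
   Context: $\partial\phi$ is the Fréchet subdifferential: $\xi\in\partial\phi(y)$ iff $y\in D(\phi)$ and $\liminf_{w\to y}\frac{\phi(w)-\phi(y)-(\xi,w-y)}{\|w-y\|}\ge0$; here $\partial\phi=\partial\phi_1+D\phi_2$ is single-valued on $D(\partial\phi)=\{y:\partial\phi(y)\ne\emptyset\}$. Chain rule: if $y\in H^1(0,T;H)$, $\xi\in L^2(0,T;H)$ and $\xi(t)\in\partial\phi(y(t))$ for a.e. $t$, then $\phi\circ y$ is absolutely continuous on $[0,T]$ and $(\phi\circ y)'=(\xi,y')$ a.e. De Giorgi functional: for $(u,y)\in X$, $G_{\rm DG}(u,y)=\int_0^T\big(\frac12\|y'\|^2+\frac12\|\partial\phi(y)-u\|^2-(u,y')\big)\,dt+\phi(y(T))-\phi(y_0)$ if $y(t)\in D(\partial\phi)$ for a.e. $t$ and $y(0)=y_0$, and $G_{\rm DG}(u,y)=\infty$ otherwise. For each $u\in L^2(0,T;H)$, $G_{\rm DG}(u,y)=0$ iff $y\in H^1(0,T;H)$ solves $y'+\partial\phi(y)\ni u$ a.e., $y(0)=y_0$. Quasiminimizers: $\lim(E_\varepsilon(x_\varepsilon)-\inf E_\varepsilon)=0$; $\Gamma$-convergence is sequential. *)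

theory Defs
  imports "HOL-Analysis.Analysis"
begin

definition proper_fun :: "('a \<Rightarrow> ereal) \<Rightarrow> bool" where
  "proper_fun f \<longleftrightarrow> (\<exists>x. f x \<noteq> \<infinity>) \<and> (\<forall>x. f x \<noteq> -\<infinity>)"

definition convex_fun :: "('a::real_vector \<Rightarrow> ereal) \<Rightarrow> bool" where
  "convex_fun f \<longleftrightarrow> (\<forall>x y t. 0 < t \<and> t < 1 \<longrightarrow>
      f (t *\<^sub>R x + (1 - t) *\<^sub>R y) \<le> ereal t * f x + ereal (1 - t) * f y)"

definition lsc_fun :: "('a::topological_space \<Rightarrow> ereal) \<Rightarrow> bool" where
  "lsc_fun f \<longleftrightarrow> (\<forall>x. f x \<le> Liminf (at x) f)"

definition dom_fun :: "('a \<Rightarrow> ereal) \<Rightarrow> 'a set" where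
  "dom_fun f = {x. f x < \<infinity>}"

definition frechet_subdiff :: "('a::real_inner \<Rightarrow> ereal) \<Rightarrow> 'a \<Rightarrow> 'a set" where
  "frechet_subdiff f y = {\<xi>. y \<in> dom_fun f \<and>
      Liminf (at y) (\<lambda>w. (f w - f y - ereal (inner \<xi> (w - y))) / ereal (norm (w - y))) \<ge> 0}"

definition dom_subdiff :: "('a::real_inner \<Rightarrow> ereal) \<Rightarrow> 'a set" where
  "dom_subdiff f = {y. frechet_subdiff f y \<noteq> {}}"

definition subdiff_fun :: "('a::real_inner \<Rightarrow> ereal) \<Rightarrow> 'a \<Rightarrow> 'a" where
  "subdiff_fun f y = (THE \<xi>. \<xi> \<in> frechet_subdiff f y)"

definition C11 :: "('a::real_normed_vector \<Rightarrow> real) \<Rightarrow> bool" where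
  "C11 f \<longleftrightarrow> (\<forall>x. f differentiable (at x)) \<and>
     (\<exists>L. \<forall>x y. onorm (\<lambda>h. frechet_derivative f (at x) h - frechet_derivative f (at y) h)
                 \<le> L * norm (x - y))"

text \<open>L^2(0,T;H) (representatives; a.e.-equal functions are identified through the topology).\<close>
definition L2fun :: "real \<Rightarrow> (real \<Rightarrow> 'a::{banach,second_countable_topology}) set" where
  "L2fun T = {u. u \<in> borel_measurable (lebesgue_on {0..T}) \<and>
                 integrable (lebesgue_on {0..T}) (\<lambda>t. (norm (u t))\<^sup>2)}"

definition L2dist :: "real \<Rightarrow> (real \<Rightarrow> 'a::{banach,second_countable_topology}) \<Rightarrow> (real \<Rightarrow> 'a) \<Rightarrow> real" where
  "L2dist T u v = sqrt (LINT t|lebesgue_on {0..T}. (norm (u t - v t))\<^sup>2)"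

definition L2_top :: "real \<Rightarrow> (real \<Rightarrow> 'a::{banach,second_countable_topology}) topology" where
  "L2_top T = topology (\<lambda>S. S \<subseteq> L2fun T \<and>
       (\<forall>u\<in>S. \<exists>e>0. {v \<in> L2fun T. L2dist T u v < e} \<subseteq> S))"

text \<open>H^1(0,T;H), each class represented by its continuous (absolutely continuous)
  representative on [0,T], extended by 0 outside [0,T].\<close>
definition H1fun :: "real \<Rightarrow> (real \<Rightarrow> 'a::{banach,second_countable_topology}) set" where
  "H1fun T = {y. (\<forall>t. t \<notin> {0..T} \<longrightarrow> y t = 0) \<and>
      (\<exists>y' \<in> L2fun T. \<forall>t\<in>{0..T}. y t = y 0 + integral\<^sup>L (lebesgue_on {0..t}) y')}"

text \<open>Weak derivative y' (unique up to a.e. equality).\<close>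
definition h1deriv :: "real \<Rightarrow> (real \<Rightarrow> 'a::{banach,second_countable_topology}) \<Rightarrow> real \<Rightarrow> 'a" where
  "h1deriv T y = (SOME y'. y' \<in> L2fun T \<and>
      (\<forall>t\<in>{0..T}. y t = y 0 + integral\<^sup>L (lebesgue_on {0..t}) y'))"

definition H1inner :: "real \<Rightarrow> (real \<Rightarrow> 'a::{real_inner,banach,second_countable_topology}) \<Rightarrow> (real \<Rightarrow> 'a) \<Rightarrow> real" where
  "H1inner T y z = (LINT t|lebesgue_on {0..T}. inner (y t) (z t)) +
                   (LINT t|lebesgue_on {0..T}. inner (h1deriv T y t) (h1deriv T z t))"

text \<open>Weak topology of the Hilbert space H^1(0,T;H): initial topology of the
  continuous linear functionals, i.e. of y \<mapsto> (y,z)_{H^1}, z \<in> H^1.\<close>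
definition H1w_top :: "real \<Rightarrow> (real \<Rightarrow> 'a::{real_inner,banach,second_countable_topology}) topology" where
  "H1w_top T = subtopology
      (topology_generated_by {{y \<in> H1fun T. H1inner T y z \<in> V} | z V. z \<in> H1fun T \<and> open V})
      (H1fun T)"

definition Xset :: "real \<Rightarrow> ((real \<Rightarrow> 'a::{real_inner,banach,second_countable_topology}) \<times> (real \<Rightarrow> 'a)) set" where
  "Xset T = L2fun T \<times> H1fun T"

definition tau :: "real \<Rightarrow> ((real \<Rightarrow> 'a::{real_inner,banach,second_countable_topology}) \<times> (real \<Rightarrow> 'a)) topology" where
  "tau T = prod_topology (L2_top T) (H1w_top T)"

definition Xeq :: "real \<Rightarrow> ((real \<Rightarrow> 'a::{real_inner,banach,second_countable_topology}) \<times> (real \<Rightarrow> 'a))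
                    \<Rightarrow> ((real \<Rightarrow> 'a) \<times> (real \<Rightarrow> 'a)) \<Rightarrow> bool" where
  "Xeq T x x' \<longleftrightarrow> (AE t in lebesgue_on {0..T}. fst x t = fst x' t) \<and> snd x = snd x'"

definition abs_cont_on :: "real \<Rightarrow> real \<Rightarrow> (real \<Rightarrow> real) \<Rightarrow> bool" where
  "abs_cont_on a b g \<longleftrightarrow> (\<forall>e>0. \<exists>d>0. \<forall>(n::nat) (s::nat \<Rightarrow> real) t.
      (\<forall>i<n. a \<le> s i \<and> s i \<le> t i \<and> t i \<le> b) \<and>
      (\<forall>i<n. \<forall>j<n. i \<noteq> j \<longrightarrow> t i \<le> s j \<or> t j \<le> s i) \<and>
      (\<Sum>i<n. t i - s i) < d \<longrightarrow> (\<Sum>i<n. \<bar>g (t i) - g (s i)\<bar>) < e)"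

definition chain_rule :: "real \<Rightarrow> ('a::{real_inner,banach,second_countable_topology} \<Rightarrow> ereal) \<Rightarrow> bool" where
  "chain_rule T f \<longleftrightarrow> (\<forall>y \<in> H1fun T. \<forall>\<xi> \<in> L2fun T.
      (AE t in lebesgue_on {0..T}. \<xi> t \<in> frechet_subdiff f (y t)) \<longrightarrow>
      (\<forall>t\<in>{0..T}. \<bar>f (y t)\<bar> \<noteq> \<infinity>) \<and>
      abs_cont_on 0 T (\<lambda>t. real_of_ereal (f (y t))) \<and>
      (AE t in lebesgue_on {0..T}.
         ((\<lambda>s. real_of_ereal (f (y s))) has_real_derivative inner (\<xi> t) (h1deriv T y t))
           (at t within {0..T})))"

definition G_DG :: "real \<Rightarrow> ('a::{real_inner,banach,second_countable_topology} \<Rightarrow> ereal) \<Rightarrow> 'a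
                    \<Rightarrow> (real \<Rightarrow> 'a) \<times> (real \<Rightarrow> 'a) \<Rightarrow> ereal" where
  "G_DG T f y0 x = (let u = fst x; y = snd x in
     if (AE t in lebesgue_on {0..T}. y t \<in> dom_subdiff f) \<and> y 0 = y0 then
       enn2ereal (\<integral>\<^sup>+ t. ennreal ((norm (h1deriv T y t))\<^sup>2 / 2 +
                                 (norm (subdiff_fun f (y t) - u t))\<^sup>2 / 2) \<partial>(lebesgue_on {0..T}))
       - ereal (LINT t|lebesgue_on {0..T}. inner (u t) (h1deriv T y t))
       + f (y T) - f y0
     else \<infinity>)"

definition E_eps :: "real \<Rightarrow> ('a::{real_inner,banach,second_countable_topology} \<Rightarrow> ereal) \<Rightarrow> 'a
      \<Rightarrow> ((real \<Rightarrow> 'a) \<times> (real \<Rightarrow> 'a) \<Rightarrow> ennreal) \<Rightarrow> real \<Rightarrow> (real \<Rightarrow> 'a) \<times> (real \<Rightarrow> 'a) \<Rightarrow> ereal" where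
  "E_eps T f y0 F \<epsilon> x = enn2ereal (F x) + ereal (1 / \<epsilon>) * G_DG T f y0 x"

definition E_0 :: "real \<Rightarrow> ('a::{real_inner,banach,second_countable_topology} \<Rightarrow> ereal) \<Rightarrow> 'a
      \<Rightarrow> ((real \<Rightarrow> 'a) \<times> (real \<Rightarrow> 'a) \<Rightarrow> ennreal) \<Rightarrow> (real \<Rightarrow> 'a) \<times> (real \<Rightarrow> 'a) \<Rightarrow> ereal" where
  "E_0 T f y0 F x = (if G_DG T f y0 x = 0 then enn2ereal (F x) else \<infinity>)"

definition lsc_top :: "'b topology \<Rightarrow> ('b \<Rightarrow> ennreal) \<Rightarrow> bool" where
  "lsc_top X f \<longleftrightarrow> (\<forall>c. openin X {x \<in> topspace X. c < f x})"

definition is_minimizer :: "'b set \<Rightarrow> ('b \<Rightarrow> ereal) \<Rightarrow> 'b \<Rightarrow> bool" where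
  "is_minimizer S f x \<longleftrightarrow> x \<in> S \<and> (\<forall>x'\<in>S. f x \<le> f x')"

definition gamma_conv :: "'b topology \<Rightarrow> (real \<Rightarrow> 'b \<Rightarrow> ereal) \<Rightarrow> ('b \<Rightarrow> ereal) \<Rightarrow> bool" where
  "gamma_conv X E E0 \<longleftrightarrow> (\<forall>\<epsilon>::nat \<Rightarrow> real. (\<forall>n. \<epsilon> n > 0) \<and> \<epsilon> \<longlonglongrightarrow> 0 \<longrightarrow>
     (\<forall>x xs. (\<forall>n. xs n \<in> topspace X) \<and> limitin X xs x sequentially \<longrightarrow>
         E0 x \<le> liminf (\<lambda>n. E (\<epsilon> n) (xs n))) \<and>
     (\<forall>x \<in> topspace X. \<exists>xs. (\<forall>n. xs n \<in> topspace X) \<and> limitin X xs x sequentially \<and>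
         limsup (\<lambda>n. E (\<epsilon> n) (xs n)) \<le> E0 x))"

text \<open>Sequences of quasiminimizers: eps_n \<rightarrow> 0+, E_{eps_n}(x_n) - inf E_{eps_n} \<rightarrow> 0
  (with E_{eps_n}(x_n) eventually finite, so the difference is meaningful).\<close>
definition quasimin_seq :: "'b set \<Rightarrow> (real \<Rightarrow> 'b \<Rightarrow> ereal) \<Rightarrow> (nat \<Rightarrow> real) \<Rightarrow> (nat \<Rightarrow> 'b) \<Rightarrow> bool" where
  "quasimin_seq S E \<epsilon> xs \<longleftrightarrow> (\<forall>n. \<epsilon> n > 0) \<and> \<epsilon> \<longlonglongrightarrow> 0 \<and> (\<forall>n. xs n \<in> S) \<and>
     (\<forall>\<^sub>F n in sequentially. E (\<epsilon> n) (xs n) < \<infinity>) \<and>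
     ((\<lambda>n. E (\<epsilon> n) (xs n) - (INF x\<in>S. E (\<epsilon> n) x)) \<longlonglongrightarrow> 0)"

end

theory Submission
  imports Defs "HOL-Library.Function_Algebras"
begin

text \<open>By the chain rule, \<open>G_DG (u, y)\<close> is half the squared \<open>L\<^sup>2\<close> norm of \<open>y' + \<partial>\<phi>(y) - u\<close> whenever
  it is finite; in particular it is nonnegative. A bound on \<open>G_DG\<close> with controls in a compact set
  bounds \<open>y'\<close> and \<open>\<partial>\<phi>(y)\<close> in \<open>L\<^sup>2\<close> and, again by the chain rule, confines all trajectories to one
  compact sublevel of \<open>\<phi>\<close>. Weakly convergent velocities therefore give trajectories converging
  strongly at every time, and the graph of \<open>\<partial>\<phi>\<close> is closed under strong convergence of \<open>y\<close> and weak
  convergence of \<open>\<partial>\<phi>(y)\<close>, so \<open>G_DG\<close> is lower semicontinuous with compact sublevels. The rest holds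
  for any penalization of such a functional: minimizers exist by the direct method, bounded
  penalized energies force \<open>G_DG\<close> to vanish in the limit, and constant sequences recover the
  \<open>\<Gamma>\<close>-limit.\<close>

section \<open>Semi-inner product spaces\<close>

instantiation "fun" :: (type, real_vector) real_vector
begin

definition "a *\<^sub>R f = (\<lambda>x. a *\<^sub>R f x)"

instance
  by standard (simp_all add: scaleR_fun_def fun_eq_iff scaleR_add_left scaleR_add_right)

end

lemma scaleR_fun_apply [simp]: "(a *\<^sub>R f) x = a *\<^sub>R f x"
  by (simp add: scaleR_fun_def)

lemma nonneg_quadratic_imp_discriminant_nonpos:
  fixes a b c :: real
  assumes nonneg: "\<And>s. 0 \<le> a + 2 * s * b + s\<^sup>2 * c" and "0 \<le> c"
  shows "b\<^sup>2 \<le> a * c"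
proof (cases "c = 0")
  case True
  have "b = 0"
  proof (rule ccontr)
    assume "b \<noteq> 0"
    then show False using nonneg[of "- (a + 1) / (2 * b)"] True by (simp add: field_simps)
  qed
  with True show ?thesis by simp
next
  case False
  have "0 \<le> (a + 2 * (- b / c) * b + (- b / c)\<^sup>2 * c) * c"
    using nonneg[of "- b / c"] \<open>0 \<le> c\<close> by (rule mult_nonneg_nonneg)
  also have "\<dots> = a * c - b\<^sup>2" using False by (simp add: field_simps power2_eq_square)
  finally show ?thesis by simp
qed

lemma bounded_real_sequences_convergent_subsequence:
  fixes f :: "nat \<Rightarrow> nat \<Rightarrow> real"
  assumes bound: "\<And>n k. \<bar>f n k\<bar> \<le> B k"
  shows "\<exists>r. strict_mono r \<and> (\<forall>k. convergent (\<lambda>n. f (r n) k))"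
proof -
  define K where "K = (PiE UNIV (\<lambda>k. {- B k..B k}))"
  have "compact K"
    unfolding K_def euclidean_product_topology[symmetric] compactin_euclidean_iff[symmetric]
    by (subst compactin_PiE) simp
  moreover have "f n \<in> K" for n using bound by (auto simp: K_def abs_le_iff minus_le_iff)
  ultimately obtain l r where r: "strict_mono r" "(f \<circ> r) \<longlonglongrightarrow> l"
    using compact_imp_seq_compact unfolding seq_compact_def by metis
  then have "limitin (product_topology (\<lambda>_. euclidean) UNIV) (f \<circ> r) l sequentially"
    by (simp add: euclidean_product_topology)
  then have "(\<lambda>n. f (r n) k) \<longlonglongrightarrow> l k" for k by (simp add: limitin_componentwise)
  with r show ?thesis by (auto simp: convergent_def)
qed

lemma convergent_if_uniformly_approximable:
  fixes f :: "nat \<Rightarrow> real"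
  assumes approx: "\<And>e. e > 0 \<Longrightarrow> \<exists>g. convergent g \<and> (\<forall>n. \<bar>g n - f n\<bar> < e)"
  shows "convergent f"
proof -
  have "Cauchy f"
  proof (rule CauchyI)
    fix e :: real assume e: "e > 0"
    then obtain g where g: "convergent g" "\<And>n. \<bar>g n - f n\<bar> < e / 3" using approx[of "e / 3"] by auto
    obtain N where N: "\<And>m n. m \<ge> N \<Longrightarrow> n \<ge> N \<Longrightarrow> \<bar>g m - g n\<bar> < e / 3"
      using CauchyD[OF convergent_Cauchy[OF g(1)], of "e / 3"] e by auto
    have "\<bar>f m - f n\<bar> < e" if "m \<ge> N" "n \<ge> N" for m n
      using g(2)[of m] g(2)[of n] N[OF that] by linarith
    then show "\<exists>N. \<forall>m\<ge>N. \<forall>n\<ge>N. norm (f m - f n) < e" by auto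
  qed
  then show ?thesis by (simp add: Cauchy_convergent_iff)
qed

text \<open>Square integrable functions are handled through representatives, so the form is allowed to
  be degenerate.\<close>

locale semi_hilbert =
  fixes V :: "'b::real_vector set" and ip :: "'b \<Rightarrow> 'b \<Rightarrow> real"
  assumes subspace: "subspace V"
    and ip_add_left: "x \<in> V \<Longrightarrow> y \<in> V \<Longrightarrow> z \<in> V \<Longrightarrow> ip (x + y) z = ip x z + ip y z"
    and ip_scaleR_left: "x \<in> V \<Longrightarrow> y \<in> V \<Longrightarrow> ip (a *\<^sub>R x) y = a * ip x y"
    and ip_commute: "x \<in> V \<Longrightarrow> y \<in> V \<Longrightarrow> ip x y = ip y x"
    and ip_nonneg: "x \<in> V \<Longrightarrow> 0 \<le> ip x x"
    and complete: "(\<And>n::nat. X n \<in> V) \<Longrightarrow>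
        (\<And>e. e > 0 \<Longrightarrow> \<exists>N. \<forall>m\<ge>N. \<forall>n\<ge>N. ip (X m - X n) (X m - X n) < e) \<Longrightarrow>
        \<exists>x\<in>V. (\<lambda>n. ip (X n - x) (X n - x)) \<longlonglongrightarrow> 0"
begin

lemmas add_mem = subspace_add[OF subspace]
  and diff_mem = subspace_diff[OF subspace]
  and scaleR_mem = subspace_scale[OF subspace]

lemma ip_add_right: "x \<in> V \<Longrightarrow> y \<in> V \<Longrightarrow> z \<in> V \<Longrightarrow> ip z (x + y) = ip z x + ip z y"
  by (metis add_mem ip_add_left ip_commute)

lemma ip_scaleR_right: "x \<in> V \<Longrightarrow> y \<in> V \<Longrightarrow> ip y (a *\<^sub>R x) = a * ip y x"
  by (metis scaleR_mem ip_scaleR_left ip_commute)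

lemma ip_zero_right: "x \<in> V \<Longrightarrow> ip x 0 = 0"
  using ip_scaleR_right[of 0 x 0] subspace_0[OF subspace] by simp

lemma ip_diff_left: "x \<in> V \<Longrightarrow> y \<in> V \<Longrightarrow> z \<in> V \<Longrightarrow> ip (x - y) z = ip x z - ip y z"
  using ip_add_left[of "x - y" y z] diff_mem[of x y] by simp

lemma ip_diff_right: "x \<in> V \<Longrightarrow> y \<in> V \<Longrightarrow> z \<in> V \<Longrightarrow> ip z (x - y) = ip z x - ip z y"
  using ip_add_right[of "x - y" y z] diff_mem[of x y] by simp

lemma ip_add_self:
  assumes "x \<in> V" "y \<in> V"
  shows "ip (x + y) (x + y) = ip x x + 2 * ip x y + ip y y"
  using assms ip_commute[OF assms] by (simp add: ip_add_left ip_add_right add_mem)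

lemma ip_diff_self:
  assumes "x \<in> V" "y \<in> V"
  shows "ip (x - y) (x - y) = ip x x - 2 * ip x y + ip y y"
  using assms ip_commute[OF assms] by (simp add: ip_diff_left ip_diff_right diff_mem)

lemma ip_scaleR_self: "x \<in> V \<Longrightarrow> ip (a *\<^sub>R x) (a *\<^sub>R x) = a\<^sup>2 * ip x x"
  by (simp add: ip_scaleR_left ip_scaleR_right scaleR_mem power2_eq_square)

lemma cauchy_schwarz:
  assumes "x \<in> V" "y \<in> V"
  shows "(ip x y)\<^sup>2 \<le> ip x x * ip y y"
proof (rule nonneg_quadratic_imp_discriminant_nonpos)
  fix s :: real
  have "0 \<le> ip (x + s *\<^sub>R y) (x + s *\<^sub>R y)" by (intro ip_nonneg add_mem scaleR_mem assms)
  then show "0 \<le> ip x x + 2 * s * ip x y + s\<^sup>2 * ip y y"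
    by (simp add: assms ip_add_self ip_scaleR_left ip_scaleR_right scaleR_mem power2_eq_square
        mult.assoc)
qed (rule ip_nonneg[OF assms(2)])

lemma ip_le_ip_self:
  assumes "x \<in> V" "y \<in> V"
  shows "ip x y \<le> ip x x + ip y y / 4"
  using ip_nonneg[of "x - (1/2) *\<^sub>R y"]
  by (simp add: assms diff_mem scaleR_mem ip_diff_self ip_scaleR_left ip_scaleR_right)

lemma ip_add_self_le:
  assumes "x \<in> V" "y \<in> V"
  shows "ip (x + y) (x + y) \<le> 2 * ip x x + 2 * ip y y"
  using ip_nonneg[OF diff_mem[OF assms]] by (simp add: assms ip_add_self ip_diff_self)

lemma sqrt_ip_triangle:
  assumes "x \<in> V" "y \<in> V"
  shows "sqrt (ip (x + y) (x + y)) \<le> sqrt (ip x x) + sqrt (ip y y)"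
proof (rule real_le_lsqrt)
  have "ip x y \<le> sqrt (ip x x * ip y y)" using cauchy_schwarz[OF assms] by (rule real_le_rsqrt)
  then show "ip (x + y) (x + y) \<le> (sqrt (ip x x) + sqrt (ip y y))\<^sup>2"
    by (simp add: assms ip_add_self ip_nonneg power2_sum real_sqrt_mult)
qed (simp add: assms ip_nonneg)

definition weak_lim :: "(nat \<Rightarrow> 'b) \<Rightarrow> 'b \<Rightarrow> bool" where
  "weak_lim X x \<longleftrightarrow> (\<forall>z\<in>V. (\<lambda>n. ip (X n) z) \<longlonglongrightarrow> ip x z)"

definition strong_lim :: "(nat \<Rightarrow> 'b) \<Rightarrow> 'b \<Rightarrow> bool" where
  "strong_lim X x \<longleftrightarrow> (\<lambda>n. ip (X n - x) (X n - x)) \<longlonglongrightarrow> 0"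

lemma weak_lim_subseq: "weak_lim X x \<Longrightarrow> strict_mono r \<Longrightarrow> weak_lim (X \<circ> r) x"
  unfolding weak_lim_def using LIMSEQ_subseq_LIMSEQ[of "\<lambda>n. ip (X n) _" _ r] by (simp add: o_def)

lemma strong_lim_subseq: "strong_lim X x \<Longrightarrow> strict_mono r \<Longrightarrow> strong_lim (X \<circ> r) x"
  unfolding strong_lim_def
  using LIMSEQ_subseq_LIMSEQ[of "\<lambda>n. ip (X n - x) (X n - x)" 0 r] by (simp add: o_def)

lemma weak_lim_add:
  assumes "\<And>n. X n \<in> V" "x \<in> V" "\<And>n. Z n \<in> V" "z \<in> V" "weak_lim X x" "weak_lim Z z"
  shows "weak_lim (\<lambda>n. X n + Z n) (x + z)"
  using assms unfolding weak_lim_def by (auto simp: ip_add_left intro!: tendsto_add)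

lemma weak_lim_diff:
  assumes "\<And>n. X n \<in> V" "x \<in> V" "\<And>n. Z n \<in> V" "z \<in> V" "weak_lim X x" "weak_lim Z z"
  shows "weak_lim (\<lambda>n. X n - Z n) (x - z)"
  using assms unfolding weak_lim_def by (auto simp: ip_diff_left intro!: tendsto_diff)

lemma weak_lim_ip_strong_lim:
  assumes X: "\<And>n. X n \<in> V" and Z: "\<And>n. Z n \<in> V" "z \<in> V"
    and bound: "\<And>n. ip (X n) (X n) \<le> M" and weak: "weak_lim X x" and strong: "strong_lim Z z"
  shows "(\<lambda>n. ip (X n) (Z n)) \<longlonglongrightarrow> ip x z"
proof -
  define d where "d n = ip (Z n - z) (Z n - z)" for n
  have "(\<lambda>n. (ip (X n) (Z n - z))\<^sup>2) \<longlonglongrightarrow> 0"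
  proof (rule tendsto_sandwich[OF always_eventually always_eventually tendsto_const])
    show "(\<lambda>n. M * d n) \<longlonglongrightarrow> 0"
      using strong unfolding strong_lim_def d_def by (rule tendsto_mult_right_zero)
    show "\<forall>n. (ip (X n) (Z n - z))\<^sup>2 \<le> M * d n"
      using cauchy_schwarz[OF X diff_mem[OF Z]]
        mult_right_mono[OF bound ip_nonneg[OF diff_mem[OF Z]]]
      unfolding d_def by (blast intro: order_trans)
  qed auto
  then have "(\<lambda>n. ip (X n) (Z n - z)) \<longlonglongrightarrow> 0" by simp
  moreover have "(\<lambda>n. ip (X n) z) \<longlonglongrightarrow> ip x z" using weak Z(2) by (simp add: weak_lim_def)
  ultimately have "(\<lambda>n. ip (X n) (Z n - z) + ip (X n) z) \<longlonglongrightarrow> 0 + ip x z" by (rule tendsto_add)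
  then show ?thesis by (simp add: ip_diff_right X Z)
qed

lemma strong_imp_weak_lim:
  assumes "\<And>n. X n \<in> V" "x \<in> V" "strong_lim X x"
  shows "weak_lim X x"
  unfolding weak_lim_def
proof
  fix z assume z: "z \<in> V"
  then have "(\<lambda>n. ip z (X n)) \<longlonglongrightarrow> ip z x"
    using assms by (intro weak_lim_ip_strong_lim[of "\<lambda>_. z" X x "ip z z"]) (auto simp: weak_lim_def)
  then show "(\<lambda>n. ip (X n) z) \<longlonglongrightarrow> ip x z" by (simp add: ip_commute[of _ z] assms z)
qed

lemma strong_lim_ip_self:
  assumes "\<And>n. X n \<in> V" "x \<in> V" "strong_lim X x"
  shows "(\<lambda>n. ip (X n) (X n)) \<longlonglongrightarrow> ip x x"
proof -
  have "(\<lambda>n. ip (X n - x) (X n - x) + 2 * ip (X n) x - ip x x) \<longlonglongrightarrow> 0 + 2 * ip x x - ip x x"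
    using assms strong_imp_weak_lim[OF assms] unfolding strong_lim_def weak_lim_def
    by (intro tendsto_intros) auto
  then show ?thesis by (simp add: ip_diff_self assms)
qed

lemma weak_lim_ip_self_le:
  assumes X: "\<And>n. X n \<in> V" "x \<in> V" and weak: "weak_lim X x" and bound: "\<And>n. ip (X n) (X n) \<le> a"
  shows "ip x x \<le> a"
proof -
  have "(\<lambda>n. 2 * ip (X n) x - ip x x) \<longlonglongrightarrow> 2 * ip x x - ip x x"
    using weak X(2) unfolding weak_lim_def by (intro tendsto_intros) auto
  moreover have "2 * ip (X n) x - ip x x \<le> a" for n
    using ip_nonneg[of "X n - x"] bound[of n] by (simp add: X ip_diff_self diff_mem)
  ultimately have "2 * ip x x - ip x x \<le> a" by (intro LIMSEQ_le_const2) auto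
  then show ?thesis by simp
qed

definition closed_subspace :: "'b set \<Rightarrow> bool" where
  "closed_subspace W \<longleftrightarrow> W \<subseteq> V \<and> subspace W \<and>
     (\<forall>X x. (\<forall>n. X n \<in> W) \<and> x \<in> V \<and> strong_lim X x \<longrightarrow> x \<in> W)"

definition bounded_form_on :: "'b set \<Rightarrow> ('b \<Rightarrow> real) \<Rightarrow> bool" where
  "bounded_form_on W l \<longleftrightarrow> (\<forall>x\<in>W. \<forall>y\<in>W. l (x + y) = l x + l y) \<and>
     (\<forall>x\<in>W. \<forall>a. l (a *\<^sub>R x) = a * l x) \<and> (\<exists>M. \<forall>x\<in>W. (l x)\<^sup>2 \<le> M * ip x x)"

lemma bounded_form_on_ip: "W \<subseteq> V \<Longrightarrow> z \<in> V \<Longrightarrow> bounded_form_on W (ip z)"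
  unfolding bounded_form_on_def
  using cauchy_schwarz[of z] by (metis ip_add_right ip_scaleR_right subsetD)

lemma bounded_form_on_strong_lim:
  assumes W: "subspace W" "W \<subseteq> V" and l: "bounded_form_on W l"
    and X: "\<And>n. X n \<in> W" "x \<in> W" "strong_lim X x"
  shows "(\<lambda>n. l (X n)) \<longlonglongrightarrow> l x"
proof -
  obtain M where M: "\<And>w. w \<in> W \<Longrightarrow> (l w)\<^sup>2 \<le> M * ip w w"
    using l unfolding bounded_form_on_def by blast
  have "(\<lambda>n. (l (X n - x))\<^sup>2) \<longlonglongrightarrow> 0"
  proof (rule tendsto_sandwich[OF always_eventually always_eventually tendsto_const])
    show "(\<lambda>n. M * ip (X n - x) (X n - x)) \<longlonglongrightarrow> 0"
      using X(3) unfolding strong_lim_def by (rule tendsto_mult_right_zero)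
    show "\<forall>n. (l (X n - x))\<^sup>2 \<le> M * ip (X n - x) (X n - x)"
      using M subspace_diff[OF W(1) X(1,2)] by blast
  qed auto
  then have "(\<lambda>n. l (X n - x) + l x) \<longlonglongrightarrow> 0 + l x" by (intro tendsto_intros) simp
  moreover have "l (X n - x) + l x = l (X n)" for n
    using l X subspace_diff[OF W(1) X(1,2)] unfolding bounded_form_on_def by (metis diff_add_cancel)
  ultimately show ?thesis by simp
qed

lemma bounded_form_quadratic_bdd_below:
  assumes W: "W \<subseteq> V" and l: "bounded_form_on W l"
  shows "bdd_below ((\<lambda>w. ip w w - 2 * l w) ` W)"
proof -
  obtain M where M: "\<And>w. w \<in> W \<Longrightarrow> (l w)\<^sup>2 \<le> M * ip w w"
    using l unfolding bounded_form_on_def by blast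
  have "- \<bar>M\<bar> \<le> ip w w - 2 * l w" if w: "w \<in> W" for w
  proof -
    have nonneg: "0 \<le> ip w w" using w W ip_nonneg by auto
    have "(l w)\<^sup>2 \<le> \<bar>M\<bar> * ip w w"
      using M[OF w] mult_right_mono[OF abs_ge_self[of M] nonneg] by linarith
    also have "\<dots> \<le> ((\<bar>M\<bar> + ip w w) / 2)\<^sup>2"
      using sum_squares_bound[of "\<bar>M\<bar>" "ip w w"] by (simp add: power2_eq_square field_simps)
    finally have "l w \<le> (\<bar>M\<bar> + ip w w) / 2"
      by (rule power2_le_imp_le) (use nonneg in simp)
    then show ?thesis by (simp add: field_simps)
  qed
  then show ?thesis by (rule bdd_belowI2)
qed

lemma bounded_form_quadratic_parallelogram:
  assumes W: "subspace W" "W \<subseteq> V" and l: "bounded_form_on W l" and xy: "x \<in> W" "y \<in> W"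
  defines "J \<equiv> \<lambda>w. ip w w - 2 * l w"
  shows "ip (x - y) (x - y) = 2 * J x + 2 * J y - 4 * J ((1/2) *\<^sub>R (x + y))"
proof -
  have V: "x \<in> V" "y \<in> V" using xy W(2) by auto
  have "4 * J ((1/2) *\<^sub>R (x + y)) = ip (x + y) (x + y) - 4 * (l x + l y)"
    using l xy subspace_add[OF W(1) xy] V unfolding J_def bounded_form_on_def
    by (simp add: ip_scaleR_self add_mem power2_eq_square add_divide_distrib)
  then show ?thesis by (simp add: J_def ip_add_self ip_diff_self V)
qed

text \<open>By the parallelogram identity minimizing sequences are Cauchy.\<close>

lemma bounded_form_quadratic_attains_min:
  assumes W: "closed_subspace W" and l: "bounded_form_on W l"
  obtains v where "v \<in> W" "\<And>w. w \<in> W \<Longrightarrow> ip v v - 2 * l v \<le> ip w w - 2 * l w"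
proof -
  have W_subspace: "subspace W" and WV: "W \<subseteq> V" using W by (auto simp: closed_subspace_def)
  have "W \<noteq> {}" using subspace_0[OF W_subspace] by blast
  define J where "J w = ip w w - 2 * l w" for w
  define j where "j = (INF w\<in>W. J w)"
  have bdd: "bdd_below (J ` W)"
    unfolding J_def by (rule bounded_form_quadratic_bdd_below[OF WV l])
  have j_le: "j \<le> J w" if "w \<in> W" for w unfolding j_def by (rule cINF_lower[OF bdd that])
  have "\<exists>w\<in>W. J w < j + inverse (real (Suc n))" for n
    using cINF_less_iff[OF \<open>W \<noteq> {}\<close> bdd, of "j + inverse (real (Suc n))"] by (simp add: j_def)
  then obtain X where X: "\<And>n. X n \<in> W" "\<And>n. J (X n) < j + inverse (real (Suc n))" by metis
  have XV: "X n \<in> V" for n using X(1) WV by auto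
  have J_lim: "(\<lambda>n. J (X n)) \<longlonglongrightarrow> j"
  proof (rule tendsto_sandwich[OF _ _ tendsto_const])
    show "(\<lambda>n. j + inverse (real (Suc n))) \<longlonglongrightarrow> j"
      using tendsto_add[OF tendsto_const LIMSEQ_inverse_real_of_nat, of j] by simp
    show "\<forall>\<^sub>F n in sequentially. j \<le> J (X n)" by (intro always_eventually allI j_le X)
    show "\<forall>\<^sub>F n in sequentially. J (X n) \<le> j + inverse (real (Suc n))"
      by (intro always_eventually allI less_imp_le X)
  qed
  have parallelogram: "ip (X m - X n) (X m - X n) \<le> 2 * J (X m) + 2 * J (X n) - 4 * j" for m n
    using bounded_form_quadratic_parallelogram[OF W_subspace WV l X(1) X(1), of m n]
      j_le[OF subspace_scale[OF W_subspace subspace_add[OF W_subspace X(1) X(1)], of "1/2" m n]]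
    by (simp add: J_def)
  have "\<exists>N. \<forall>m\<ge>N. \<forall>n\<ge>N. ip (X m - X n) (X m - X n) < e" if "e > 0" for e
  proof -
    have "\<forall>\<^sub>F n in sequentially. J (X n) < j + e / 4"
      using order_tendstoD(2)[OF J_lim, of "j + e/4"] that by simp
    then obtain N where N: "\<And>n. n \<ge> N \<Longrightarrow> J (X n) < j + e / 4" by (auto simp: eventually_sequentially)
    have "ip (X m - X n) (X m - X n) < e" if "N \<le> m" "N \<le> n" for m n
      using parallelogram[of m n] N[OF that(1)] N[OF that(2)] by linarith
    then show ?thesis by blast
  qed
  from complete[of X, OF XV this] obtain v where v: "v \<in> V" "strong_lim X v"
    by (auto simp: strong_lim_def)
  then have "v \<in> W" using W X(1) unfolding closed_subspace_def by blast
  moreover have "(\<lambda>n. J (X n)) \<longlonglongrightarrow> J v"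
    unfolding J_def
    by (intro tendsto_intros strong_lim_ip_self[OF XV v]
        bounded_form_on_strong_lim[OF W_subspace WV l X(1) \<open>v \<in> W\<close> v(2)])
  then have "J v = j" using J_lim LIMSEQ_unique by blast
  ultimately show ?thesis using that j_le by (auto simp: J_def)
qed

theorem riesz_representation:
  assumes W: "closed_subspace W" and l: "bounded_form_on W l"
  shows "\<exists>v\<in>W. \<forall>w\<in>W. ip v w = l w"
proof -
  have W_subspace: "subspace W" and WV: "W \<subseteq> V" using W by (auto simp: closed_subspace_def)
  obtain v where v: "v \<in> W" and minimal: "\<And>w. w \<in> W \<Longrightarrow> ip v v - 2 * l v \<le> ip w w - 2 * l w"
    using bounded_form_quadratic_attains_min[OF W l] by blast
  have "ip v w = l w" if w: "w \<in> W" for w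
  proof -
    have V: "v \<in> V" "w \<in> V" using v w WV by auto
    have "0 \<le> 0 + 2 * s * (ip v w - l w) + s\<^sup>2 * ip w w" for s
    proof -
      have "l (v + s *\<^sub>R w) = l v + s * l w"
        using l v w subspace_scale[OF W_subspace] by (auto simp: bounded_form_on_def)
      then show ?thesis
        using minimal[OF subspace_add[OF W_subspace v subspace_scale[OF W_subspace w, of s]]]
        by (simp add: V ip_add_self ip_scaleR_left ip_scaleR_right scaleR_mem power2_eq_square
            algebra_simps)
    qed
    then have "(ip v w - l w)\<^sup>2 \<le> 0 * ip w w"
      by (rule nonneg_quadratic_imp_discriminant_nonpos) (rule ip_nonneg[OF V(2)])
    then show ?thesis by simp
  qed
  with v show ?thesis by blast
qed

lemma closed_subspace_convergent_ip:
  assumes X: "\<And>n::nat. X n \<in> V" and bound: "\<And>n. ip (X n) (X n) \<le> M"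
  shows "closed_subspace {z \<in> V. convergent (\<lambda>n. ip (X n) z)}" (is "closed_subspace ?Z")
  unfolding closed_subspace_def
proof (intro conjI allI impI)
  show "subspace ?Z"
    unfolding subspace_def
  proof (intro conjI ballI allI)
    show "0 \<in> ?Z" by (simp add: ip_zero_right X subspace_0[OF subspace] convergent_const)
    fix x assume x: "x \<in> ?Z"
    then have "convergent (\<lambda>n. a * ip (X n) x)" for a
      by (intro convergent_mult convergent_const) simp
    then show "a *\<^sub>R x \<in> ?Z" for a using x by (simp add: ip_scaleR_right X scaleR_mem)
    fix y assume y: "y \<in> ?Z"
    have "convergent (\<lambda>n. ip (X n) x + ip (X n) y)" using x y by (intro convergent_add) auto
    then show "x + y \<in> ?Z" using x y by (simp add: ip_add_right X add_mem)
  qed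
  fix zs z assume zs: "(\<forall>i. zs i \<in> ?Z) \<and> z \<in> V \<and> strong_lim zs z"
  then have z: "z \<in> V" and zs_mem: "\<And>i. zs i \<in> V"
    and zs_conv: "\<And>i. convergent (\<lambda>n. ip (X n) (zs i))" by auto
  have "convergent (\<lambda>n. ip (X n) z)"
  proof (rule convergent_if_uniformly_approximable)
    fix e :: real assume e: "e > 0"
    have "(\<lambda>i. M * ip (zs i - z) (zs i - z)) \<longlonglongrightarrow> 0"
      using zs unfolding strong_lim_def by (intro tendsto_mult_right_zero) blast
    from order_tendstoD(2)[OF this, of "e\<^sup>2"] e
    obtain i where i: "M * ip (zs i - z) (zs i - z) < e\<^sup>2" by (auto simp: eventually_sequentially)
    have "\<bar>ip (X n) (zs i) - ip (X n) z\<bar> < e" for n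
    proof -
      have "(ip (X n) (zs i - z))\<^sup>2 \<le> ip (X n) (X n) * ip (zs i - z) (zs i - z)"
        by (intro cauchy_schwarz X diff_mem zs_mem z)
      also have "\<dots> \<le> M * ip (zs i - z) (zs i - z)"
        by (intro mult_right_mono bound ip_nonneg diff_mem zs_mem z)
      finally have "\<bar>ip (X n) (zs i - z)\<bar>\<^sup>2 < e\<^sup>2" using i by simp
      then have "\<bar>ip (X n) (zs i - z)\<bar> < e" by (rule power2_less_imp_less) (use e in simp)
      then show ?thesis by (simp add: ip_diff_right X zs_mem z)
    qed
    with zs_conv show "\<exists>g. convergent g \<and> (\<forall>n. \<bar>g n - ip (X n) z\<bar> < e)" by blast
  qed
  then show "z \<in> ?Z" using z by simp
qed auto

lemma closed_subspace_whole: "closed_subspace V"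
  by (simp add: closed_subspace_def subspace)

lemma orthogonal_projection:
  assumes "closed_subspace W" "z \<in> V"
  obtains p where "p \<in> W" "\<And>w. w \<in> W \<Longrightarrow> ip w p = ip w z"
proof -
  have WV: "W \<subseteq> V" using assms(1) by (simp add: closed_subspace_def)
  obtain p where "p \<in> W" "\<forall>w\<in>W. ip p w = ip z w"
    using riesz_representation[OF assms(1) bounded_form_on_ip[OF WV assms(2)]] by blast
  with that WV assms(2) show ?thesis by (metis ip_commute subsetD)
qed

lemma weak_lim_exists:
  assumes X: "\<And>n. X n \<in> V" and bound: "\<And>n. ip (X n) (X n) \<le> M"
    and conv: "\<And>z. z \<in> V \<Longrightarrow> convergent (\<lambda>n. ip (X n) z)"
  obtains x where "x \<in> V" "weak_lim X x"
proof -
  define l where "l z = lim (\<lambda>n. ip (X n) z)" for z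
  have l: "(\<lambda>n. ip (X n) z) \<longlonglongrightarrow> l z" if "z \<in> V" for z
    using conv[OF that] by (simp add: l_def convergent_LIMSEQ_iff)
  have "bounded_form_on V l"
    unfolding bounded_form_on_def
  proof (intro conjI ballI allI exI[of _ M])
    fix x y assume xy: "x \<in> V" "y \<in> V"
    have "(\<lambda>n. ip (X n) (x + y)) \<longlonglongrightarrow> l x + l y"
      using tendsto_add[OF l[OF xy(1)] l[OF xy(2)]] by (simp add: ip_add_right X xy)
    then show "l (x + y) = l x + l y" using l[OF add_mem[OF xy]] LIMSEQ_unique by blast
  next
    fix x and a :: real assume x: "x \<in> V"
    have "(\<lambda>n. ip (X n) (a *\<^sub>R x)) \<longlonglongrightarrow> a * l x"
      using tendsto_mult_left[OF l[OF x]] by (simp add: ip_scaleR_right X x)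
    then show "l (a *\<^sub>R x) = a * l x" using l[OF scaleR_mem[OF x]] LIMSEQ_unique by blast
  next
    fix x assume x: "x \<in> V"
    have "(ip (X n) x)\<^sup>2 \<le> M * ip x x" for n
      using cauchy_schwarz[OF X x] mult_right_mono[OF bound ip_nonneg[OF x]] order_trans by blast
    then show "(l x)\<^sup>2 \<le> M * ip x x" by (intro LIMSEQ_le_const2[OF tendsto_power[OF l[OF x]]]) auto
  qed
  then obtain x where "x \<in> V" "\<forall>z\<in>V. ip x z = l z"
    using riesz_representation[OF closed_subspace_whole] by blast
  with l that show ?thesis by (simp add: weak_lim_def)
qed

text \<open>The test vectors along which a subsequence converges form a closed subspace; as it contains
  all \<open>X k\<close>, every vector may be replaced by its projection to that subspace.\<close>

theorem bounded_imp_weakly_convergent_subsequence: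
  assumes X: "\<And>n::nat. X n \<in> V" and bound: "\<And>n. ip (X n) (X n) \<le> M"
  obtains r x where "strict_mono r" "x \<in> V" "weak_lim (X \<circ> r) x"
proof -
  have ip_bound: "\<bar>ip (X n) (X k)\<bar> \<le> \<bar>M\<bar>" for n k
  proof -
    have "(ip (X n) (X k))\<^sup>2 \<le> M * M"
      using cauchy_schwarz[OF X X] mult_mono'[OF bound bound ip_nonneg[OF X] ip_nonneg[OF X]]
      by (rule order_trans)
    then show ?thesis by (simp add: abs_le_square_iff power2_eq_square)
  qed
  obtain r where r: "strict_mono r" "\<And>k. convergent (\<lambda>n. ip (X (r n)) (X k))"
    using bounded_real_sequences_convergent_subsequence[of "\<lambda>n k. ip (X n) (X k)", OF ip_bound]
    by blast
  define Z where "Z = {z \<in> V. convergent (\<lambda>n. ip (X (r n)) z)}"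
  have Z: "closed_subspace Z"
    unfolding Z_def by (rule closed_subspace_convergent_ip[OF X bound])
  have "convergent (\<lambda>n. ip (X (r n)) z)" if z: "z \<in> V" for z
  proof -
    obtain p where p: "p \<in> Z" "\<And>w. w \<in> Z \<Longrightarrow> ip w p = ip w z"
      using orthogonal_projection[OF Z z] by blast
    have "X k \<in> Z" for k using r(2) X by (simp add: Z_def)
    then show ?thesis using p by (simp add: Z_def)
  qed
  then obtain x where "x \<in> V" "weak_lim (X \<circ> r) x"
    using weak_lim_exists[of "X \<circ> r" M] X bound by auto
  with r(1) that show ?thesis by blast
qed

end

interpretation Hilbert: semi_hilbert "UNIV :: 'a::{real_inner,banach} set" inner
proof
  fix X :: "nat \<Rightarrow> 'a"
  assume small: "\<And>e. e > 0 \<Longrightarrow> \<exists>N. \<forall>m\<ge>N. \<forall>n\<ge>N. inner (X m - X n) (X m - X n) < e"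
  have "Cauchy X"
  proof (rule CauchyI)
    fix e :: real assume e: "0 < e"
    then obtain N where N: "\<And>m n. m \<ge> N \<Longrightarrow> n \<ge> N \<Longrightarrow> (norm (X m - X n))\<^sup>2 < e\<^sup>2"
      using small[of "e\<^sup>2"] by (auto simp: power2_norm_eq_inner)
    then show "\<exists>M. \<forall>m\<ge>M. \<forall>n\<ge>M. norm (X m - X n) < e"
      using e by (intro exI[of _ N] allI impI power2_less_imp_less[of _ e]) auto
  qed
  then obtain x where "X \<longlonglongrightarrow> x" by (auto simp: Cauchy_convergent_iff convergent_def)
  then have "(\<lambda>n. inner (X n - x) (X n - x)) \<longlonglongrightarrow> inner (x - x) (x - x)" by (intro tendsto_intros)
  then show "\<exists>x\<in>UNIV. (\<lambda>n. inner (X n - x) (X n - x)) \<longlonglongrightarrow> 0" by auto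
qed (simp_all add: inner_add_left, simp add: inner_commute)

section \<open>Square integrable functions\<close>

definition square_integrable ::
  "'b measure \<Rightarrow> ('b \<Rightarrow> 'a::{banach,second_countable_topology}) set" where
  "square_integrable M = {u \<in> borel_measurable M. integrable M (\<lambda>x. (norm (u x))\<^sup>2)}"

definition L2_inner ::
  "'b measure \<Rightarrow> ('b \<Rightarrow> 'a::{real_inner,banach,second_countable_topology}) \<Rightarrow> ('b \<Rightarrow> 'a) \<Rightarrow> real"
  where
  "L2_inner M u v = (LINT x|M. inner (u x) (v x))"

lemma
  assumes "u \<in> square_integrable M"
  shows square_integrable_measurable: "u \<in> borel_measurable M"
    and integrable_norm_square: "integrable M (\<lambda>x. (norm (u x))\<^sup>2)"
  using assms by (auto simp: square_integrable_def)

lemma L2_inner_self: "L2_inner M u u = (LINT x|M. (norm (u x))\<^sup>2)"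
  by (simp add: L2_inner_def power2_norm_eq_inner)

lemma L2_inner_self_eq_0_iff:
  "u \<in> square_integrable M \<Longrightarrow> L2_inner M u u = 0 \<longleftrightarrow> (AE x in M. u x = 0)"
  by (simp add: L2_inner_self integral_nonneg_eq_0_iff_AE integrable_norm_square)

lemma nn_integral_norm_square:
  "u \<in> square_integrable M \<Longrightarrow> (\<integral>\<^sup>+x. ennreal ((norm (u x))\<^sup>2) \<partial>M) = ennreal (L2_inner M u u)"
  unfolding L2_inner_self by (intro nn_integral_eq_integral integrable_norm_square) auto

lemma square_integrable_iff_nn_integral:
  assumes [measurable]: "u \<in> borel_measurable M"
  shows "u \<in> square_integrable M \<longleftrightarrow> (\<integral>\<^sup>+x. ennreal ((norm (u x))\<^sup>2) \<partial>M) < \<infinity>"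
  by (simp add: square_integrable_def integrable_iff_bounded)

lemma subspace_square_integrable:
  "subspace (square_integrable M :: ('b \<Rightarrow> 'a::{banach,second_countable_topology}) set)"
  unfolding subspace_def
proof (intro conjI ballI allI)
  show "0 \<in> square_integrable M" by (simp add: square_integrable_def zero_fun_def)
next
  fix u v :: "'b \<Rightarrow> 'a" assume u: "u \<in> square_integrable M" and v: "v \<in> square_integrable M"
  note [measurable] = u[THEN square_integrable_measurable] v[THEN square_integrable_measurable]
  have norm_add_square_le: "(norm (a + b))\<^sup>2 \<le> 2 * (norm a)\<^sup>2 + 2 * (norm b)\<^sup>2" for a b :: 'a
    using power_mono[OF norm_triangle_ineq[of a b] norm_ge_zero, of 2]
      sum_squares_bound[of "norm a" "norm b"] by (simp add: power2_sum)
  have "integrable M (\<lambda>x. 2 * (norm (u x))\<^sup>2 + 2 * (norm (v x))\<^sup>2)"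
    using u v
    by (intro Bochner_Integration.integrable_add integrable_mult_right integrable_norm_square)
  then have "integrable M (\<lambda>x. (norm (u x + v x))\<^sup>2)"
    by (rule Bochner_Integration.integrable_bound) (use norm_add_square_le in auto)
  then show "u + v \<in> square_integrable M" by (simp add: square_integrable_def plus_fun_def)
next
  fix c :: real and u :: "'b \<Rightarrow> 'a" assume "u \<in> square_integrable M"
  then show "c *\<^sub>R u \<in> square_integrable M"
    by (auto simp: square_integrable_def scaleR_fun_def power_mult_distrib)
qed

lemma integrable_inner:
  fixes u v :: "'b \<Rightarrow> 'a::{real_inner,banach,second_countable_topology}"
  assumes u: "u \<in> square_integrable M" and v: "v \<in> square_integrable M"
  shows "integrable M (\<lambda>x. inner (u x) (v x))"
proof (rule Bochner_Integration.integrable_bound)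
  note [measurable] = u[THEN square_integrable_measurable] v[THEN square_integrable_measurable]
  show "integrable M (\<lambda>x. (norm (u x))\<^sup>2 + (norm (v x))\<^sup>2)"
    by (intro Bochner_Integration.integrable_add integrable_norm_square u v)
  show "(\<lambda>x. inner (u x) (v x)) \<in> borel_measurable M" by measurable
  have "norm (inner a b) \<le> norm ((norm a)\<^sup>2 + (norm b)\<^sup>2)" for a b :: 'a
    using Cauchy_Schwarz_ineq2[of a b] sum_squares_bound[of "norm a" "norm b"] by simp
  then show "AE x in M. norm (inner (u x) (v x)) \<le> norm ((norm (u x))\<^sup>2 + (norm (v x))\<^sup>2)" by simp
qed

lemma L2_inner_AE_cong:
  assumes "u \<in> square_integrable M" "u' \<in> square_integrable M" "AE x in M. u x = u' x"
    and "v \<in> square_integrable M" "v' \<in> square_integrable M" "AE x in M. v x = v' x"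
  shows "L2_inner M u v = L2_inner M u' v'"
proof -
  note [measurable] = assms(1,2,4,5)[THEN square_integrable_measurable]
  show ?thesis unfolding L2_inner_def using assms(3,6) by (intro integral_cong_AE) auto
qed

lemma square_integrable_bounded:
  assumes "finite_measure M" and [measurable]: "u \<in> borel_measurable M"
    and bound: "\<And>x. x \<in> space M \<Longrightarrow> norm (u x) \<le> B"
  shows "u \<in> square_integrable M"
proof -
  have "integrable M (\<lambda>x. (norm (u x))\<^sup>2)"
  proof (rule finite_measure.integrable_const_bound[OF assms(1)])
    show "AE x in M. norm ((norm (u x))\<^sup>2) \<le> B\<^sup>2"
      using bound by (intro AE_I2) (auto intro: power_mono)
  qed measurable
  then show ?thesis by (simp add: square_integrable_def)
qed

lemma square_integrable_imp_integrable:
  fixes u :: "'b \<Rightarrow> 'a::{banach,second_countable_topology}"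
  assumes "finite_measure M" and u: "u \<in> square_integrable M"
  shows "integrable M u"
proof (rule Bochner_Integration.integrable_bound)
  interpret finite_measure M by fact
  show "integrable M (\<lambda>x. 1 + (norm (u x))\<^sup>2)"
    by (intro Bochner_Integration.integrable_add integrable_norm_square u) simp
  have "norm a \<le> norm (1 + (norm a)\<^sup>2)" for a :: 'a
    using sum_squares_bound[of 1 "norm a"] norm_ge_zero[of a] by (simp del: norm_ge_zero)
  then show "AE x in M. norm (u x) \<le> norm (1 + (norm (u x))\<^sup>2)" by simp
qed (rule square_integrable_measurable[OF u])

lemma square_integrable_indicator:
  assumes v: "v \<in> square_integrable M" and [measurable]: "A \<in> sets M"
  shows "(\<lambda>x. indicator A x *\<^sub>R v x) \<in> square_integrable M"
    and "L2_inner M (\<lambda>x. indicator A x *\<^sub>R v x) (\<lambda>x. indicator A x *\<^sub>R v x) \<le> L2_inner M v v"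
proof -
  note [measurable] = v[THEN square_integrable_measurable]
  have norm_eq: "(norm (indicator A x *\<^sub>R v x))\<^sup>2 = indicator A x *\<^sub>R (norm (v x))\<^sup>2" for x
    by (auto simp: indicator_def)
  have indicator_int: "integrable M (\<lambda>x. (norm (indicator A x *\<^sub>R v x))\<^sup>2)"
    unfolding norm_eq by (intro integrable_mult_indicator integrable_norm_square v) simp
  then show "(\<lambda>x. indicator A x *\<^sub>R v x) \<in> square_integrable M" by (simp add: square_integrable_def)
  show "L2_inner M (\<lambda>x. indicator A x *\<^sub>R v x) (\<lambda>x. indicator A x *\<^sub>R v x) \<le> L2_inner M v v"
    unfolding L2_inner_self using indicator_int integrable_norm_square[OF v]
    by (rule integral_mono) (auto simp: indicator_def)
qed

lemma rapidly_Cauchy_subsequence: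
  fixes q :: "nat \<Rightarrow> nat \<Rightarrow> real" and \<delta> :: "nat \<Rightarrow> real"
  assumes cauchy: "\<And>e. e > 0 \<Longrightarrow> \<exists>N. \<forall>m\<ge>N. \<forall>n\<ge>N. q m n < e" and \<delta>: "\<And>k. \<delta> k > 0"
  obtains r where "strict_mono r" "\<And>k. q (r (Suc k)) (r k) < \<delta> k"
proof -
  have "\<exists>r. \<forall>k. (\<forall>m\<ge>r k. q m (r k) < \<delta> k) \<and> r k < r (Suc k)"
  proof (rule dependent_nat_choice)
    show "\<exists>n. \<forall>m\<ge>n. q m n < \<delta> 0" using cauchy[OF \<delta>] by blast
  next
    fix n k
    obtain N where "\<forall>m\<ge>N. \<forall>n\<ge>N. q m n < \<delta> (Suc k)" using cauchy[OF \<delta>] by blast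
    then show "\<exists>y. (\<forall>m\<ge>y. q m y < \<delta> (Suc k)) \<and> n < y" by (intro exI[of _ "N + n + 1"]) auto
  qed
  then obtain r where "\<And>k. \<forall>m\<ge>r k. q m (r k) < \<delta> k" "\<And>k. r k < r (Suc k)" by blast
  with that show ?thesis by (meson less_imp_le strict_mono_Suc_iff)
qed

lemma summable_of_weighted_squares:
  fixes d :: "nat \<Rightarrow> real"
  assumes "summable (\<lambda>k. 4 ^ k * (d k)\<^sup>2)"
  shows "summable d"
proof (rule summable_comparison_test)
  show "summable (\<lambda>k. 4 ^ k * (d k)\<^sup>2 + (1/4) ^ k)"
    using assms by (intro summable_add summable_geometric) auto
  have "\<bar>d k\<bar> \<le> 4 ^ k * (d k)\<^sup>2 + (1/4) ^ k" for k
  proof -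
    have "2 * (2 ^ k * \<bar>d k\<bar>) * (1/2) ^ k \<le> (2 ^ k * \<bar>d k\<bar>)\<^sup>2 + ((1/2) ^ k)\<^sup>2"
      by (rule sum_squares_bound)
    also have "\<dots> = 4 ^ k * (d k)\<^sup>2 + (1/4) ^ k"
      using power_mult_distrib[of "2::real" 2 k] power_mult_distrib[of "1/2::real" "1/2" k]
      by (simp add: power2_eq_square)
    finally have "2 * \<bar>d k\<bar> \<le> 4 ^ k * (d k)\<^sup>2 + (1/4) ^ k" by (simp add: power_one_over)
    then show ?thesis using abs_ge_zero[of "d k"] by linarith
  qed
  then show "\<exists>N. \<forall>k\<ge>N. norm (d k) \<le> 4 ^ k * (d k)\<^sup>2 + (1/4) ^ k" by simp
qed

lemma AE_convergent_of_summable_increments: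
  fixes Y :: "nat \<Rightarrow> 'b \<Rightarrow> 'a::{real_inner,banach,second_countable_topology}"
  assumes Y: "\<And>k. Y k \<in> square_integrable M"
    and small: "\<And>k. L2_inner M (Y (Suc k) - Y k) (Y (Suc k) - Y k) \<le> (1/8) ^ k"
  shows "AE x in M. convergent (\<lambda>k. Y k x)"
proof -
  note [measurable] = Y[THEN square_integrable_measurable]
  define D where "D k x = (norm (Y (Suc k) x - Y k x))\<^sup>2" for k x
  have [measurable]: "D k \<in> borel_measurable M" for k unfolding D_def by measurable
  have D_int: "(\<integral>\<^sup>+x. ennreal (4 ^ k * D k x) \<partial>M) \<le> ennreal ((1/2) ^ k)" for k
  proof -
    have "(\<integral>\<^sup>+x. ennreal (4 ^ k * D k x) \<partial>M) = ennreal (4 ^ k) * (\<integral>\<^sup>+x. ennreal (D k x) \<partial>M)"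
      by (simp add: ennreal_mult nn_integral_cmult D_def)
    also have "(\<integral>\<^sup>+x. ennreal (D k x) \<partial>M) =
        ennreal (L2_inner M (Y (Suc k) - Y k) (Y (Suc k) - Y k))"
      using nn_integral_norm_square[OF subspace_diff[OF subspace_square_integrable Y Y]]
      by (simp add: D_def)
    also have "ennreal (4 ^ k) * \<dots> \<le> ennreal (4 ^ k) * ennreal ((1/8) ^ k)"
      by (intro mult_left_mono ennreal_leI small) simp
    also have "\<dots> = ennreal ((1/2) ^ k)" by (simp flip: ennreal_mult power_mult_distrib)
    finally show ?thesis .
  qed
  have "(\<integral>\<^sup>+x. (\<Sum>k. ennreal (4 ^ k * D k x)) \<partial>M) = (\<Sum>k. \<integral>\<^sup>+x. ennreal (4 ^ k * D k x) \<partial>M)"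
    by (rule nn_integral_suminf) simp
  also have "\<dots> \<le> (\<Sum>k. ennreal ((1/2) ^ k))" by (intro suminf_le D_int) auto
  also have "\<dots> = ennreal (\<Sum>k. (1/2) ^ k)" by (rule suminf_ennreal2) (auto intro: summable_geometric)
  finally have "(\<integral>\<^sup>+x. (\<Sum>k. ennreal (4 ^ k * D k x)) \<partial>M) \<noteq> \<infinity>" by (auto simp: top_unique)
  then have "AE x in M. (\<Sum>k. ennreal (4 ^ k * D k x)) \<noteq> \<infinity>" by (intro nn_integral_PInf_AE) auto
  then show ?thesis
  proof eventually_elim
    case (elim x)
    have "summable (\<lambda>k. 4 ^ k * D k x)"
      using elim by (intro summable_suminf_not_top) (auto simp: D_def)
    then have "summable (\<lambda>k. norm (Y (Suc k) x - Y k x))"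
      using summable_of_weighted_squares by (simp add: D_def)
    then have "summable (\<lambda>k. Y (Suc k) x - Y k x)" by (rule summable_norm_cancel)
    then have "convergent (\<lambda>n. \<Sum>k<n. Y (Suc k) x - Y k x)" by (simp add: summable_iff_convergent)
    then have "convergent (\<lambda>n. Y n x - Y 0 x)" by (simp add: sum_lessThan_telescope[of "\<lambda>k. Y k x"])
    from convergent_add[OF this convergent_const[of "Y 0 x"]] show ?case by simp
  qed
qed

lemma L2_inner_diff_limit_le:
  fixes Y :: "nat \<Rightarrow> 'b \<Rightarrow> 'a::{real_inner,banach,second_countable_topology}"
  assumes Y: "\<And>k. Y k \<in> square_integrable M" and [measurable]: "v \<in> borel_measurable M"
    and lim: "AE x in M. (\<lambda>k. Y k x) \<longlonglongrightarrow> v x" and u: "u \<in> square_integrable M"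
    and bound: "\<forall>\<^sub>F k in sequentially. L2_inner M (Y k - u) (Y k - u) \<le> e"
  shows "v - u \<in> square_integrable M" "L2_inner M (v - u) (v - u) \<le> e"
proof -
  note [measurable] = Y[THEN square_integrable_measurable] u[THEN square_integrable_measurable]
  have Yu: "Y k - u \<in> square_integrable M" for k
    by (rule subspace_diff[OF subspace_square_integrable Y u])
  have "0 \<le> L2_inner M (Y k - u) (Y k - u)" for k by (simp add: L2_inner_self)
  then have e: "0 \<le> e"
    using eventually_happens[OF bound] order_trans by (auto simp: trivial_limit_sequentially)
  have "(\<integral>\<^sup>+x. ennreal ((norm ((v - u) x))\<^sup>2) \<partial>M)
      = (\<integral>\<^sup>+x. liminf (\<lambda>k. ennreal ((norm ((Y k - u) x))\<^sup>2)) \<partial>M)"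
  proof (rule nn_integral_cong_AE)
    show "AE x in M. ennreal ((norm ((v - u) x))\<^sup>2) = liminf (\<lambda>k. ennreal ((norm ((Y k - u) x))\<^sup>2))"
      using lim
    proof eventually_elim
      case (elim x)
      then have "(\<lambda>k. ennreal ((norm ((Y k - u) x))\<^sup>2)) \<longlonglongrightarrow> ennreal ((norm ((v - u) x))\<^sup>2)"
        by (simp, intro tendsto_intros)
      then show ?case by (rule lim_imp_Liminf[OF sequentially_bot, symmetric])
    qed
  qed
  also have "\<dots> \<le> liminf (\<lambda>k. \<integral>\<^sup>+x. ennreal ((norm ((Y k - u) x))\<^sup>2) \<partial>M)"
    by (rule nn_integral_liminf) simp
  also have "\<dots> = liminf (\<lambda>k. ennreal (L2_inner M (Y k - u) (Y k - u)))"
    by (simp only: nn_integral_norm_square[OF Yu])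
  also have "\<dots> \<le> liminf (\<lambda>k. ennreal e)"
    by (rule Liminf_mono, rule eventually_mono[OF bound]) (rule ennreal_leI)
  finally have nn_integral_le: "(\<integral>\<^sup>+x. ennreal ((norm ((v - u) x))\<^sup>2) \<partial>M) \<le> ennreal e"
    by (simp add: Liminf_const)
  then have "(\<integral>\<^sup>+x. ennreal ((norm ((v - u) x))\<^sup>2) \<partial>M) < \<infinity>" by (rule le_less_trans) simp
  then show vu: "v - u \<in> square_integrable M"
    by (simp add: square_integrable_iff_nn_integral fun_diff_def)
  show "L2_inner M (v - u) (v - u) \<le> e" using nn_integral_le e
    unfolding nn_integral_norm_square[OF vu] by simp
qed

lemma L2_Cauchy_imp_AE_convergent_subsequence:
  fixes X :: "nat \<Rightarrow> 'b \<Rightarrow> 'a::{real_inner,banach,second_countable_topology}"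
  assumes X: "\<And>n. X n \<in> square_integrable M"
    and cauchy: "\<And>e. e > 0 \<Longrightarrow> \<exists>N. \<forall>m\<ge>N. \<forall>n\<ge>N. L2_inner M (X m - X n) (X m - X n) < e"
  obtains r v where "strict_mono r" "v \<in> borel_measurable M" "AE x in M. (\<lambda>k. X (r k) x) \<longlonglongrightarrow> v x"
proof -
  note [measurable] = X[THEN square_integrable_measurable]
  obtain r where r: "strict_mono r"
    "\<And>k. L2_inner M (X (r (Suc k)) - X (r k)) (X (r (Suc k)) - X (r k)) < (1/8) ^ k"
    by (rule rapidly_Cauchy_subsequence[of "\<lambda>m n. L2_inner M (X m - X n) (X m - X n)"
        "\<lambda>k. (1/8) ^ k"]) (use cauchy in auto)
  have "AE x in M. (\<lambda>k. X (r k) x) \<longlonglongrightarrow> lim (\<lambda>k. X (r k) x)"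
    using AE_convergent_of_summable_increments[of "\<lambda>k. X (r k)", OF X less_imp_le[OF r(2)]]
    by (simp add: convergent_LIMSEQ_iff)
  then show ?thesis using that[OF r(1), of "\<lambda>x. lim (\<lambda>k. X (r k) x)"] by simp
qed

lemma square_integrable_complete:
  fixes X :: "nat \<Rightarrow> 'b \<Rightarrow> 'a::{real_inner,banach,second_countable_topology}"
  assumes X: "\<And>n. X n \<in> square_integrable M"
    and cauchy: "\<And>e. e > 0 \<Longrightarrow> \<exists>N. \<forall>m\<ge>N. \<forall>n\<ge>N. L2_inner M (X m - X n) (X m - X n) < e"
  shows "\<exists>v\<in>square_integrable M. (\<lambda>n. L2_inner M (X n - v) (X n - v)) \<longlonglongrightarrow> 0"
proof -
  obtain r v where r: "strict_mono r" and v: "v \<in> borel_measurable M"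
    and lim: "AE x in M. (\<lambda>k. X (r k) x) \<longlonglongrightarrow> v x"
    using L2_Cauchy_imp_AE_convergent_subsequence[OF X cauchy] .
  have close: "v - X n \<in> square_integrable M" "L2_inner M (X n - v) (X n - v) \<le> e"
    if "\<And>m. m \<ge> N \<Longrightarrow> L2_inner M (X m - X n) (X m - X n) < e" for n N e
  proof -
    have "\<forall>\<^sub>F k in sequentially. L2_inner M (X (r k) - X n) (X (r k) - X n) \<le> e"
      using eventually_ge_at_top[of N]
      by eventually_elim (use that seq_suble[OF r] in \<open>meson less_imp_le order_trans\<close>)
    note limit = L2_inner_diff_limit_le[OF X v lim X this]
    show "v - X n \<in> square_integrable M" by (rule limit(1))
    show "L2_inner M (X n - v) (X n - v) \<le> e"
      using limit(2) by (simp add: L2_inner_self norm_minus_commute)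
  qed
  obtain N where "\<forall>m\<ge>N. \<forall>n\<ge>N. L2_inner M (X m - X n) (X m - X n) < 1" using cauchy[of 1] by auto
  then have "v - X N \<in> square_integrable M" using close(1)[of N N 1] by blast
  from subspace_add[OF subspace_square_integrable this X[of N]] have "v \<in> square_integrable M"
    by simp
  moreover have "(\<lambda>n. L2_inner M (X n - v) (X n - v)) \<longlonglongrightarrow> 0"
  proof (rule LIMSEQ_I)
    fix e :: real assume e: "e > 0"
    then obtain N where N: "\<forall>m\<ge>N. \<forall>n\<ge>N. L2_inner M (X m - X n) (X m - X n) < e / 2"
      using cauchy[of "e/2"] by auto
    have "norm (L2_inner M (X n - v) (X n - v) - 0) < e" if "n \<ge> N" for n
    proof -
      have "0 \<le> L2_inner M (X n - v) (X n - v)" by (simp add: L2_inner_self)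
      then show ?thesis using close(2)[of N n "e/2"] N e that by simp
    qed
    then show "\<exists>N. \<forall>n\<ge>N. norm (L2_inner M (X n - v) (X n - v) - 0) < e" by blast
  qed
  ultimately show ?thesis by blast
qed

lemma semi_hilbert_square_integrable:
  "semi_hilbert (square_integrable M ::
     ('b \<Rightarrow> 'a::{real_inner,banach,second_countable_topology}) set) (L2_inner M)"
proof
  fix x y z :: "'b \<Rightarrow> 'a" and a :: real
  assume x: "x \<in> square_integrable M" and y: "y \<in> square_integrable M"
  show "L2_inner M (a *\<^sub>R x) y = a * L2_inner M x y" by (simp add: L2_inner_def)
  show "L2_inner M x y = L2_inner M y x" by (simp add: L2_inner_def inner_commute)
  assume z: "z \<in> square_integrable M"
  show "L2_inner M (x + y) z = L2_inner M x z + L2_inner M y z"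
    using integrable_inner[OF x z] integrable_inner[OF y z]
    by (simp add: L2_inner_def inner_add_left)
next
  fix x :: "'b \<Rightarrow> 'a"
  show "0 \<le> L2_inner M x x" by (simp add: L2_inner_self)
qed (fact subspace_square_integrable square_integrable_complete)+

lemma L2_dominated_convergence:
  fixes Z :: "nat \<Rightarrow> 'b \<Rightarrow> 'a::{real_inner,banach,second_countable_topology}"
  assumes "finite_measure M"
    and meas: "\<And>n. Z n \<in> borel_measurable M" "z \<in> borel_measurable M"
    and bound: "\<And>n x. x \<in> space M \<Longrightarrow> norm (Z n x) \<le> B"
    and lim: "\<And>x. x \<in> space M \<Longrightarrow> (\<lambda>n. Z n x) \<longlonglongrightarrow> z x"
  shows "(\<lambda>n. L2_inner M (Z n - z) (Z n - z)) \<longlonglongrightarrow> 0"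
proof -
  interpret finite_measure M by fact
  note [measurable] = meas
  have z_bound: "norm (z x) \<le> B" if "x \<in> space M" for x
    by (rule LIMSEQ_le_const2[OF tendsto_norm[OF lim[OF that]]]) (use bound[OF that] in auto)
  have "(\<lambda>n. LINT x|M. (norm (Z n x - z x))\<^sup>2) \<longlonglongrightarrow> (LINT x|M. 0)"
  proof (rule integral_dominated_convergence[where w = "\<lambda>_. (2 * B)\<^sup>2"])
    show "AE x in M. (\<lambda>n. (norm (Z n x - z x))\<^sup>2) \<longlonglongrightarrow> 0"
    proof (rule AE_I2)
      fix x assume "x \<in> space M"
      then have "(\<lambda>n. (norm (Z n x - z x))\<^sup>2) \<longlonglongrightarrow> (norm (z x - z x))\<^sup>2" by (intro tendsto_intros lim)
      then show "(\<lambda>n. (norm (Z n x - z x))\<^sup>2) \<longlonglongrightarrow> 0" by simp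
    qed
    show "AE x in M. norm ((norm (Z n x - z x))\<^sup>2) \<le> (2 * B)\<^sup>2" for n
    proof (rule AE_I2)
      fix x assume x: "x \<in> space M"
      have "norm (Z n x - z x) \<le> 2 * B"
        using norm_triangle_ineq4[of "Z n x" "z x"] bound[OF x, of n] z_bound[OF x] by simp
      then show "norm ((norm (Z n x - z x))\<^sup>2) \<le> (2 * B)\<^sup>2" using power_mono[of _ "2 * B" 2] by simp
    qed
  qed auto
  then show ?thesis by (simp add: L2_inner_self)
qed

section \<open>Sobolev functions on an interval\<close>

lemma finite_measure_interval: "finite_measure (lebesgue_on {a..b::real})"
  by (rule finite_measure_lebesgue_on) simp

lemma initial_interval_sets: "t \<in> {a..b} \<Longrightarrow> {a..t} \<in> sets (lebesgue_on {a..b::real})"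
  by (auto simp: sets_restrict_space intro!: image_eqI[of _ _ "{a..t}"])

lemma integrable_lebesgue_on_subset:
  fixes f :: "'a::euclidean_space \<Rightarrow> 'b::{banach,second_countable_topology}"
  assumes "integrable (lebesgue_on A) f" "A \<in> sets lebesgue" "B \<in> sets lebesgue" "B \<subseteq> A"
  shows "integrable (lebesgue_on B) f"
  using set_integrable_subset[of lebesgue A f B] assms
  by (simp add: integrable_restrict_space set_integrable_def)

lemma integral_lebesgue_on_subset:
  fixes f :: "'a::euclidean_space \<Rightarrow> 'b::{banach,second_countable_topology}"
  assumes "A \<in> sets lebesgue" "B \<in> sets lebesgue" "B \<subseteq> A"
  shows "integral\<^sup>L (lebesgue_on B) f = (LINT x|lebesgue_on A. indicator B x *\<^sub>R f x)"
proof -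
  have "indicator A x *\<^sub>R indicator B x *\<^sub>R f x = indicator B x *\<^sub>R f x" for x
    using assms(3) by (auto simp: indicator_def)
  then show ?thesis
    using assms by (simp add: integral_restrict_space del: scaleR_scaleR scaleR_cancel_right)
qed

lemma AE_zero_if_initial_integrals_zero_real:
  fixes f :: "real \<Rightarrow> real"
  assumes int: "integrable (lebesgue_on {a..b}) f"
    and zero: "\<And>t. t \<in> {a..b} \<Longrightarrow> integral\<^sup>L (lebesgue_on {a..t}) f = 0"
  shows "AE t in lebesgue_on {a..b}. f t = 0"
proof -
  define f0 where "f0 t = (if t \<in> {a..b} then f t else 0)" for t
  have f: "f integrable_on {a..b}" using int by (simp add: integrable_on_lebesgue_on)
  have zero': "integral {a..t} f = 0" if "t \<in> {a..b}" for t
    using lebesgue_integral_eq_integral[OF integrable_lebesgue_on_subset[OF int, of "{a..t}"]]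
      zero[OF that] that
    by simp
  have "f0 integrable_on UNIV" unfolding f0_def integrable_restrict_UNIV by (rule f)
  then have "f0 integrable_on cbox c d" for c d by (rule integrable_on_subcbox) simp
  then obtain N where N: "negligible N"
    "\<And>t e. t \<notin> N \<Longrightarrow> 0 < e \<Longrightarrow> \<exists>d>0. \<forall>h. 0 < h \<and> h < d \<longrightarrow>
       norm (integral (cbox t (t + h *\<^sub>R One)) f0 /\<^sub>R h ^ DIM(real) - f0 t) < e"
    using integrable_ccontinuous_explicit[of f0] by blast
  have "f t = 0" if t: "a \<le> t" "t < b" "t \<notin> N" for t
  proof (rule ccontr)
    assume "f t \<noteq> 0"
    then obtain d where d: "d > 0"
      "\<And>h. 0 < h \<Longrightarrow> h < d \<Longrightarrow> \<bar>integral {t..t + h} f0 / h - f0 t\<bar> < \<bar>f t\<bar>"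
      using N(2)[OF t(3), of "\<bar>f t\<bar>"] by (auto simp: Basis_real_def divide_inverse mult.commute)
    define h where "h = min (d / 2) (b - t)"
    have h: "0 < h" "h < d" "t + h \<in> {a..b}" using t d by (auto simp: h_def)
    have "integral {t..t + h} f0 = integral {t..t + h} f"
      using t h by (intro integral_cong) (auto simp: f0_def)
    also have "\<dots> = integral {a..t + h} f - integral {a..t} f"
      using Henstock_Kurzweil_Integration.integral_combine[of a t "t + h" f]
        integrable_subinterval_real[OF f, of a "t + h"] t h by auto
    also have "\<dots> = 0" using zero' t h by simp
    finally show False using d(2)[OF h(1,2)] t by (simp add: f0_def)
  qed
  then have "{t \<in> {a..b}. f t \<noteq> 0} \<subseteq> N \<union> {b}" by force
  then have "negligible {t \<in> {a..b}. f t \<noteq> 0}"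
    using N(1) negligible_subset negligible_Un negligible_sing by metis
  then show ?thesis
    by (auto simp: AE_restrict_space_iff negligible_iff_null_sets
        intro!: AE_I'[of "{t \<in> {a..b}. f t \<noteq> 0}"])
qed

lemma AE_zero_if_initial_integrals_zero:
  fixes f :: "real \<Rightarrow> 'a::{real_inner,banach,second_countable_topology}"
  assumes int: "integrable (lebesgue_on {a..b}) f"
    and zero: "\<And>t. t \<in> {a..b} \<Longrightarrow> integral\<^sup>L (lebesgue_on {a..t}) f = 0"
  shows "AE t in lebesgue_on {a..b}. f t = 0"
proof -
  obtain D :: "'a set" where D: "countable D" "closure D = UNIV"
    using separable[of UNIV] by (metis top.extremum_unique)
  have "AE t in lebesgue_on {a..b}. inner (f t) w = 0" for w
  proof (rule AE_zero_if_initial_integrals_zero_real)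
    show "integrable (lebesgue_on {a..b}) (\<lambda>t. inner (f t) w)"
      using int by (rule integrable_inner_left)
    fix t assume t: "t \<in> {a..b}"
    then have "integrable (lebesgue_on {a..t}) f"
      by (intro integrable_lebesgue_on_subset[OF int]) auto
    then show "(LINT s|lebesgue_on {a..t}. inner (f s) w) = 0" by (simp add: zero[OF t])
  qed
  then have "AE t in lebesgue_on {a..b}. \<forall>w\<in>D. inner (f t) w = 0"
    by (simp add: AE_ball_countable D(1))
  then show ?thesis
  proof eventually_elim
    case (elim t)
    have "closed {w. inner (f t) w = 0}" by (intro closed_Collect_eq continuous_intros)
    then have "closure D \<subseteq> {w. inner (f t) w = 0}" using elim by (intro closure_minimal) auto
    then have "f t \<in> {w. inner (f t) w = 0}" using D(2) by blast
    then show ?case by simp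
  qed
qed

lemma indicator_initial_interval_tendsto:
  fixes t :: real
  assumes "r \<longlonglongrightarrow> t" "s \<noteq> t"
  shows "(\<lambda>n. indicator {a..r n} s) \<longlonglongrightarrow> (indicator {a..t} s :: real)"
proof (rule tendsto_eventually)
  show "\<forall>\<^sub>F n in sequentially. indicator {a..r n} s = (indicator {a..t} s :: real)"
  proof (cases "s < t")
    case True
    show ?thesis using order_tendstoD(1)[OF assms(1) True]
      by eventually_elim (use True in \<open>auto simp: indicator_def\<close>)
  next
    case False
    then have "t < s" using assms(2) by simp
    show ?thesis using order_tendstoD(2)[OF assms(1) \<open>t < s\<close>]
      by eventually_elim (use \<open>t < s\<close> in \<open>auto simp: indicator_def\<close>)
  qed
qed

lemma continuous_on_indefinite_integral:
  fixes f :: "real \<Rightarrow> 'a::{banach,second_countable_topology}"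
  assumes f: "integrable (lebesgue_on {a..b}) f"
  shows "continuous_on {a..b} (\<lambda>t. integral\<^sup>L (lebesgue_on {a..t}) f)"
  unfolding continuous_on_sequentially o_def
proof (intro allI ballI impI, elim conjE)
  fix r :: "nat \<Rightarrow> real" and t assume t: "t \<in> {a..b}" and r: "\<forall>n. r n \<in> {a..b}" and lim: "r \<longlonglongrightarrow> t"
  let ?M = "lebesgue_on {a..b}"
  have integral_eq_indicator:
    "integral\<^sup>L (lebesgue_on {a..x}) f = (LINT s|?M. indicator {a..x} s *\<^sub>R f s)"
    if "x \<in> {a..b}" for x
    using that by (intro integral_lebesgue_on_subset) auto
  have indicator_measurable: "(\<lambda>s. indicator {a..x} s *\<^sub>R f s) \<in> borel_measurable ?M"
    if "x \<in> {a..b}" for x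
    by (intro borel_measurable_integrable integrable_mult_indicator initial_interval_sets that f)
  have "(\<lambda>n. LINT s|?M. indicator {a..r n} s *\<^sub>R f s) \<longlonglongrightarrow> (LINT s|?M. indicator {a..t} s *\<^sub>R f s)"
  proof (rule integral_dominated_convergence[OF indicator_measurable[OF t]
        indicator_measurable[OF r[rule_format]]])
    show "integrable ?M (\<lambda>s. norm (f s))" using f by simp
    show "AE s in ?M. norm (indicator {a..r n} s *\<^sub>R f s) \<le> norm (f s)" for n
      by (auto simp: indicator_def)
    have "AE s in lebesgue. s \<noteq> t" by (rule AE_I'[of "{t}"]) auto
    then have "AE s in lebesgue. s \<in> {a..b} \<longrightarrow> s \<noteq> t" by eventually_elim simp
    then have "AE s in ?M. s \<noteq> t" by (simp add: AE_restrict_space_iff)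
    then show "AE s in ?M. (\<lambda>n. indicator {a..r n} s *\<^sub>R f s) \<longlonglongrightarrow> indicator {a..t} s *\<^sub>R f s"
      by eventually_elim (intro tendsto_intros indicator_initial_interval_tendsto[OF lim])
  qed
  then show "(\<lambda>n. integral\<^sup>L (lebesgue_on {a..r n}) f) \<longlonglongrightarrow> integral\<^sup>L (lebesgue_on {a..t}) f"
    unfolding integral_eq_indicator[OF t] integral_eq_indicator[OF r[rule_format]] .
qed

abbreviation L2ip ::
  "real \<Rightarrow> (real \<Rightarrow> 'a::{real_inner,banach,second_countable_topology}) \<Rightarrow> (real \<Rightarrow> 'a) \<Rightarrow> real" where
  "L2ip T \<equiv> L2_inner (lebesgue_on {0..T})"

lemma L2fun_eq: "L2fun T = square_integrable (lebesgue_on {0..T})"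
  by (simp add: L2fun_def square_integrable_def)

lemma L2fun_measurable: "u \<in> L2fun T \<Longrightarrow> u \<in> borel_measurable (lebesgue_on {0..T})"
  by (simp add: L2fun_def)

lemma integrable_L2fun: "u \<in> L2fun T \<Longrightarrow> integrable (lebesgue_on {0..T}) u"
  unfolding L2fun_eq by (rule square_integrable_imp_integrable[OF finite_measure_interval])

interpretation L2: semi_hilbert "L2fun T" "L2ip T" for T
  unfolding L2fun_eq by (rule semi_hilbert_square_integrable)

lemma H1fun_outside: "y \<in> H1fun T \<Longrightarrow> t \<notin> {0..T} \<Longrightarrow> y t = 0"
  by (simp add: H1fun_def)

lemma
  assumes "y \<in> H1fun T"
  shows h1deriv_L2fun: "h1deriv T y \<in> L2fun T"
    and h1deriv_integral: "t \<in> {0..T} \<Longrightarrow> y t = y 0 + integral\<^sup>L (lebesgue_on {0..t}) (h1deriv T y)"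
proof -
  have "\<exists>y'. y' \<in> L2fun T \<and> (\<forall>t\<in>{0..T}. y t = y 0 + integral\<^sup>L (lebesgue_on {0..t}) y')"
    using assms by (auto simp: H1fun_def)
  note spec = someI_ex[OF this, folded h1deriv_def]
  show "h1deriv T y \<in> L2fun T" using spec by blast
  show "t \<in> {0..T} \<Longrightarrow> y t = y 0 + integral\<^sup>L (lebesgue_on {0..t}) (h1deriv T y)" using spec by blast
qed

lemma integral_diff_initial:
  assumes "u \<in> L2fun T" "v \<in> L2fun T" "t \<in> {0..T}"
  shows "integral\<^sup>L (lebesgue_on {0..t}) (u - v) =
      integral\<^sup>L (lebesgue_on {0..t}) u - integral\<^sup>L (lebesgue_on {0..t}) v"
proof -
  have "integrable (lebesgue_on {0..t}) w" if "w \<in> L2fun T" for w :: "real \<Rightarrow> 'a"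
    using assms(3) by (intro integrable_lebesgue_on_subset[OF integrable_L2fun[OF that]]) auto
  then show ?thesis using assms by (simp add: fun_diff_def)
qed

lemma h1deriv_AE_unique:
  fixes y :: "real \<Rightarrow> 'a::{real_inner,banach,second_countable_topology}"
  assumes y: "y \<in> H1fun T" and v: "v \<in> L2fun T"
    and repr: "\<And>t. t \<in> {0..T} \<Longrightarrow> y t = y 0 + integral\<^sup>L (lebesgue_on {0..t}) v"
  shows "AE t in lebesgue_on {0..T}. h1deriv T y t = v t"
proof -
  note d = h1deriv_L2fun[OF y]
  have "AE t in lebesgue_on {0..T}. (h1deriv T y - v) t = 0"
  proof (rule AE_zero_if_initial_integrals_zero)
    show "integrable (lebesgue_on {0..T}) (h1deriv T y - v)"
      by (intro integrable_L2fun L2.diff_mem d v)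
    show "integral\<^sup>L (lebesgue_on {0..t}) (h1deriv T y - v) = 0" if "t \<in> {0..T}" for t
      using h1deriv_integral[OF y that] repr[OF that]
      by (simp add: integral_diff_initial[OF d v that])
  qed
  then show ?thesis by simp
qed

lemma
  fixes y z :: "real \<Rightarrow> 'a::{real_inner,banach,second_countable_topology}"
  assumes y: "y \<in> H1fun T" and z: "z \<in> H1fun T"
  shows H1fun_diff: "y - z \<in> H1fun T"
    and h1deriv_diff:
      "AE t in lebesgue_on {0..T}. h1deriv T (y - z) t = h1deriv T y t - h1deriv T z t"
proof -
  note d = h1deriv_L2fun[OF y] h1deriv_L2fun[OF z]
  have diff_repr:
    "(y - z) t = (y - z) 0 + integral\<^sup>L (lebesgue_on {0..t}) (h1deriv T y - h1deriv T z)"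
    if "t \<in> {0..T}" for t
    using h1deriv_integral[OF y that] h1deriv_integral[OF z that]
    by (simp add: integral_diff_initial[OF d that])
  show diff_H1: "y - z \<in> H1fun T"
    unfolding H1fun_def mem_Collect_eq
    by (intro conjI allI impI bexI[OF _ L2.diff_mem[OF d]] ballI diff_repr)
      (simp add: H1fun_outside[OF y] H1fun_outside[OF z])
  have "AE t in lebesgue_on {0..T}. h1deriv T (y - z) t = (h1deriv T y - h1deriv T z) t"
    by (rule h1deriv_AE_unique[OF diff_H1 L2.diff_mem[OF d] diff_repr])
  then show "AE t in lebesgue_on {0..T}. h1deriv T (y - z) t = h1deriv T y t - h1deriv T z t"
    by simp
qed

lemma H1fun_continuous:
  assumes "y \<in> H1fun T"
  shows "continuous_on {0..T} y"
proof -
  have "continuous_on {0..T} (\<lambda>t. y 0 + integral\<^sup>L (lebesgue_on {0..t}) (h1deriv T y))"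
    by (intro continuous_intros continuous_on_indefinite_integral integrable_L2fun h1deriv_L2fun
        assms)
  then show ?thesis using h1deriv_integral[OF assms, symmetric] by (rule continuous_on_eq)
qed

lemma H1fun_L2fun:
  assumes y: "y \<in> H1fun T"
  shows "y \<in> L2fun T"
proof -
  have "compact (y ` {0..T})" by (intro compact_continuous_image H1fun_continuous y compact_Icc)
  then obtain B where "\<And>t. t \<in> {0..T} \<Longrightarrow> norm (y t) \<le> B"
    using compact_imp_bounded bounded_iff by (metis imageI)
  moreover have "y \<in> borel_measurable (lebesgue_on {0..T})"
    by (intro continuous_imp_measurable_on_sets_lebesgue H1fun_continuous y) simp
  ultimately show ?thesis
    unfolding L2fun_eq by (intro square_integrable_bounded[OF finite_measure_interval]) auto
qed

lemma indefinite_integral_H1fun: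
  fixes v :: "real \<Rightarrow> 'a::{real_inner,banach,second_countable_topology}" and c :: 'a
  assumes T: "0 \<le> T" and v: "v \<in> L2fun T"
  defines "y \<equiv> \<lambda>t. if t \<in> {0..T} then c + integral\<^sup>L (lebesgue_on {0..t}) v else 0"
  shows "y \<in> H1fun T" "y 0 = c" "AE t in lebesgue_on {0..T}. h1deriv T y t = v t"
proof -
  have "integral\<^sup>L (lebesgue_on {0..0}) v = 0" by (simp add: integral_eq_zero_null_sets)
  then show y0: "y 0 = c" using T by (simp add: y_def)
  have y_repr: "y t = y 0 + integral\<^sup>L (lebesgue_on {0..t}) v" if "t \<in> {0..T}" for t
    unfolding y0 using that by (simp add: y_def)
  show y: "y \<in> H1fun T"
    unfolding H1fun_def mem_Collect_eq
    by (intro conjI allI impI bexI[OF _ v] ballI y_repr) (auto simp: y_def)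
  show "AE t in lebesgue_on {0..T}. h1deriv T y t = v t" by (rule h1deriv_AE_unique[OF y v y_repr])
qed

lemma L2fun_indicator_const:
  "A \<in> sets (lebesgue_on {0..T}) \<Longrightarrow> (\<lambda>s. indicator A s *\<^sub>R w) \<in> L2fun T"
  unfolding L2fun_eq
  by (rule square_integrable_bounded[OF finite_measure_interval, where B = "norm w"])
    (auto simp: indicator_def)

lemma inner_H1fun:
  fixes y :: "real \<Rightarrow> 'a::{real_inner,banach,second_countable_topology}"
  assumes y: "y \<in> H1fun T" and t: "t \<in> {0..T}"
  shows "inner (y t) w = inner (y 0) w + L2ip T (h1deriv T y) (\<lambda>s. indicator {0..t} s *\<^sub>R w)"
proof -
  have "integrable (lebesgue_on {0..T}) (\<lambda>s. indicator {0..t} s *\<^sub>R h1deriv T y s)"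
    by (intro integrable_mult_indicator initial_interval_sets t integrable_L2fun h1deriv_L2fun y)
  then have "L2ip T (h1deriv T y) (\<lambda>s. indicator {0..t} s *\<^sub>R w)
      = inner (LINT s|lebesgue_on {0..T}. indicator {0..t} s *\<^sub>R h1deriv T y s) w"
    unfolding L2_inner_def by (simp add: integral_inner_left[symmetric] del: integral_inner_left)
  also have "\<dots> = inner (y t - y 0) w"
    using t h1deriv_integral[OF y t]
    by (simp add: integral_lebesgue_on_subset[of "{0..T}" "{0..t}"])
  finally show ?thesis by (simp add: inner_diff_left)
qed

lemma H1inner_L2ip: "H1inner T y z = L2ip T y z + L2ip T (h1deriv T y) (h1deriv T z)"
  by (simp add: H1inner_def L2_inner_def)

lemma H1inner_self_eq_0_imp_eq_0:
  assumes T: "0 < T" and d: "d \<in> H1fun T" and self_zero: "H1inner T d d = 0"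
  shows "d = 0"
proof -
  note d' = h1deriv_L2fun[OF d]
  have "L2ip T d d = 0" "L2ip T (h1deriv T d) (h1deriv T d) = 0"
    using self_zero L2.ip_nonneg[OF H1fun_L2fun[OF d]] L2.ip_nonneg[OF d']
      by (simp_all add: H1inner_L2ip)
  then have AE_d: "AE t in lebesgue_on {0..T}. d t = 0"
    and AE_d': "AE t in lebesgue_on {0..T}. h1deriv T d t = 0"
    using H1fun_L2fun[OF d] d' by (simp_all add: L2fun_eq L2_inner_self_eq_0_iff)
  have const: "d t = d 0" if t: "t \<in> {0..T}" for t
  proof -
    have "(LINT s|lebesgue_on {0..T}. indicator {0..t} s *\<^sub>R h1deriv T d s) = 0"
      by (rule integral_eq_zero_AE) (use AE_d' in \<open>auto elim: eventually_mono\<close>)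
    then show ?thesis
      using h1deriv_integral[OF d t] t
      by (simp add: integral_lebesgue_on_subset[of "{0..T}" "{0..t}"])
  qed
  have "d 0 = 0"
  proof (rule ccontr)
    assume "d 0 \<noteq> 0"
    have "AE t in lebesgue_on {0..T}. False"
      using AE_d AE_space
    proof eventually_elim
      case (elim t)
      then show ?case using const[of t] \<open>d 0 \<noteq> 0\<close> by simp
    qed
    then show False using T by (simp add: ae_filter_eq_bot_iff emeasure_restrict_space)
  qed
  then have "d t = 0" for t using const[of t] H1fun_outside[OF d, of t] by (cases "t \<in> {0..T}") auto
  then show ?thesis by (simp add: fun_eq_iff)
qed

lemma H1inner_nondegenerate:
  fixes y z :: "real \<Rightarrow> 'a::{real_inner,banach,second_countable_topology}"
  assumes T: "0 < T" and y: "y \<in> H1fun T" and z: "z \<in> H1fun T"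
    and H1inner_eq: "\<And>w. w \<in> H1fun T \<Longrightarrow> H1inner T y w = H1inner T z w"
  shows "y = z"
proof -
  note d = H1fun_diff[OF y z]
  note deriv = h1deriv_L2fun[OF y] h1deriv_L2fun[OF z] h1deriv_L2fun[OF d]
  have "L2ip T (h1deriv T (y - z)) (h1deriv T (y - z)) =
      L2ip T (h1deriv T y - h1deriv T z) (h1deriv T (y - z))"
    using h1deriv_diff[OF y z] deriv L2.diff_mem[OF deriv(1,2)]
    by (intro L2_inner_AE_cong) (auto simp: L2fun_eq)
  then have "H1inner T (y - z) (y - z) = H1inner T y (y - z) - H1inner T z (y - z)"
    by (simp add: H1inner_L2ip L2.ip_diff_left H1fun_L2fun deriv y z d)
  then have "y - z = 0" using H1inner_eq[OF d] by (intro H1inner_self_eq_0_imp_eq_0[OF T d]) simp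
  then show ?thesis by simp
qed

section \<open>The topologies\<close>

lemma limitin_topology_generated_by:
  "limitin (topology_generated_by S) f l F \<longleftrightarrow> l \<in> \<Union>S \<and> (\<forall>A\<in>S. l \<in> A \<longrightarrow> (\<forall>\<^sub>F x in F. f x \<in> A))"
proof (intro iffI conjI)
  assume "limitin (topology_generated_by S) f l F"
  then show "l \<in> \<Union>S" "\<forall>A\<in>S. l \<in> A \<longrightarrow> (\<forall>\<^sub>F x in F. f x \<in> A)"
    by (auto simp: limitin_def topology_generated_by_Basis)
next
  assume R: "l \<in> \<Union>S \<and> (\<forall>A\<in>S. l \<in> A \<longrightarrow> (\<forall>\<^sub>F x in F. f x \<in> A))"
  have "l \<in> A \<longrightarrow> (\<forall>\<^sub>F x in F. f x \<in> A)" if "generate_topology_on S A" for A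
    using that
  proof induction
    case (Int a b) then show ?case by (auto simp: eventually_conj_iff)
  next
    case (UN K)
    have "\<forall>\<^sub>F x in F. f x \<in> \<Union>K" if "k \<in> K" "l \<in> k" for k
      using UN.IH[OF that(1)] that by (auto elim: eventually_mono)
    then show ?case by blast
  next
    case (Basis A) then show ?case using R by blast
  qed simp
  then show "limitin (topology_generated_by S) f l F"
    using R by (auto simp: limitin_def dest: openin_topology_generated_by)
qed

lemma limitin_if_subsequences_limitin:
  assumes x: "x \<in> topspace X"
    and subsequences: "\<And>r :: nat \<Rightarrow> nat. strict_mono r \<Longrightarrow>
      \<exists>s :: nat \<Rightarrow> nat. strict_mono s \<and> limitin X (xs \<circ> r \<circ> s) x sequentially"
  shows "limitin X xs x sequentially"
proof (rule ccontr)
  assume "\<not> ?thesis"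
  then obtain U where U: "openin X U" "x \<in> U" "\<not> (\<forall>\<^sub>F n in sequentially. xs n \<in> U)"
    using x unfolding limitin_def by blast
  then have infinitely_many: "infinite {n. xs n \<notin> U}"
    by (simp add: cofinite_eq_sequentially[symmetric] eventually_cofinite)
  define r where "r = enumerate {n. xs n \<notin> U}"
  have outside: "xs (r n) \<notin> U" for n
    using enumerate_in_set[OF infinitely_many] by (auto simp: r_def)
  obtain s :: "nat \<Rightarrow> nat" where "limitin X (xs \<circ> r \<circ> s) x sequentially"
    using subsequences[of r] strict_mono_enumerate[OF infinitely_many] by (auto simp: r_def)
  then have "\<forall>\<^sub>F n in sequentially. (xs \<circ> r \<circ> s) n \<in> U" using U by (simp add: limitin_def)
  then show False using outside by (auto simp: eventually_sequentially)
qed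

lemma compactin_cluster_point:
  assumes K: "compactin X K" and xs: "\<And>n::nat. xs n \<in> K"
  shows "\<exists>x\<in>K. \<forall>V. openin X V \<and> x \<in> V \<longrightarrow> (\<exists>\<^sub>F n in sequentially. xs n \<in> V)"
proof (rule ccontr)
  assume "\<not> ?thesis"
  then obtain V where
    V: "\<And>x. x \<in> K \<Longrightarrow> openin X (V x) \<and> x \<in> V x \<and> (\<forall>\<^sub>F n in sequentially. xs n \<notin> V x)"
    unfolding not_frequently[symmetric] by metis
  then obtain \<F> where "finite \<F>" "\<F> \<subseteq> V ` K" "K \<subseteq> \<Union>\<F>"
    using compactinD[OF K, of "V ` K"] by blast
  then obtain S where S: "finite S" "S \<subseteq> K" "K \<subseteq> \<Union>(V ` S)" by (metis finite_subset_image)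
  have "\<forall>\<^sub>F n in sequentially. \<forall>x\<in>S. xs n \<notin> V x"
    using S V by (intro eventually_ball_finite) blast+
  then obtain n where "\<forall>x\<in>S. xs n \<notin> V x" by (auto simp: eventually_sequentially)
  then show False using S(3) xs[of n] by blast
qed

lemma lsc_top_liminf:
  assumes F: "lsc_top X F" and lim: "limitin X xs x sequentially"
  shows "enn2ereal (F x) \<le> liminf (\<lambda>n. enn2ereal (F (xs n)))"
  unfolding le_Liminf_iff
proof (intro allI impI)
  fix c assume c: "c < enn2ereal (F x)"
  show "\<forall>\<^sub>F n in sequentially. c < enn2ereal (F (xs n))"
  proof (cases "0 \<le> c")
    case True
    define S where "S = {x \<in> topspace X. e2ennreal c < F x}"
    have less_iff: "e2ennreal c < F z \<longleftrightarrow> c < enn2ereal (F z)" for z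
      using True by (simp add: less_ennreal.rep_eq enn2ereal_e2ennreal)
    have "openin X S" using F unfolding lsc_top_def S_def by blast
    moreover have "x \<in> S" using lim c by (simp add: S_def limitin_def less_iff)
    ultimately have "\<forall>\<^sub>F n in sequentially. xs n \<in> S" using lim by (simp add: limitin_def)
    then show ?thesis by eventually_elim (simp add: less_iff S_def)
  next
    case False
    then have "c < enn2ereal (F (xs n))" for n
      using enn2ereal_nonneg[of "F (xs n)"] by (meson less_le_trans not_le)
    then show ?thesis by simp
  qed
qed

lemma zero_H1fun: "(0 :: real \<Rightarrow> 'a::{real_inner,banach,second_countable_topology}) \<in> H1fun T"
proof -
  have "(0 :: real \<Rightarrow> 'a) \<in> L2fun T" by (rule subspace_0[OF L2.subspace])
  then show ?thesis unfolding H1fun_def by (auto simp: zero_fun_def intro!: bexI[of _ "\<lambda>_. 0"])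
qed

lemma topspace_H1w_top: "topspace (H1w_top T) = H1fun T"
  unfolding H1w_top_def using zero_H1fun by (auto intro!: exI[of _ UNIV])

lemma limitin_H1w_top_iff:
  fixes y :: "real \<Rightarrow> 'a::{real_inner,banach,second_countable_topology}"
  shows "limitin (H1w_top T) ys y F \<longleftrightarrow> y \<in> H1fun T \<and> (\<forall>\<^sub>F n in F. ys n \<in> H1fun T) \<and>
     (\<forall>z\<in>H1fun T. ((\<lambda>n. H1inner T (ys n) z) \<longlongrightarrow> H1inner T y z) F)" (is "?L \<longleftrightarrow> ?R")
proof -
  define A where "A z V = {y \<in> H1fun T. H1inner T y z \<in> V}" for z :: "real \<Rightarrow> 'a" and V
  define S where "S = {A z V | z V. z \<in> H1fun T \<and> open V}"
  have basic_iff: "(\<forall>B\<in>S. y \<in> B \<longrightarrow> (\<forall>\<^sub>F n in F. ys n \<in> B)) \<longleftrightarrow>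
      (\<forall>z\<in>H1fun T. ((\<lambda>n. H1inner T (ys n) z) \<longlongrightarrow> H1inner T y z) F)"
    if y: "y \<in> H1fun T" and ys: "\<forall>\<^sub>F n in F. ys n \<in> H1fun T"
  proof -
    have "(\<forall>B\<in>S. y \<in> B \<longrightarrow> (\<forall>\<^sub>F n in F. ys n \<in> B)) \<longleftrightarrow>
        (\<forall>z\<in>H1fun T. \<forall>V. open V \<longrightarrow> y \<in> A z V \<longrightarrow> (\<forall>\<^sub>F n in F. ys n \<in> A z V))"
      unfolding S_def by blast
    then show ?thesis using y ys by (simp add: A_def tendsto_def eventually_conj_iff)
  qed
  have "y \<in> \<Union>S" if "y \<in> H1fun T"
    by (rule UnionI[of "A 0 UNIV"]) (use that zero_H1fun open_UNIV in \<open>auto simp: S_def A_def\<close>)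
  with basic_iff show ?thesis
    unfolding H1w_top_def S_def[symmetric, unfolded A_def] limitin_subtopology
      limitin_topology_generated_by by blast
qed

lemma limitin_H1w_top_unique:
  assumes T: "0 < T"
    and "limitin (H1w_top T) ys y sequentially" "limitin (H1w_top T) ys z sequentially"
  shows "y = z"
proof (rule H1inner_nondegenerate[OF T])
  show "y \<in> H1fun T" "z \<in> H1fun T" using assms by (auto simp: limitin_H1w_top_iff)
  show "H1inner T y w = H1inner T z w" if "w \<in> H1fun T" for w
    using assms that LIMSEQ_unique unfolding limitin_H1w_top_iff by blast
qed

lemma L2dist_L2ip: "L2dist T u v = sqrt (L2ip T (u - v) (u - v))"
  by (simp add: L2dist_def L2_inner_self)

lemma L2dist_commute: "L2dist T u v = L2dist T v u"
  by (simp add: L2dist_def norm_minus_commute)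

lemma L2dist_nonneg [simp]: "0 \<le> L2dist T u v"
  by (simp add: L2dist_def)

lemma L2dist_triangle:
  fixes u v w :: "real \<Rightarrow> 'a::{real_inner,banach,second_countable_topology}"
  assumes "u \<in> L2fun T" "v \<in> L2fun T" "w \<in> L2fun T"
  shows "L2dist T u w \<le> L2dist T u v + L2dist T v w"
  using L2.sqrt_ip_triangle[of "u - v" T "v - w"] by (simp add: L2dist_L2ip L2.diff_mem assms)

lemma openin_L2_top:
  fixes S :: "(real \<Rightarrow> 'a::{banach,second_countable_topology}) set"
  shows "openin (L2_top T) S \<longleftrightarrow> S \<subseteq> L2fun T \<and> (\<forall>u\<in>S. \<exists>e>0. {v \<in> L2fun T. L2dist T u v < e} \<subseteq> S)"
proof -
  define P where "P S \<longleftrightarrow> S \<subseteq> L2fun T \<and> (\<forall>u\<in>S. \<exists>e>0. {v \<in> L2fun T. L2dist T u v < e} \<subseteq> S)"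
    for S :: "(real \<Rightarrow> 'a) set"
  have "P (A \<inter> B)" if AB: "P A" "P B" for A B
    unfolding P_def
  proof (intro conjI ballI)
    show "A \<inter> B \<subseteq> L2fun T" using that by (auto simp: P_def)
    fix u assume "u \<in> A \<inter> B"
    then obtain d e where "d > 0" "{v \<in> L2fun T. L2dist T u v < d} \<subseteq> A"
        "e > 0" "{v \<in> L2fun T. L2dist T u v < e} \<subseteq> B"
      using AB unfolding P_def by blast
    then show "\<exists>e>0. {v \<in> L2fun T. L2dist T u v < e} \<subseteq> A \<inter> B"
      by (intro exI[of _ "min d e"]) auto
  qed
  moreover have "P (\<Union>\<K>)" if "\<forall>K\<in>\<K>. P K" for \<K>
    using that unfolding P_def by (meson Sup_least Union_iff Union_upper order_trans)
  ultimately have "istopology P" by (simp add: istopology_def)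
  then show ?thesis unfolding L2_top_def P_def by (simp add: topology_inverse')
qed

lemma topspace_L2_top: "topspace (L2_top T) = L2fun T"
proof -
  have "openin (L2_top T) (L2fun T)" unfolding openin_L2_top by (auto intro: exI[of _ 1])
  then show ?thesis using openin_L2_top openin_subset openin_topspace by (metis subset_antisym)
qed

lemma openin_L2_ball:
  fixes u :: "real \<Rightarrow> 'a::{real_inner,banach,second_countable_topology}"
  assumes "u \<in> L2fun T"
  shows "openin (L2_top T) {v \<in> L2fun T. L2dist T u v < e}"
  unfolding openin_L2_top
proof (intro conjI ballI)
  fix v assume v: "v \<in> {v \<in> L2fun T. L2dist T u v < e}"
  have "L2dist T u w < e" if "w \<in> L2fun T" "L2dist T v w < e - L2dist T u v" for w
    using L2dist_triangle[OF assms, of v w] v that by auto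
  then show "\<exists>d>0. {w \<in> L2fun T. L2dist T v w < d} \<subseteq> {v \<in> L2fun T. L2dist T u v < e}"
    using v by (intro exI[of _ "e - L2dist T u v"]) auto
qed auto

lemma limitin_L2_top_iff:
  fixes u :: "real \<Rightarrow> 'a::{real_inner,banach,second_countable_topology}"
  shows "limitin (L2_top T) us u F \<longleftrightarrow>
    u \<in> L2fun T \<and> (\<forall>\<^sub>F n in F. us n \<in> L2fun T) \<and> ((\<lambda>n. L2dist T (us n) u) \<longlongrightarrow> 0) F" (is "?L = ?R")
proof
  assume L: ?L
  then have u: "u \<in> L2fun T" by (simp add: limitin_def topspace_L2_top)
  have eventually_near: "\<forall>\<^sub>F n in F. us n \<in> L2fun T \<and> L2dist T u (us n) < e" if "e > 0" for e
  proof -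
    have "\<forall>\<^sub>F n in F. us n \<in> {v \<in> L2fun T. L2dist T u v < e}"
      using L openin_L2_ball[OF u, of e] u that unfolding limitin_def by (auto simp: L2dist_def)
    then show ?thesis by simp
  qed
  have "((\<lambda>n. L2dist T (us n) u) \<longlongrightarrow> 0) F"
  proof (rule tendstoI)
    fix e :: real assume "e > 0"
    from eventually_near[OF this] show "\<forall>\<^sub>F n in F. dist (L2dist T (us n) u) 0 < e"
      by eventually_elim (simp add: L2dist_commute[of T _ u] dist_real_def)
  qed
  moreover have "\<forall>\<^sub>F n in F. us n \<in> L2fun T"
    using eventually_near[of 1] by (auto elim: eventually_mono)
  ultimately show ?R using u by blast
next
  assume R: ?R
  show ?L unfolding limitin_def topspace_L2_top
  proof (intro conjI allI impI, use R in blast, elim conjE)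
    fix S assume S: "openin (L2_top T) S" "u \<in> S"
    then obtain e where e: "e > 0" "{v \<in> L2fun T. L2dist T u v < e} \<subseteq> S"
      unfolding openin_L2_top by blast
    have "\<forall>\<^sub>F n in F. L2dist T (us n) u < e" using R e(1) by (intro order_tendstoD(2)) auto
    moreover have "\<forall>\<^sub>F n in F. us n \<in> L2fun T" using R by blast
    ultimately show "\<forall>\<^sub>F n in F. us n \<in> S"
      by eventually_elim (use e in \<open>auto simp: L2dist_commute[of T _ u]\<close>)
  qed
qed

lemma limitin_L2_top_imp_strong_lim:
  fixes u :: "real \<Rightarrow> 'a::{real_inner,banach,second_countable_topology}"
  assumes "limitin (L2_top T) us u sequentially"
  shows "L2.strong_lim T us u"
proof -
  have "(\<lambda>n. (L2dist T (us n) u)\<^sup>2) \<longlonglongrightarrow> 0\<^sup>2"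
    using assms unfolding limitin_L2_top_iff by (intro tendsto_power) blast
  then show ?thesis by (simp add: L2.strong_lim_def L2dist_L2ip L2_inner_self)
qed

lemma compactin_L2_top_convergent_subsequence:
  fixes us :: "nat \<Rightarrow> real \<Rightarrow> 'a::{real_inner,banach,second_countable_topology}"
  assumes U: "compactin (L2_top T) U" and us: "\<And>n. us n \<in> U"
  obtains r u where "strict_mono r" "limitin (L2_top T) (us \<circ> r) u sequentially"
proof -
  have UL: "U \<subseteq> L2fun T" using U by (simp add: compactin_def topspace_L2_top)
  from compactin_cluster_point[OF U us] obtain u where u: "u \<in> U"
    and cluster: "\<forall>V. openin (L2_top T) V \<and> u \<in> V \<longrightarrow> (\<exists>\<^sub>F n in sequentially. us n \<in> V)"
    by (rule bexE)
  have uL: "u \<in> L2fun T" using u UL by blast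
  have frequently_near: "\<exists>n>N. L2dist T (us n) u < e" if "e > 0" for N e
  proof -
    have "\<exists>\<^sub>F n in sequentially. us n \<in> {v \<in> L2fun T. L2dist T u v < e}"
      using uL that openin_L2_ball[OF uL] by (intro cluster[rule_format]) (simp add: L2dist_def)
    then obtain n where "n \<ge> Suc N" "us n \<in> {v \<in> L2fun T. L2dist T u v < e}"
      unfolding frequently_sequentially by blast
    then show ?thesis by (auto simp: L2dist_commute[of T _ u] intro!: exI[of _ n])
  qed
  have "\<exists>r. \<forall>k. L2dist T (us (r k)) u < inverse (real (Suc k)) \<and> r k < r (Suc k)"
  proof (rule dependent_nat_choice)
    show "\<exists>n. L2dist T (us n) u < inverse (real (Suc 0))" using frequently_near[of 1 0] by auto
    show "\<exists>n. L2dist T (us n) u < inverse (real (Suc (Suc k))) \<and> m < n" for m k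
      using frequently_near[of "inverse (real (Suc (Suc k)))" m] by auto
  qed
  then obtain r where r: "\<And>k. L2dist T (us (r k)) u < inverse (real (Suc k))" "\<And>k. r k < r (Suc k)"
    by blast
  have "(\<lambda>k. L2dist T (us (r k)) u) \<longlonglongrightarrow> 0"
    by (rule tendsto_sandwich[OF always_eventually always_eventually tendsto_const
          LIMSEQ_inverse_real_of_nat]) (use less_imp_le[OF r(1)] in simp_all)
  then have "limitin (L2_top T) (us \<circ> r) u sequentially"
    unfolding limitin_L2_top_iff using UL uL us by (auto intro!: always_eventually)
  moreover have "strict_mono r" using r(2) by (simp add: strict_mono_Suc_iff)
  ultimately show ?thesis using that by blast
qed

lemma topspace_tau: "topspace (tau T) = Xset T"
  by (simp add: tau_def topspace_L2_top topspace_H1w_top Xset_def)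

lemma limitin_tau_iff:
  "limitin (tau T) xs x sequentially \<longleftrightarrow>
     limitin (L2_top T) (fst \<circ> xs) (fst x) sequentially \<and>
     limitin (H1w_top T) (snd \<circ> xs) (snd x) sequentially"
  by (simp add: tau_def limitin_pairwise)

lemma limitin_tau_Xeq:
  fixes x x' :: "(real \<Rightarrow> 'a::{real_inner,banach,second_countable_topology}) \<times> (real \<Rightarrow> 'a)"
  assumes lim: "limitin (tau T) xs x' sequentially" and Xeq: "Xeq T x' x" and x: "x \<in> Xset T"
  shows "limitin (tau T) xs x sequentially"
proof -
  have lim': "fst x' \<in> L2fun T" "\<forall>\<^sub>F n in sequentially. fst (xs n) \<in> L2fun T"
    "(\<lambda>n. L2dist T (fst (xs n)) (fst x')) \<longlonglongrightarrow> 0"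
    using lim by (auto simp: limitin_tau_iff limitin_L2_top_iff)
  have fx: "fst x \<in> L2fun T" using x by (auto simp: Xset_def)
  have "\<forall>\<^sub>F n in sequentially. L2dist T (fst (xs n)) (fst x') = L2dist T (fst (xs n)) (fst x)"
    using lim'(2)
  proof eventually_elim
    case (elim n)
    have "AE t in lebesgue_on {0..T}. fst x' t = fst x t" using Xeq by (simp add: Xeq_def)
    then have "L2ip T (fst (xs n) - fst x') (fst (xs n) - fst x') =
        L2ip T (fst (xs n) - fst x) (fst (xs n) - fst x)"
      using L2.diff_mem[OF elim lim'(1)] L2.diff_mem[OF elim fx]
      by (intro L2_inner_AE_cong) (auto simp: L2fun_eq)
    then show ?case by (simp add: L2dist_L2ip)
  qed
  then have "(\<lambda>n. L2dist T (fst (xs n)) (fst x)) \<longlonglongrightarrow> 0" by (rule Lim_transform_eventually[OF lim'(3)])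
  with lim lim'(2) fx Xeq show ?thesis by (simp add: limitin_tau_iff limitin_L2_top_iff Xeq_def)
qed

section \<open>Absolutely continuous functions\<close>

lemma abs_cont_on_subset:
  assumes "abs_cont_on A B g" "A \<le> a" "b \<le> B"
  shows "abs_cont_on a b g"
  unfolding abs_cont_on_def
proof (intro allI impI)
  fix e :: real assume e: "e > 0"
  from assms(1)[unfolded abs_cont_on_def, rule_format, OF e]
  obtain d where "d > 0"
    and d: "\<forall>(n::nat) s t. (\<forall>i<n. A \<le> s i \<and> s i \<le> t i \<and> t i \<le> B) \<and>
      (\<forall>i<n. \<forall>j<n. i \<noteq> j \<longrightarrow> t i \<le> s j \<or> t j \<le> s i) \<and> (\<Sum>i<n. t i - s i) < d \<longrightarrow>
      (\<Sum>i<n. \<bar>g (t i) - g (s i)\<bar>) < e"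
    by (elim exE conjE, intro that)
  show "\<exists>d>0. \<forall>(n::nat) s t. (\<forall>i<n. a \<le> s i \<and> s i \<le> t i \<and> t i \<le> b) \<and>
      (\<forall>i<n. \<forall>j<n. i \<noteq> j \<longrightarrow> t i \<le> s j \<or> t j \<le> s i) \<and> (\<Sum>i<n. t i - s i) < d \<longrightarrow>
      (\<Sum>i<n. \<bar>g (t i) - g (s i)\<bar>) < e"
  proof (intro exI[of _ d] conjI allI impI \<open>d > 0\<close>)
    fix n :: nat and s t :: "nat \<Rightarrow> real"
    assume st: "(\<forall>i<n. a \<le> s i \<and> s i \<le> t i \<and> t i \<le> b) \<and>
      (\<forall>i<n. \<forall>j<n. i \<noteq> j \<longrightarrow> t i \<le> s j \<or> t j \<le> s i) \<and> (\<Sum>i<n. t i - s i) < d"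
    then have "\<forall>i<n. A \<le> s i \<and> s i \<le> t i \<and> t i \<le> B" using assms(2,3) by force
    with st d show "(\<Sum>i<n. \<bar>g (t i) - g (s i)\<bar>) < e" by blast
  qed
qed

lemma abs_cont_on_finite_family:
  assumes ac: "abs_cont_on a b g" and e: "e > 0"
  shows "\<exists>d>0. \<forall>(I :: 'i set) s t. finite I \<longrightarrow>
      (\<forall>i\<in>I. a \<le> s i \<and> s i \<le> t i \<and> t i \<le> b) \<longrightarrow>
      (\<forall>i\<in>I. \<forall>j\<in>I. i \<noteq> j \<longrightarrow> t i \<le> s j \<or> t j \<le> s i) \<longrightarrow>
      (\<Sum>i\<in>I. t i - s i) < d \<longrightarrow> (\<Sum>i\<in>I. \<bar>g (t i) - g (s i)\<bar>) < e"
proof -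
  from ac[unfolded abs_cont_on_def, rule_format, OF e]
  obtain d where d: "d > 0" "\<forall>(n::nat) s t.
      (\<forall>i<n. a \<le> s i \<and> s i \<le> t i \<and> t i \<le> b) \<and>
      (\<forall>i<n. \<forall>j<n. i \<noteq> j \<longrightarrow> t i \<le> s j \<or> t j \<le> s i) \<and>
      (\<Sum>i<n. t i - s i) < d \<longrightarrow> (\<Sum>i<n. \<bar>g (t i) - g (s i)\<bar>) < e"
    by (elim exE conjE, intro that)
  show ?thesis
  proof (intro exI[of _ d] conjI allI impI d(1))
    fix I :: "'i set" and s t
    assume fin: "finite I" and st: "\<forall>i\<in>I. a \<le> s i \<and> s i \<le> t i \<and> t i \<le> b"
      and nonoverlapping: "\<forall>i\<in>I. \<forall>j\<in>I. i \<noteq> j \<longrightarrow> t i \<le> s j \<or> t j \<le> s i"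
      and small: "(\<Sum>i\<in>I. t i - s i) < d"
    obtain h where h: "bij_betw h {..<card I} I"
      using ex_bij_betw_nat_finite[OF fin] by (auto simp: atLeast0LessThan)
    have h_mem: "h i \<in> I" if "i < card I" for i using h that by (auto simp: bij_betw_def)
    have h_inj: "h i \<noteq> h j" if "i < card I" "j < card I" "i \<noteq> j" for i j
      using h that by (auto simp: bij_betw_def inj_on_def)
    have "(\<Sum>i<card I. \<bar>g (t (h i)) - g (s (h i))\<bar>) < e"
    proof (rule d(2)[rule_format], intro conjI allI impI)
      show "(\<Sum>i<card I. t (h i) - s (h i)) < d"
        using small sum.reindex_bij_betw[OF h, of "\<lambda>i. t i - s i"] by simp
    qed (use st nonoverlapping h_mem h_inj in blast)+
    then show "(\<Sum>i\<in>I. \<bar>g (t i) - g (s i)\<bar>) < e"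
      using sum.reindex_bij_betw[OF h, of "\<lambda>i. \<bar>g (t i) - g (s i)\<bar>"] by simp
  qed
qed

definition increment :: "(real \<Rightarrow> 'a::ab_group_add) \<Rightarrow> real \<times> real set \<Rightarrow> 'a" where
  "increment g i = g (Sup (snd i)) - g (Inf (snd i))"

lemma tagged_partial_division_of_real:
  fixes p :: "(real \<times> real set) set"
  assumes p: "p tagged_partial_division_of {a..b}" and i: "i \<in> p"
  shows "snd i = {Inf (snd i)..Sup (snd i)}"
    and "a \<le> Inf (snd i)" "Inf (snd i) \<le> fst i" "fst i \<le> Sup (snd i)" "Sup (snd i) \<le> b"
proof -
  obtain x K where i_eq: "i = (x, K)" by (cases i)
  then obtain u v where "K = {u..v}"
    using tagged_partial_division_ofD(4)[OF p] i by (metis box_real(2))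
  moreover have "x \<in> K" "K \<subseteq> {a..b}" using tagged_partial_division_ofD(2,3)[OF p] i i_eq by auto
  ultimately show "snd i = {Inf (snd i)..Sup (snd i)}"
    and "a \<le> Inf (snd i)" "Inf (snd i) \<le> fst i" "fst i \<le> Sup (snd i)" "Sup (snd i) \<le> b"
    using i_eq by auto
qed

lemma tagged_partial_division_of_real_disjoint:
  fixes p :: "(real \<times> real set) set"
  assumes p: "p tagged_partial_division_of {a..b}" and ij: "i \<in> p" "j \<in> p" "i \<noteq> j"
  shows "{Inf (snd i)<..<Sup (snd i)} \<inter> {Inf (snd j)<..<Sup (snd j)} = {}"
proof -
  have "interior (snd i) \<inter> interior (snd j) = {}"
    using tagged_partial_division_ofD(5)[OF p, of "fst i" "snd i" "fst j" "snd j"] ij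
    by (metis prod.collapse)
  then show ?thesis
    using tagged_partial_division_of_real(1)[OF p ij(1)]
      tagged_partial_division_of_real(1)[OF p ij(2)]
    by (metis interior_atLeastAtMost_real)
qed

lemma tagged_partial_division_of_real_nonoverlapping:
  fixes p :: "(real \<times> real set) set"
  assumes p: "p tagged_partial_division_of {a..b}" and ij: "i \<in> p" "j \<in> p" "i \<noteq> j"
    and nondegenerate: "Inf (snd i) < Sup (snd i)" "Inf (snd j) < Sup (snd j)"
  shows "Sup (snd i) \<le> Inf (snd j) \<or> Sup (snd j) \<le> Inf (snd i)"
proof (rule ccontr)
  assume "\<not> ?thesis"
  then have "max (Inf (snd i)) (Inf (snd j)) < min (Sup (snd i)) (Sup (snd j))"
    using nondegenerate by auto
  then obtain z where "max (Inf (snd i)) (Inf (snd j)) < z" "z < min (Sup (snd i)) (Sup (snd j))"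
    using dense by blast
  then show False using tagged_partial_division_of_real_disjoint[OF p ij] by auto
qed

lemma tagged_partial_division_of_real_length_le:
  fixes p :: "(real \<times> real set) set"
  assumes p: "p tagged_partial_division_of {a..b}"
    and S: "S \<in> lmeasurable" "\<And>i. i \<in> p \<Longrightarrow> snd i \<subseteq> S"
  shows "(\<Sum>i\<in>p. Sup (snd i) - Inf (snd i)) \<le> measure lebesgue S"
proof -
  define J where "J i = {Inf (snd i)<..<Sup (snd i)}" for i :: "real \<times> real set"
  note ordered = order_trans[OF tagged_partial_division_of_real(3,4)[OF p]]
  have fin: "finite p" using p by (rule tagged_partial_division_ofD(1))
  have "ennreal (\<Sum>i\<in>p. Sup (snd i) - Inf (snd i)) = (\<Sum>i\<in>p. emeasure lebesgue (J i))"
    using ordered by (subst sum_ennreal[symmetric]) (auto simp: J_def intro!: sum.cong)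
  also have "\<dots> = emeasure lebesgue (\<Union>i\<in>p. J i)"
    using tagged_partial_division_of_real_disjoint[OF p] fin
    by (intro sum_emeasure) (auto simp: disjoint_family_on_def J_def)
  also have "\<dots> \<le> emeasure lebesgue S"
  proof (rule emeasure_mono)
    have "J i \<subseteq> S" if "i \<in> p" for i
      using S(2)[OF that] tagged_partial_division_of_real(1)[OF p that] by (force simp: J_def)
    then show "(\<Union>i\<in>p. J i) \<subseteq> S" by blast
  qed (use S in auto)
  also have "\<dots> = ennreal (measure lebesgue S)" by (rule emeasure_eq_measure2[OF S(1)])
  finally show ?thesis by (subst (asm) ennreal_le_iff) simp_all
qed

lemma abs_cont_on_tagged_partial_division:
  assumes ac: "abs_cont_on a b g" and e: "e > 0"
  shows "\<exists>d>0. \<forall>p S. p tagged_partial_division_of {a..b} \<and> S \<in> lmeasurable \<and>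
      measure lebesgue S < d \<and> (\<forall>i\<in>p. snd i \<subseteq> S) \<longrightarrow> (\<Sum>i\<in>p. \<bar>increment g i\<bar>) < e"
proof -
  from abs_cont_on_finite_family[OF ac e, where ?'i = "real \<times> real set"]
  obtain d where "d > 0" and d: "\<forall>(I :: (real \<times> real set) set) s t. finite I \<longrightarrow>
      (\<forall>i\<in>I. a \<le> s i \<and> s i \<le> t i \<and> t i \<le> b) \<longrightarrow>
      (\<forall>i\<in>I. \<forall>j\<in>I. i \<noteq> j \<longrightarrow> t i \<le> s j \<or> t j \<le> s i) \<longrightarrow>
      (\<Sum>i\<in>I. t i - s i) < d \<longrightarrow> (\<Sum>i\<in>I. \<bar>g (t i) - g (s i)\<bar>) < e"
    by (elim exE conjE, intro that)
  show ?thesis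
  proof (intro exI[of _ d] conjI allI impI \<open>d > 0\<close>, elim conjE)
    fix p :: "(real \<times> real set) set" and S
    assume p: "p tagged_partial_division_of {a..b}"
      and S: "S \<in> lmeasurable" "measure lebesgue S < d" "\<forall>i\<in>p. snd i \<subseteq> S"
    define I where "I = {i \<in> p. Inf (snd i) < Sup (snd i)}"
    have I: "I tagged_partial_division_of {a..b}"
      by (rule tagged_partial_division_subset[OF p]) (auto simp: I_def)
    have "(\<Sum>i\<in>I. \<bar>increment g i\<bar>) < e"
      unfolding increment_def
    proof (rule d[rule_format])
      show "finite I" using I by (rule tagged_partial_division_ofD(1))
      show "a \<le> Inf (snd i) \<and> Inf (snd i) \<le> Sup (snd i) \<and> Sup (snd i) \<le> b" if "i \<in> I" for i
        using tagged_partial_division_of_real[OF I that] by auto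
      show "Sup (snd i) \<le> Inf (snd j) \<or> Sup (snd j) \<le> Inf (snd i)"
        if ij: "i \<in> I" "j \<in> I" "i \<noteq> j" for i j
        using ij
          by (intro tagged_partial_division_of_real_nonoverlapping[OF I ij]) (auto simp: I_def)
      have "(\<Sum>i\<in>I. Sup (snd i) - Inf (snd i)) \<le> measure lebesgue S"
        using S by (intro tagged_partial_division_of_real_length_le[OF I]) (auto simp: I_def)
      then show "(\<Sum>i\<in>I. Sup (snd i) - Inf (snd i)) < d" using S(2) by linarith
    qed
    moreover have "(\<Sum>i\<in>p. \<bar>increment g i\<bar>) = (\<Sum>i\<in>I. \<bar>increment g i\<bar>)"
    proof (rule sum.mono_neutral_right)
      have "Inf (snd i) = Sup (snd i)" if "i \<in> p - I" for i
        using that tagged_partial_division_of_real(3,4)[OF p, of i] by (auto simp: I_def)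
      then show "\<forall>i\<in>p - I. \<bar>increment g i\<bar> = 0" by (simp add: increment_def)
    qed (use tagged_partial_division_ofD(1)[OF p] in \<open>auto simp: I_def\<close>)
    ultimately show "(\<Sum>i\<in>p. \<bar>increment g i\<bar>) < e" by simp
  qed
qed

lemma Riemann_sum_derivative_estimate:
  fixes g g' :: "real \<Rightarrow> real"
  assumes ab: "a \<le> b" and p: "p tagged_division_of {a..b}" and P: "P \<subseteq> p" and e: "0 \<le> e"
    and linear: "\<And>x K s. (x, K) \<in> P \<Longrightarrow> s \<in> K \<Longrightarrow> \<bar>g s - g x - g' x * (s - x)\<bar> \<le> e * \<bar>s - x\<bar>"
  shows "\<bar>\<Sum>i\<in>P. measure lborel (snd i) * g' (fst i) - increment g i\<bar> \<le> e * (b - a)"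
proof -
  have part: "p tagged_partial_division_of {a..b}" using p by (simp add: tagged_division_of_def)
  have "\<bar>measure lborel (snd i) * g' (fst i) - increment g i\<bar> \<le> e * measure lborel (snd i)"
    if i: "i \<in> P" for i
  proof -
    define x u v where "x = fst i" and "u = Inf (snd i)" and "v = Sup (snd i)"
    have uv: "snd i = {u..v}" "u \<le> x" "x \<le> v"
      using tagged_partial_division_of_real[OF part, of i] i P by (auto simp: x_def u_def v_def)
    have content: "measure lborel (snd i) = v - u" using uv by simp
    have "(x, snd i) \<in> P" using i by (simp add: x_def)
    from linear[OF this, of u] linear[OF this, of v]
    have "\<bar>g u - g x - g' x * (u - x)\<bar> \<le> e * (x - u)" "\<bar>g v - g x - g' x * (v - x)\<bar> \<le> e * (v - x)"
      using uv by (simp_all add: abs_of_nonpos)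
    then have "\<bar>(g u - g x - g' x * (u - x)) - (g v - g x - g' x * (v - x))\<bar>
        \<le> e * (x - u) + e * (v - x)" by linarith
    then show ?thesis
      unfolding content increment_def x_def[symmetric] u_def[symmetric] v_def[symmetric]
      by (simp add: algebra_simps)
  qed
  then have "\<bar>\<Sum>i\<in>P. measure lborel (snd i) * g' (fst i) - increment g i\<bar>
      \<le> (\<Sum>i\<in>P. e * measure lborel (snd i))"
    by (intro order_trans[OF sum_abs] sum_mono)
  also have "\<dots> \<le> (\<Sum>i\<in>p. e * measure lborel (snd i))"
    using P e tagged_partial_division_ofD(1)[OF part] by (intro sum_mono2) auto
  also have "\<dots> = e * (b - a)"
    using additive_content_tagged_division[of p a b] p ab
    by (simp add: split_def flip: sum_distrib_left)
  finally show ?thesis .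
qed

lemma negligible_outer_open:
  assumes "negligible N" "d > 0"
  obtains S where "open S" "N \<subseteq> S" "S \<in> lmeasurable" "measure lebesgue S < d"
proof -
  obtain S where S: "open S" "N \<subseteq> S" "S - N \<in> lmeasurable" "emeasure lebesgue (S - N) < ennreal d"
    using sets_lebesgue_outer_open[OF negligible_imp_sets[OF assms(1)] assms(2)] .
  have symdiff: "negligible ((S - N - S) \<union> (S - (S - N)))"
    by (rule negligible_subset[OF assms(1)]) auto
  have "S \<in> lmeasurable" by (rule lmeasurable_negligible_symdiff[OF S(3) symdiff])
  moreover have "measure lebesgue S = measure lebesgue (S - N)"
    by (rule measure_negligible_symdiff[OF S(3) symdiff])
  moreover have "measure lebesgue (S - N) < d"
    using S(4) unfolding emeasure_eq_measure2[OF S(3)] by (simp add: ennreal_less_iff)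
  ultimately show ?thesis using that S(1,2) by simp
qed

lemma derivative_approximation_radius:
  fixes g g' :: "real \<Rightarrow> real"
  assumes deriv: "\<And>t. t \<in> A \<Longrightarrow> (g has_real_derivative g' t) (at t within B)" and e: "e > 0"
  shows "\<exists>r. (\<forall>t. r t > 0) \<and> (\<forall>t\<in>A. \<forall>s\<in>B. \<bar>s - t\<bar> < r t \<longrightarrow>
    \<bar>g s - g t - g' t * (s - t)\<bar> \<le> e * \<bar>s - t\<bar>)"
proof -
  have "\<exists>r>0. t \<in> A \<longrightarrow> (\<forall>s\<in>B. \<bar>s - t\<bar> < r \<longrightarrow> \<bar>g s - g t - g' t * (s - t)\<bar> \<le> e * \<bar>s - t\<bar>)"
    for t
  proof (cases "t \<in> A")
    case True
    then show ?thesis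
      using deriv[OF True] e unfolding has_field_derivative_def has_derivative_within_alt by auto
  qed (auto intro: exI[of _ 1])
  then show ?thesis by metis
qed

lemma Riemann_sum_estimate_off_exceptional_set:
  fixes g g' :: "real \<Rightarrow> real"
  assumes ab: "a \<le> b" and p: "p tagged_division_of {a..b}" and e: "0 \<le> e"
    and linear: "\<And>x K s. (x, K) \<in> p \<Longrightarrow> x \<notin> N \<Longrightarrow> s \<in> K \<Longrightarrow>
      \<bar>g s - g x - g' x * (s - x)\<bar> \<le> e * \<bar>s - x\<bar>"
  shows "\<bar>(\<Sum>(x, K)\<in>p. measure lborel K * (if x \<in> N then 0 else g' x)) - (g b - g a)\<bar>
    \<le> e * (b - a) + (\<Sum>i\<in>{i \<in> p. fst i \<in> N}. \<bar>increment g i\<bar>)"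
proof -
  define P Q where "P = {i \<in> p. fst i \<notin> N}" and "Q = {i \<in> p. fst i \<in> N}"
  define \<rho> where
    "\<rho> i = measure lborel (snd i) * (if fst i \<in> N then 0 else g' (fst i)) - increment g i" for i
  have "(\<Sum>(x, K)\<in>p. measure lborel K * (if x \<in> N then 0 else g' x)) - (g b - g a) = (\<Sum>i\<in>p. \<rho> i)"
    unfolding additive_tagged_division_1[OF ab p, of g, symmetric] \<rho>_def increment_def
    by (simp add: sum_subtractf split_def)
  also have "\<dots> = (\<Sum>i\<in>P. \<rho> i) + (\<Sum>i\<in>Q. \<rho> i)"
    using p by (subst sum.union_disjoint[symmetric]) (auto simp: P_def Q_def intro!: sum.cong)
  also have "\<dots> = (\<Sum>i\<in>P. measure lborel (snd i) * g' (fst i) - increment g i) -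
      (\<Sum>i\<in>Q. increment g i)"
    by (simp add: P_def Q_def \<rho>_def sum_negf)
  also have "\<bar>\<dots>\<bar> \<le> e * (b - a) + (\<Sum>i\<in>Q. \<bar>increment g i\<bar>)"
  proof -
    have "\<bar>\<Sum>i\<in>P. measure lborel (snd i) * g' (fst i) - increment g i\<bar> \<le> e * (b - a)"
      by (rule Riemann_sum_derivative_estimate[OF ab p _ e]) (auto simp: P_def intro: linear)
    then show ?thesis using sum_abs[of "increment g" Q] by linarith
  qed
  finally show ?thesis by (simp add: Q_def)
qed

lemma Riemann_sum_fine_estimate:
  fixes g g' :: "real \<Rightarrow> real"
  assumes ab: "a \<le> b" and p: "p tagged_division_of {a..b}"
    and fine: "(\<lambda>t. if t \<in> N then S else ball t (r t)) fine p" and e: "0 \<le> e"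
    and linear: "\<And>t s. t \<in> {a..b} - N \<Longrightarrow> s \<in> {a..b} \<Longrightarrow> \<bar>s - t\<bar> < r t \<Longrightarrow>
      \<bar>g s - g t - g' t * (s - t)\<bar> \<le> e * \<bar>s - t\<bar>"
    and small: "\<And>q. q tagged_partial_division_of {a..b} \<Longrightarrow> \<forall>i\<in>q. snd i \<subseteq> S \<Longrightarrow>
      (\<Sum>i\<in>q. \<bar>increment g i\<bar>) < e'"
  shows "\<bar>(\<Sum>(x, K)\<in>p. measure lborel K * (if x \<in> N then 0 else g' x)) - (g b - g a)\<bar>
    < e * (b - a) + e'"
proof -
  have part: "p tagged_partial_division_of {a..b}" using p by (simp add: tagged_division_of_def)
  have fine_subset: "K \<subseteq> (if x \<in> N then S else ball x (r x))" if "(x, K) \<in> p" for x K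
    using fineD[OF fine that] .
  have "(\<Sum>i\<in>{i \<in> p. fst i \<in> N}. \<bar>increment g i\<bar>) < e'"
  proof (rule small)
    show "{i \<in> p. fst i \<in> N} tagged_partial_division_of {a..b}"
      by (rule tagged_partial_division_subset[OF part]) auto
    show "\<forall>i\<in>{i \<in> p. fst i \<in> N}. snd i \<subseteq> S" using fine_subset by fastforce
  qed
  moreover have "\<bar>g s - g x - g' x * (s - x)\<bar> \<le> e * \<bar>s - x\<bar>"
    if "(x, K) \<in> p" "x \<notin> N" "s \<in> K" for x K s
  proof -
    have "K \<subseteq> ball x (r x)" using fine_subset[OF that(1)] that(2) by simp
    moreover have "x \<in> {a..b}" "K \<subseteq> {a..b}"
      using that(1) tagged_partial_division_ofD(2,3)[OF part, of x K] by auto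
    ultimately show ?thesis using that(2,3) by (intro linear) (auto simp: dist_real_def)
  qed
  then have "\<bar>(\<Sum>(x, K)\<in>p. measure lborel K * (if x \<in> N then 0 else g' x)) - (g b - g a)\<bar>
      \<le> e * (b - a) + (\<Sum>i\<in>{i \<in> p. fst i \<in> N}. \<bar>increment g i\<bar>)"
    by (rule Riemann_sum_estimate_off_exceptional_set[OF ab p e])
  ultimately show ?thesis by linarith
qed

text \<open>The gauge forces the subintervals tagged in the exceptional null set into an open set of small
  measure, where absolute continuity controls the increments.\<close>

theorem abs_cont_on_has_integral_derivative:
  fixes g g' :: "real \<Rightarrow> real"
  assumes ab: "a \<le> b" and ac: "abs_cont_on a b g" and N: "negligible N"
    and deriv: "\<And>t. t \<in> {a..b} - N \<Longrightarrow> (g has_real_derivative g' t) (at t within {a..b})"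
  shows "(g' has_integral (g b - g a)) {a..b}"
proof (rule has_integral_spike[OF N])
  show "((\<lambda>t. if t \<in> N then 0 else g' t) has_integral (g b - g a)) {a..b}"
    unfolding has_integral_real
  proof (intro allI impI)
    fix e :: real assume e: "e > 0"
    obtain d where "d > 0" and d: "\<forall>p S. p tagged_partial_division_of {a..b} \<and> S \<in> lmeasurable \<and>
        measure lebesgue S < d \<and> (\<forall>i\<in>p. snd i \<subseteq> S) \<longrightarrow> (\<Sum>i\<in>p. \<bar>increment g i\<bar>) < e / 2"
      using abs_cont_on_tagged_partial_division[OF ac, of "e / 2"] e by auto
    obtain S where S: "open S" "N \<subseteq> S" "S \<in> lmeasurable" "measure lebesgue S < d"
      using negligible_outer_open[OF N \<open>d > 0\<close>] .
    define e' where "e' = e / (2 * (b - a + 1))"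
    have e': "e' > 0" "e' * (b - a) < e / 2" using e ab by (auto simp: e'_def field_simps)
    obtain r where r: "\<And>t. r t > 0"
      "\<And>t s. t \<in> {a..b} - N \<Longrightarrow> s \<in> {a..b} \<Longrightarrow> \<bar>s - t\<bar> < r t \<Longrightarrow>
        \<bar>g s - g t - g' t * (s - t)\<bar> \<le> e' * \<bar>s - t\<bar>"
      using derivative_approximation_radius[OF deriv e'(1)] by metis
    define \<gamma> where "\<gamma> t = (if t \<in> N then S else ball t (r t))" for t
    have "norm ((\<Sum>(x, K)\<in>p. measure lborel K *\<^sub>R (if x \<in> N then 0 else g' x)) - (g b - g a)) < e"
      if p: "p tagged_division_of {a..b}" and fine: "\<gamma> fine p" for p
    proof -
      have "\<bar>(\<Sum>(x, K)\<in>p. measure lborel K * (if x \<in> N then 0 else g' x)) - (g b - g a)\<bar>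
          < e' * (b - a) + e / 2"
      proof (rule Riemann_sum_fine_estimate[OF ab p fine[unfolded \<gamma>_def] less_imp_le[OF e'(1)]])
        show "(\<Sum>i\<in>q. \<bar>increment g i\<bar>) < e / 2"
          if "q tagged_partial_division_of {a..b}" "\<forall>i\<in>q. snd i \<subseteq> S" for q
          using d S(3,4) that by blast
      qed (rule r(2))
      then show ?thesis using e'(2) by simp
    qed
    moreover have "gauge \<gamma>" using S r(1) by (auto simp: gauge_def \<gamma>_def)
    ultimately show "\<exists>\<gamma>. gauge \<gamma> \<and> (\<forall>p. p tagged_division_of {a..b} \<and> \<gamma> fine p \<longrightarrow>
        norm ((\<Sum>(x, K)\<in>p. measure lborel K *\<^sub>R (if x \<in> N then 0 else g' x)) - (g b - g a)) < e)"
      by blast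
  qed
qed simp

corollary abs_cont_on_FTC:
  fixes g g' :: "real \<Rightarrow> real"
  assumes t: "t \<in> {a..b}" and ac: "abs_cont_on a b g"
    and deriv: "AE s in lebesgue_on {a..b}. (g has_real_derivative g' s) (at s within {a..b})"
    and int: "integrable (lebesgue_on {a..b}) g'"
  shows "g t - g a = integral\<^sup>L (lebesgue_on {a..t}) g'"
proof -
  define N where "N = {s \<in> {a..b}. \<not> (g has_real_derivative g' s) (at s within {a..b})}"
  have "AE s in lebesgue. s \<in> {a..b} \<longrightarrow> (g has_real_derivative g' s) (at s within {a..b})"
    using deriv by (simp add: AE_restrict_space_iff)
  then obtain N' where "N' \<in> null_sets lebesgue" "N \<subseteq> N'"
    unfolding eventually_ae_filter N_def by auto
  then have N: "negligible N" using negligible_iff_null_sets negligible_subset by blast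
  have "(g' has_integral (g t - g a)) {a..t}"
  proof (rule abs_cont_on_has_integral_derivative[OF _ abs_cont_on_subset[OF ac] N])
    fix s assume "s \<in> {a..t} - N"
    then have "(g has_real_derivative g' s) (at s within {a..b})" using t by (auto simp: N_def)
    then show "(g has_real_derivative g' s) (at s within {a..t})"
      by (rule has_field_derivative_subset) (use t in auto)
  qed (use t in auto)
  moreover have "integrable (lebesgue_on {a..t}) g'"
    using t by (intro integrable_lebesgue_on_subset[OF int]) auto
  then have "(g' has_integral (integral\<^sup>L (lebesgue_on {a..t}) g')) {a..t}"
    by (rule has_integral_integral_lebesgue_on) simp
  ultimately show ?thesis by (rule has_integral_unique)
qed

section \<open>Subdifferentials\<close>

lemma zero_le_Liminf_iff:
  fixes q :: "'b \<Rightarrow> ereal"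
  shows "0 \<le> Liminf F q \<longleftrightarrow> (\<forall>e>0. \<forall>\<^sub>F w in F. ereal (- e) \<le> q w)"
proof
  assume L: "0 \<le> Liminf F q"
  show "\<forall>e>0. \<forall>\<^sub>F w in F. ereal (- e) \<le> q w"
  proof (intro allI impI)
    fix e :: real assume "e > 0"
    then have "\<forall>\<^sub>F w in F. ereal (- e) < q w" using L unfolding le_Liminf_iff by simp
    then show "\<forall>\<^sub>F w in F. ereal (- e) \<le> q w" by (rule eventually_mono) simp
  qed
next
  assume R: "\<forall>e>0. \<forall>\<^sub>F w in F. ereal (- e) \<le> q w"
  show "0 \<le> Liminf F q"
    unfolding le_Liminf_iff
  proof (intro allI impI)
    fix c :: ereal assume "c < 0"
    then obtain e where "e < 0" "c < ereal e" using ereal_dense2[of c 0] by auto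
    then show "\<forall>\<^sub>F w in F. c < q w" using R[rule_format, of "- e"] by (auto elim!: eventually_mono)
  qed
qed

lemma frechet_subdiff_iff:
  fixes f :: "'a::real_inner \<Rightarrow> ereal"
  assumes ninf: "\<And>x. f x \<noteq> -\<infinity>"
  shows "\<xi> \<in> frechet_subdiff f y \<longleftrightarrow> f y < \<infinity> \<and>
    (\<forall>e>0. \<forall>\<^sub>F w in at y. f y + ereal (inner \<xi> (w - y) - e * norm (w - y)) \<le> f w)"
proof (cases "f y < \<infinity>")
  case False
  then show ?thesis by (simp add: frechet_subdiff_def dom_fun_def)
next
  case True
  then obtain p where p: "f y = ereal p" using ninf[of y] by (cases "f y") auto
  define Q where "Q w = (f w - f y - ereal (inner \<xi> (w - y))) / ereal (norm (w - y))" for w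
  have Q_ge: "ereal (- e) \<le> Q w \<longleftrightarrow> f y + ereal (inner \<xi> (w - y) - e * norm (w - y)) \<le> f w"
    if "w \<noteq> y" for w e
  proof (cases "f w")
    case (real q)
    have "Q w = ereal ((q - p - inner \<xi> (w - y)) / norm (w - y))"
      using that by (simp add: Q_def real p)
    then have "ereal (- e) \<le> Q w \<longleftrightarrow> - e \<le> (q - p - inner \<xi> (w - y)) / norm (w - y)" by simp
    also have "\<dots> \<longleftrightarrow> - e * norm (w - y) \<le> q - p - inner \<xi> (w - y)"
      using that by (intro pos_le_divide_eq) simp
    finally show ?thesis by (auto simp: real p)
  next
    case PInf
    then show ?thesis using that by (simp add: Q_def p)
  qed (use ninf in auto)
  have "0 \<le> Liminf (at y) Q \<longleftrightarrow> (\<forall>e>0. \<forall>\<^sub>F w in at y. ereal (- e) \<le> Q w)"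
    by (rule zero_le_Liminf_iff)
  also have "\<dots> \<longleftrightarrow> (\<forall>e>0. \<forall>\<^sub>F w in at y. f y + ereal (inner \<xi> (w - y) - e * norm (w - y)) \<le> f w)"
    using Q_ge
    by (intro all_cong imp_cong[OF refl] eventually_subst) (simp add: eventually_at_filter)
  finally show ?thesis using True by (simp add: frechet_subdiff_def dom_fun_def Q_def[abs_def])
qed

lemma frechet_subdiff_add_gradient:
  fixes f :: "'a::real_inner \<Rightarrow> ereal"
  assumes ninf: "\<And>x. f x \<noteq> -\<infinity>" and deriv: "(h has_derivative inner g) (at y)"
    and \<xi>: "\<xi> \<in> frechet_subdiff f y"
  shows "\<xi> + g \<in> frechet_subdiff (\<lambda>x. f x + ereal (h x)) y"
proof -
  have fy: "f y < \<infinity>" and ineq: "\<And>e. e > 0 \<Longrightarrow>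
      \<forall>\<^sub>F w in at y. f y + ereal (inner \<xi> (w - y) - e * norm (w - y)) \<le> f w"
    using \<xi> by (simp_all add: frechet_subdiff_iff[OF ninf])
  obtain p where p: "f y = ereal p" using fy ninf[of y] by (cases "f y") auto
  have "\<forall>\<^sub>F w in at y.
      f y + ereal (h y) + ereal (inner (\<xi> + g) (w - y) - e * norm (w - y)) \<le> f w + ereal (h w)"
    if e: "e > 0" for e
  proof -
    obtain d where "d > 0"
      "\<And>w. norm (w - y) < d \<Longrightarrow> norm (h w - h y - inner g (w - y)) \<le> e / 2 * norm (w - y)"
      using deriv e unfolding has_derivative_at_alt by (metis half_gt_zero)
    then have "\<forall>\<^sub>F w in at y. \<bar>h w - h y - inner g (w - y)\<bar> \<le> e / 2 * norm (w - y)"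
      unfolding eventually_at by (intro exI[of _ d]) (auto simp: dist_norm)
    with ineq[OF half_gt_zero[OF e]] show ?thesis
    proof eventually_elim
      case (elim w)
      show ?case
      proof (cases "f w")
        case (real q)
        have "p + (inner \<xi> (w - y) - e / 2 * norm (w - y)) \<le> q" using elim(1) by (simp add: p real)
        then have "p + h y + (inner (\<xi> + g) (w - y) - e * norm (w - y)) \<le> q + h w"
          using elim(2) mult.commute[of "norm (w - y)" e] by (simp add: inner_add_left) argo
        then show ?thesis by (simp add: p real)
      qed (use ninf in auto)
    qed
  qed
  moreover have "f x + ereal (h x) \<noteq> -\<infinity>" for x using ninf[of x] by (cases "f x") auto
  ultimately show ?thesis using fy by (simp add: frechet_subdiff_iff p)
qed

lemma frechet_subdiff_add_differentiable:
  fixes f :: "'a::real_inner \<Rightarrow> ereal"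
  assumes ninf: "\<And>x. f x \<noteq> -\<infinity>" and deriv: "(h has_derivative inner g) (at y)"
  shows "\<xi> \<in> frechet_subdiff (\<lambda>x. f x + ereal (h x)) y \<longleftrightarrow> \<xi> - g \<in> frechet_subdiff f y"
proof
  assume "\<xi> - g \<in> frechet_subdiff f y"
  from frechet_subdiff_add_gradient[OF ninf deriv this]
  show "\<xi> \<in> frechet_subdiff (\<lambda>x. f x + ereal (h x)) y" by simp
next
  have ninf': "f x + ereal (h x) \<noteq> -\<infinity>" for x using ninf[of x] by (cases "f x") auto
  have deriv': "((\<lambda>x. - h x) has_derivative inner (- g)) (at y)"
    using has_derivative_minus[OF deriv] by (simp add: inner_minus_left[abs_def])
  have cancel: "f x + ereal (h x) + ereal (- h x) = f x" for x by (cases "f x") auto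
  assume "\<xi> \<in> frechet_subdiff (\<lambda>x. f x + ereal (h x)) y"
  from frechet_subdiff_add_gradient[OF ninf' deriv' this]
  show "\<xi> - g \<in> frechet_subdiff f y" by (simp add: cancel)
qed

lemma frechet_subdiff_along_segment:
  fixes f :: "'a::real_inner \<Rightarrow> ereal"
  assumes ninf: "\<And>x. f x \<noteq> -\<infinity>" and \<xi>: "\<xi> \<in> frechet_subdiff f y"
    and wy: "w \<noteq> y" and e: "e > 0"
  shows "\<exists>t\<in>{0<..<1}. f y + ereal (t * (inner \<xi> (w - y) - e)) \<le> f (y + t *\<^sub>R (w - y))"
proof -
  define z where "z t = y + t *\<^sub>R (w - y)" for t
  have z: "filterlim z (at y) (at_right 0)"
    unfolding filterlim_at
  proof
    have "(z \<longlongrightarrow> y + 0 *\<^sub>R (w - y)) (at_right 0)" unfolding z_def by (intro tendsto_intros)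
    then show "(z \<longlongrightarrow> y) (at_right 0)" by simp
    show "\<forall>\<^sub>F t in at_right 0. z t \<in> UNIV \<and> z t \<noteq> y"
      using eventually_at_right_less by eventually_elim (use wy in \<open>simp add: z_def\<close>)
  qed
  define e' where "e' = e / norm (w - y)"
  have "e' > 0" using e wy by (simp add: e'_def)
  then have "\<forall>\<^sub>F x in at y. f y + ereal (inner \<xi> (x - y) - e' * norm (x - y)) \<le> f x"
    using \<xi> by (simp add: frechet_subdiff_iff[OF ninf])
  from eventually_compose_filterlim[OF this z]
  have "\<forall>\<^sub>F t in at_right 0. f y + ereal (inner \<xi> (z t - y) - e' * norm (z t - y)) \<le> f (z t)" .
  moreover have "\<forall>\<^sub>F t in at_right 0. t \<in> {0<..<1::real}" by (rule eventually_at_right_real) simp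
  ultimately have "\<forall>\<^sub>F t in at_right 0. t \<in> {0<..<1::real} \<and>
      f y + ereal (inner \<xi> (z t - y) - e' * norm (z t - y)) \<le> f (z t)"
    by eventually_elim blast
  from eventually_happens'[OF trivial_limit_at_right_real this] obtain t where t: "t \<in> {0<..<1}"
    and ineq: "f y + ereal (inner \<xi> (z t - y) - e' * norm (z t - y)) \<le> f (z t)" by blast
  have "inner \<xi> (z t - y) - e' * norm (z t - y) = t * (inner \<xi> (w - y) - e)"
    using t wy by (simp add: z_def e'_def right_diff_distrib)
  with t ineq show ?thesis by (auto simp: z_def)
qed

lemma frechet_subdiff_convex_iff:
  fixes f :: "'a::real_inner \<Rightarrow> ereal"
  assumes convex: "convex_fun f" and ninf: "\<And>x. f x \<noteq> -\<infinity>"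
  shows "\<xi> \<in> frechet_subdiff f y \<longleftrightarrow> f y < \<infinity> \<and> (\<forall>w. f y + ereal (inner \<xi> (w - y)) \<le> f w)"
proof (intro iffI conjI allI)
  assume \<xi>: "\<xi> \<in> frechet_subdiff f y"
  then show fy: "f y < \<infinity>" by (simp add: frechet_subdiff_iff[OF ninf])
  then obtain p where p: "f y = ereal p" using ninf[of y] by (cases "f y") auto
  fix w
  show "f y + ereal (inner \<xi> (w - y)) \<le> f w"
  proof (cases "w = y \<or> f w = \<infinity>")
    case False
    then obtain q where q: "f w = ereal q" and wy: "w \<noteq> y" using ninf[of w] by (cases "f w") auto
    have "p + inner \<xi> (w - y) \<le> q + e" if e: "e > 0" for e
    proof -
      obtain t where t: "0 < t" "t < 1"
        and ineq: "ereal (p + t * (inner \<xi> (w - y) - e)) \<le> f (y + t *\<^sub>R (w - y))"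
        using frechet_subdiff_along_segment[OF ninf \<xi> wy e] by (auto simp: p)
      note ineq
      also have "y + t *\<^sub>R (w - y) = t *\<^sub>R w + (1 - t) *\<^sub>R y" by (simp add: algebra_simps)
      also have "f \<dots> \<le> ereal t * f w + ereal (1 - t) * f y"
        using convex t unfolding convex_fun_def by blast
      finally have "t * (p + inner \<xi> (w - y)) \<le> t * (q + e)" by (simp add: p q algebra_simps)
      then show ?thesis using t by simp
    qed
    then have "p + inner \<xi> (w - y) \<le> q" by (rule field_le_epsilon)
    then show ?thesis by (simp add: p q)
  qed (auto simp: p)
next
  assume ineq: "f y < \<infinity> \<and> (\<forall>w. f y + ereal (inner \<xi> (w - y)) \<le> f w)"
  have "f y + ereal (inner \<xi> (w - y) - e * norm (w - y)) \<le> f w" if "e > 0" for e w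
  proof -
    have "f y + ereal (inner \<xi> (w - y) - e * norm (w - y)) \<le> f y + ereal (inner \<xi> (w - y))"
      using that by (intro add_left_mono) simp
    then show ?thesis using ineq order_trans by blast
  qed
  then show "\<xi> \<in> frechet_subdiff f y" using ineq by (simp add: frechet_subdiff_iff[OF ninf])
qed

lemma bounded_linear_eq_inner:
  fixes l :: "'a::{real_inner,banach} \<Rightarrow> real"
  assumes "bounded_linear l"
  obtains v where "l = inner v"
proof -
  interpret bounded_linear l by fact
  obtain K where "\<And>x. norm (l x) \<le> norm x * K" using bounded by blast
  then have "(l x)\<^sup>2 \<le> K\<^sup>2 * inner x x" for x
    using power_mono[of "\<bar>l x\<bar>" "norm x * K" 2]
    by (simp add: power_mult_distrib power2_norm_eq_inner mult.commute)
  then have "Hilbert.bounded_form_on UNIV l"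
    unfolding Hilbert.bounded_form_on_def by (auto simp: add scaleR)
  then obtain v where "\<forall>x\<in>UNIV. inner v x = l x"
    using Hilbert.riesz_representation[OF Hilbert.closed_subspace_whole] by blast
  then have "l = inner v" by auto
  with that show ?thesis .
qed

lemma norm_le_onorm_inner: "norm v \<le> onorm (inner v)"
  for v :: "'a::real_inner"
proof (cases "v = 0")
  case False
  have "norm v * norm v = norm (inner v v)"
    by (simp add: power2_eq_square flip: power2_norm_eq_inner)
  also have "\<dots> \<le> onorm (inner v) * norm v" by (rule onorm[OF bounded_linear_inner_right])
  finally show ?thesis using False by simp
qed (simp add: onorm_pos_le bounded_linear_inner_right)

lemma C11_gradient:
  fixes f :: "'a::{real_inner,banach} \<Rightarrow> real"
  assumes "C11 f"
  obtains g where "\<And>x. (f has_derivative inner (g x)) (at x)" "continuous_on UNIV g"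
proof -
  have deriv: "(f has_derivative frechet_derivative f (at x)) (at x)" for x
    using assms unfolding C11_def by (simp add: frechet_derivative_works)
  have "\<exists>v. frechet_derivative f (at x) = inner v" for x
    using bounded_linear_eq_inner[OF has_derivative_bounded_linear[OF deriv[of x]]] by blast
  then obtain g where g: "\<And>x. frechet_derivative f (at x) = inner (g x)" by metis
  define Df where "Df x = frechet_derivative f (at x)" for x
  obtain L where L: "\<And>x y. onorm (\<lambda>h. Df x h - Df y h) \<le> L * norm (x - y)"
    using assms unfolding C11_def Df_def by blast
  have "(\<bar>L\<bar>)-lipschitz_on UNIV g"
  proof (rule lipschitz_onI)
    fix x y
    have "norm (g x - g y) \<le> onorm (inner (g x - g y))" by (rule norm_le_onorm_inner)
    also have "inner (g x - g y) = (\<lambda>h. Df x h - Df y h)" by (auto simp: Df_def g inner_diff_left)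
    also have "onorm \<dots> \<le> \<bar>L\<bar> * norm (x - y)"
      by (intro order_trans[OF L] mult_right_mono) auto
    finally show "dist (g x) (g y) \<le> \<bar>L\<bar> * dist x y" by (simp add: dist_norm)
  qed simp
  then have "continuous_on UNIV g" by (rule lipschitz_on_continuous_on)
  moreover have "(f has_derivative inner (g x)) (at x)" for x using deriv[of x] by (simp only: g)
  ultimately show ?thesis using that by blast
qed

section \<open>Functionals with closed or compact sublevel sets\<close>

lemma closed_sublevels_le_liminf:
  fixes f :: "'a::topological_space \<Rightarrow> ereal"
  assumes closed: "\<And>c::real. closed {x. f x \<le> ereal c}" and lim: "zs \<longlonglongrightarrow> z"
  shows "f z \<le> liminf (\<lambda>n. f (zs n))"
  unfolding le_Liminf_iff
proof (intro allI impI)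
  fix c assume "c < f z"
  then obtain d where d: "c < ereal d" "ereal d < f z" using ereal_dense2 by blast
  have "\<forall>\<^sub>F n in sequentially. zs n \<in> - {x. f x \<le> ereal d}"
    using d(2) closed by (intro topological_tendstoD[OF lim]) (auto simp: open_Compl)
  then show "\<forall>\<^sub>F n in sequentially. c < f (zs n)"
    by eventually_elim (use d(1) in \<open>auto simp: not_le intro: less_trans\<close>)
qed

lemma closed_sublevels_borel_measurable:
  fixes f :: "'a::topological_space \<Rightarrow> ereal"
  assumes closed: "\<And>c::real. closed {x. f x \<le> ereal c}" and ninf: "\<And>x. f x \<noteq> -\<infinity>"
  shows "f \<in> borel_measurable borel"
proof (rule borel_measurableI_le)
  fix c
  have "closed {x. f x \<le> c}"
    by (cases c) (use closed ninf in auto)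
  then show "{x \<in> space borel. f x \<le> c} \<in> sets borel" by simp
qed

lemma compact_sublevels_bounded_below:
  fixes f :: "'a::t2_space \<Rightarrow> ereal"
  assumes compact: "\<And>c::real. compact {x. f x \<le> ereal c}" and ninf: "\<And>x. f x \<noteq> -\<infinity>"
  shows "\<exists>m. \<forall>x. ereal m \<le> f x"
proof -
  define A where "A n = - {x. f x \<le> ereal (- real n)}" for n
  have "{x. f x \<le> ereal 0} \<subseteq> (\<Union>n\<in>UNIV. A n)"
  proof
    fix x assume "x \<in> {x. f x \<le> ereal 0}"
    then obtain r where "f x = ereal r" using ninf[of x] by (cases "f x") auto
    moreover obtain n :: nat where "- r < real n" using reals_Archimedean2 by blast
    ultimately show "x \<in> (\<Union>n\<in>UNIV. A n)" by (auto simp: A_def intro!: exI[of _ n])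
  qed
  moreover have "open (A n)" for n
    unfolding A_def by (intro open_Compl compact_imp_closed compact)
  ultimately obtain C where C: "finite C" "{x. f x \<le> ereal 0} \<subseteq> (\<Union>n\<in>C. A n)"
    using compactE_image[OF compact, of UNIV A 0] by metis
  have "ereal (- real (\<Sum>C)) \<le> f x" for x
  proof (cases "f x \<le> ereal 0")
    case True
    then have "x \<in> (\<Union>n\<in>C. A n)" using C(2) by blast
    then obtain n where n: "n \<in> C" "ereal (- real n) < f x" by (auto simp: A_def not_le)
    have "n \<le> \<Sum>C" using member_le_sum[OF n(1), of id] C(1) by simp
    then have "ereal (- real (\<Sum>C)) \<le> ereal (- real n)"
      by (simp only: ereal_less_eq neg_le_iff_le of_nat_le_iff)
    then show ?thesis using n(2) by (meson less_imp_le order_trans)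
  next
    case False
    then have "ereal 0 \<le> f x" by simp
    then show ?thesis by (rule order_trans[rotated]) (simp add: sum_nonneg)
  qed
  then show ?thesis by blast
qed

lemma open_countable_Union_cball:
  fixes S :: "'a::{metric_space,second_countable_topology} set"
  assumes "open S"
  obtains J :: "('a \<times> real) set" where "countable J" "S = (\<Union>(c, r)\<in>J. cball c r)"
proof -
  define I where "I = {(c, r). cball c r \<subseteq> S}"
  obtain \<B> where \<B>: "\<B> \<subseteq> (\<lambda>(c, r). ball c r) ` I" "countable \<B>" "\<Union>\<B> = (\<Union>(c, r)\<in>I. ball c r)"
    by (rule Lindelof[of "(\<lambda>(c, r). ball c r) ` I"]) auto
  then obtain J where J: "countable J" "J \<subseteq> I" "\<B> = (\<lambda>(c, r). ball c r) ` J"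
    by (metis countable_subset_image)
  have "S \<subseteq> (\<Union>(c, r)\<in>I. ball c r)"
  proof
    fix x assume "x \<in> S"
    then obtain r where "r > 0" "cball x r \<subseteq> S" using assms open_contains_cball by blast
    then show "x \<in> (\<Union>(c, r)\<in>I. ball c r)" by (intro UN_I[of "(x, r)"]) (auto simp: I_def)
  qed
  also have "\<dots> = (\<Union>(c, r)\<in>J. ball c r)" using \<B>(3) J(3) by simp
  also have "\<dots> \<subseteq> (\<Union>(c, r)\<in>J. cball c r)" by auto
  finally have "S \<subseteq> (\<Union>(c, r)\<in>J. cball c r)" .
  moreover have "(\<Union>(c, r)\<in>J. cball c r) \<subseteq> S" using J(2) by (auto simp: I_def)
  ultimately show ?thesis using that J(1) by blast
qed

section \<open>Convex energies with a differentiable perturbation\<close>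

locale perturbed_convex_energy =
  fixes \<phi> \<phi>1 :: "'a::{real_inner,banach,second_countable_topology} \<Rightarrow> ereal"
    and \<phi>2 :: "'a \<Rightarrow> real" and g :: "'a \<Rightarrow> 'a"
  assumes \<phi>_eq: "\<phi> = (\<lambda>x. \<phi>1 x + ereal (\<phi>2 x))"
    and \<phi>1_not_MInf: "\<phi>1 x \<noteq> -\<infinity>"
    and \<phi>1_convex: "convex_fun \<phi>1"
    and \<phi>1_subdiff_unique: "\<xi> \<in> frechet_subdiff \<phi>1 y \<Longrightarrow> \<eta> \<in> frechet_subdiff \<phi>1 y \<Longrightarrow> \<xi> = \<eta>"
    and \<phi>2_gradient: "(\<phi>2 has_derivative inner (g x)) (at x)"
    and continuous_gradient: "continuous_on UNIV g"
    and compact_sublevel: "compact {x. \<phi> x \<le> ereal c}"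
begin

lemma \<phi>_not_MInf: "\<phi> x \<noteq> -\<infinity>"
  using \<phi>1_not_MInf[of x] by (cases "\<phi>1 x") (auto simp: \<phi>_eq)

lemma \<phi>1_eq_ereal: "\<phi> x = ereal r \<Longrightarrow> \<phi>1 x = ereal (r - \<phi>2 x)"
  by (cases "\<phi>1 x") (auto simp: \<phi>_eq)

lemma continuous_\<phi>2: "continuous_on UNIV \<phi>2"
  by (intro continuous_at_imp_continuous_on ballI has_derivative_continuous[OF \<phi>2_gradient])

lemma closed_sublevel: "closed {x. \<phi> x \<le> ereal c}"
  by (rule compact_imp_closed[OF compact_sublevel])

lemma \<phi>_measurable [measurable]: "\<phi> \<in> borel_measurable borel"
  by (rule closed_sublevels_borel_measurable[OF closed_sublevel \<phi>_not_MInf])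

lemma \<phi>_bounded_below: "\<exists>m. \<forall>x. ereal m \<le> \<phi> x"
  by (rule compact_sublevels_bounded_below[OF compact_sublevel \<phi>_not_MInf])

lemma subdiff_iff:
  "\<xi> \<in> frechet_subdiff \<phi> y \<longleftrightarrow> \<phi>1 y < \<infinity> \<and> (\<forall>w. \<phi>1 y + ereal (inner (\<xi> - g y) (w - y)) \<le> \<phi>1 w)"
  unfolding \<phi>_eq frechet_subdiff_add_differentiable[OF \<phi>1_not_MInf \<phi>2_gradient]
  by (rule frechet_subdiff_convex_iff[OF \<phi>1_convex \<phi>1_not_MInf])

lemma subdiff_unique: "\<xi> \<in> frechet_subdiff \<phi> y \<Longrightarrow> \<eta> \<in> frechet_subdiff \<phi> y \<Longrightarrow> \<xi> = \<eta>"
  using \<phi>1_subdiff_unique[of "\<xi> - g y" y "\<eta> - g y"]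
  by (simp add: \<phi>_eq frechet_subdiff_add_differentiable[OF \<phi>1_not_MInf \<phi>2_gradient])

lemma subdiff_fun_eq: "\<xi> \<in> frechet_subdiff \<phi> y \<Longrightarrow> subdiff_fun \<phi> y = \<xi>"
  unfolding subdiff_fun_def using subdiff_unique by blast

lemma subdiff_fun_mem: "y \<in> dom_subdiff \<phi> \<Longrightarrow> subdiff_fun \<phi> y \<in> frechet_subdiff \<phi> y"
  using subdiff_fun_eq by (auto simp: dom_subdiff_def)

definition epigraph :: "('a \<times> real) set" where
  "epigraph = {(w, q). \<phi>1 w \<le> ereal q}"

text \<open>The part of the subgradient inequality at \<open>z\<close>, tested with a point of the epigraph, that is
  continuous in \<open>z\<close>.\<close>

definition epigraph_bound :: "'a \<times> real \<Rightarrow> 'a \<Rightarrow> real" where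
  "epigraph_bound d z = snd d + \<phi>2 z + inner (g z) (fst d - z)"

lemma continuous_epigraph_bound: "continuous_on UNIV (epigraph_bound d)"
  unfolding epigraph_bound_def by (intro continuous_intros continuous_\<phi>2 continuous_gradient)

lemma epigraph_bound_measurable [measurable]: "epigraph_bound d \<in> borel_measurable borel"
  by (rule borel_measurable_continuous_onI[OF continuous_epigraph_bound])

lemma epigraph_bound_tendsto: "zs \<longlonglongrightarrow> z \<Longrightarrow> (\<lambda>n. epigraph_bound d (zs n)) \<longlonglongrightarrow> epigraph_bound d z"
  using continuous_epigraph_bound
  by (auto simp: continuous_on_eq_continuous_at isCont_tendsto_compose)

lemma subdiff_iff_epigraph_bound:
  assumes "\<phi> y = ereal r"
  shows "\<xi> \<in> frechet_subdiff \<phi> y \<longleftrightarrow>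
    (\<forall>d\<in>epigraph. r \<le> epigraph_bound d y - inner \<xi> (fst d - y))"
proof -
  note \<phi>1y = \<phi>1_eq_ereal[OF assms]
  have "\<phi>1 y + ereal (inner (\<xi> - g y) (w - y)) \<le> \<phi>1 w \<longleftrightarrow>
      (\<forall>q. \<phi>1 w \<le> ereal q \<longrightarrow> r \<le> epigraph_bound (w, q) y - inner \<xi> (w - y))" for w
  proof (cases "\<phi>1 w")
    case (real s)
    have "r - \<phi>2 y + inner (\<xi> - g y) (w - y) \<le> s \<longleftrightarrow>
        (\<forall>q\<ge>s. r \<le> epigraph_bound (w, q) y - inner \<xi> (w - y))"
      by (auto simp: epigraph_bound_def inner_diff_left dest: spec[of _ s])
    then show ?thesis by (simp add: \<phi>1y real)
  qed (use \<phi>1_not_MInf in auto)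
  then show ?thesis by (auto simp: subdiff_iff \<phi>1y epigraph_def)
qed

lemma subdiff_imp_\<phi>_finite:
  assumes "\<xi> \<in> frechet_subdiff \<phi> y"
  obtains r where "\<phi> y = ereal r"
  using assms \<phi>_not_MInf[of y] by (cases "\<phi> y") (auto simp: frechet_subdiff_def dom_fun_def)

lemma subdiff_demiclosed:
  assumes z: "zs \<longlonglongrightarrow> z" and \<xi>s: "\<And>n. \<xi>s n \<in> frechet_subdiff \<phi> (zs n)"
    and weak: "Hilbert.weak_lim \<xi>s \<xi>" and bound: "\<And>n. inner (\<xi>s n) (\<xi>s n) \<le> M"
  shows "\<xi> \<in> frechet_subdiff \<phi> z"
proof -
  have le_bound: "\<phi> z \<le> ereal (epigraph_bound d z - inner \<xi> (fst d - z))" if d: "d \<in> epigraph" for d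
  proof -
    let ?w = "fst d"
    have "(\<lambda>n. inner ((?w - zs n) - (?w - z)) ((?w - zs n) - (?w - z)))
        \<longlonglongrightarrow> inner ((?w - z) - (?w - z)) ((?w - z) - (?w - z))"
      by (intro tendsto_intros z)
    then have "Hilbert.strong_lim (\<lambda>n. ?w - zs n) (?w - z)" by (simp add: Hilbert.strong_lim_def)
    then have "(\<lambda>n. inner (\<xi>s n) (?w - zs n)) \<longlonglongrightarrow> inner \<xi> (?w - z)"
      by (intro Hilbert.weak_lim_ip_strong_lim[OF _ _ _ bound weak]) auto
    note lim = tendsto_ereal[OF tendsto_diff[OF epigraph_bound_tendsto[OF z] this]]
    have "\<phi> (zs n) \<le> ereal (epigraph_bound d (zs n) - inner (\<xi>s n) (?w - zs n))" for n
    proof -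
      obtain r where r: "\<phi> (zs n) = ereal r" using subdiff_imp_\<phi>_finite[OF \<xi>s] .
      then show ?thesis using \<xi>s[of n] d unfolding subdiff_iff_epigraph_bound[OF r] by simp
    qed
    then have "liminf (\<lambda>n. \<phi> (zs n)) \<le>
        liminf (\<lambda>n. ereal (epigraph_bound d (zs n) - inner (\<xi>s n) (?w - zs n)))"
      by (intro Liminf_mono) simp
    also have "\<dots> = ereal (epigraph_bound d z - inner \<xi> (?w - z))"
      by (rule lim_imp_Liminf[OF sequentially_bot lim])
    finally show ?thesis
      using closed_sublevels_le_liminf[OF closed_sublevel z] by (rule order_trans[rotated])
  qed
  obtain q where "\<phi> (zs 0) = ereal q" using subdiff_imp_\<phi>_finite[OF \<xi>s] .
  then have "(zs 0, q - \<phi>2 (zs 0)) \<in> epigraph" by (simp add: epigraph_def \<phi>1_eq_ereal)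
  from le_bound[OF this] obtain r where r: "\<phi> z = ereal r"
    using \<phi>_not_MInf[of z] by (cases "\<phi> z") auto
  show ?thesis unfolding subdiff_iff_epigraph_bound[OF r] using le_bound by (simp add: r)
qed

text \<open>Bounded subgradients have weak limit points.\<close>

lemma closed_subdiff_preimage_cball: "closed {z. \<exists>\<xi>\<in>frechet_subdiff \<phi> z. \<xi> \<in> cball c r}"
  unfolding closed_sequential_limits
proof (intro allI impI, elim conjE)
  fix zs z assume "\<forall>n. zs n \<in> {z. \<exists>\<xi>\<in>frechet_subdiff \<phi> z. \<xi> \<in> cball c r}" and z: "zs \<longlonglongrightarrow> z"
  then have "\<forall>n. \<exists>\<xi>. \<xi> \<in> frechet_subdiff \<phi> (zs n) \<and> \<xi> \<in> cball c r" by auto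
  then obtain \<xi>s where \<xi>s: "\<And>n. \<xi>s n \<in> frechet_subdiff \<phi> (zs n)" "\<And>n. \<xi>s n \<in> cball c r" by metis
  then have r: "0 \<le> r" using zero_le_dist order_trans by (metis mem_cball)
  have "norm (\<xi>s n) \<le> norm c + r" for n
    using \<xi>s(2)[of n] norm_triangle_sub[of "\<xi>s n" c] by (simp add: dist_norm norm_minus_commute)
  then have bound: "inner (\<xi>s n) (\<xi>s n) \<le> (norm c + r)\<^sup>2" for n
    by (simp flip: power2_norm_eq_inner add: power_mono)
  obtain k \<xi> where k: "strict_mono k" and weak: "Hilbert.weak_lim (\<xi>s \<circ> k) \<xi>"
    using Hilbert.bounded_imp_weakly_convergent_subsequence[of \<xi>s "(norm c + r)\<^sup>2"] bound by auto
  have "\<xi> \<in> frechet_subdiff \<phi> z"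
    by (rule subdiff_demiclosed[OF LIMSEQ_subseq_LIMSEQ[OF z k] _ weak]) (use \<xi>s bound in auto)
  moreover have "\<xi> \<in> cball c r"
  proof -
    have "Hilbert.weak_lim (\<lambda>n. (\<xi>s \<circ> k) n - c) (\<xi> - c)"
      using weak by (intro Hilbert.weak_lim_diff) (auto simp: Hilbert.weak_lim_def)
    then have "inner (\<xi> - c) (\<xi> - c) \<le> r\<^sup>2"
    proof (rule Hilbert.weak_lim_ip_self_le[rotated 2])
      show "inner ((\<xi>s \<circ> k) n - c) ((\<xi>s \<circ> k) n - c) \<le> r\<^sup>2" for n
        using \<xi>s(2)[of "k n"] r
        by (simp flip: power2_norm_eq_inner add: dist_norm norm_minus_commute power_mono)
    qed auto
    then have "norm (\<xi> - c) \<le> r"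
      using r by (simp flip: power2_norm_eq_inner add: power2_le_iff_abs_le)
    then show ?thesis by (simp add: dist_norm norm_minus_commute)
  qed
  ultimately show "z \<in> {z. \<exists>\<xi>\<in>frechet_subdiff \<phi> z. \<xi> \<in> cball c r}" by auto
qed

lemma subdiff_preimage_open_measurable:
  assumes "open S"
  shows "{z \<in> dom_subdiff \<phi>. subdiff_fun \<phi> z \<in> S} \<in> sets borel"
proof -
  obtain J where J: "countable J" "S = (\<Union>(c, r)\<in>J. cball c r)"
    using open_countable_Union_cball[OF assms] .
  have "{z \<in> dom_subdiff \<phi>. subdiff_fun \<phi> z \<in> S} =
      (\<Union>(c, r)\<in>J. {z. \<exists>\<xi>\<in>frechet_subdiff \<phi> z. \<xi> \<in> cball c r})"
    using subdiff_fun_mem subdiff_fun_eq by (force simp: J(2) dom_subdiff_def)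
  also have "\<dots> \<in> sets borel"
    using J(1) closed_subdiff_preimage_cball by (intro sets.countable_UN') auto
  finally show ?thesis .
qed

definition subgradient :: "'a \<Rightarrow> 'a" where
  "subgradient z = (if z \<in> dom_subdiff \<phi> then subdiff_fun \<phi> z else 0)"

lemma subgradient_mem: "z \<in> dom_subdiff \<phi> \<Longrightarrow> subgradient z \<in> frechet_subdiff \<phi> z"
  by (simp add: subgradient_def subdiff_fun_mem)

lemma subgradient_measurable [measurable]: "subgradient \<in> borel_measurable borel"
proof (rule borel_measurableI)
  fix S :: "'a set" assume "open S"
  have "dom_subdiff \<phi> \<in> sets borel" using subdiff_preimage_open_measurable[of UNIV] by simp
  moreover have "subgradient -` S \<inter> space borel =
      {z \<in> dom_subdiff \<phi>. subdiff_fun \<phi> z \<in> S} \<union> (if 0 \<in> S then - dom_subdiff \<phi> else {})"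
    by (auto simp: subgradient_def split: if_splits)
  ultimately show "subgradient -` S \<inter> space borel \<in> sets borel"
    using subdiff_preimage_open_measurable[OF \<open>open S\<close>] by auto
qed

end

section \<open>Trajectories with square integrable subgradients\<close>

lemma compact_weak_imp_strong:
  fixes X :: "nat \<Rightarrow> 'a::real_inner"
  assumes K: "compact K" and X: "\<And>n. X n \<in> K"
    and weak: "\<And>w. (\<lambda>n. inner (X n) w) \<longlonglongrightarrow> inner x w"
  shows "X \<longlonglongrightarrow> x"
proof -
  have "limitin euclidean X x sequentially"
  proof (rule limitin_if_subsequences_limitin)
    fix r :: "nat \<Rightarrow> nat" assume r: "strict_mono r"
    have "\<forall>n. (X \<circ> r) n \<in> K" using X by simp
    then obtain l s where s: "strict_mono s" "(X \<circ> r \<circ> s) \<longlonglongrightarrow> l"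
      using compact_imp_seq_compact[OF K] unfolding seq_compact_def by metis
    have "inner l w = inner x w" for w
    proof (rule LIMSEQ_unique)
      show "(\<lambda>n. inner ((X \<circ> r \<circ> s) n) w) \<longlonglongrightarrow> inner l w" by (intro tendsto_intros s)
      show "(\<lambda>n. inner ((X \<circ> r \<circ> s) n) w) \<longlonglongrightarrow> inner x w"
        using LIMSEQ_subseq_LIMSEQ[OF weak strict_mono_o[OF r s(1)], of w] by (simp add: o_def)
    qed
    then have "l = x" by (metis vector_eq_ldot inner_commute)
    with s show "\<exists>s. strict_mono s \<and> limitin euclidean (X \<circ> r \<circ> s) x sequentially" by auto
  qed simp
  then show ?thesis by simp
qed

lemma ennreal_diff_le_liminf:
  fixes a :: real
  assumes "ereal a \<le> liminf (\<lambda>n. ereal (as n))"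
  shows "ennreal (a - m) \<le> liminf (\<lambda>n. ennreal (as n - m))"
  unfolding le_Liminf_iff
proof (intro allI impI)
  fix c assume c: "c < ennreal (a - m)"
  then obtain s where s: "c = ennreal s" "0 \<le> s" by (cases c) auto
  then have "ereal (s + m) < ereal a" using c by (simp add: ennreal_less_iff)
  then have "\<forall>\<^sub>F n in sequentially. ereal (s + m) < ereal (as n)"
    using assms unfolding le_Liminf_iff by blast
  then show "\<forall>\<^sub>F n in sequentially. c < ennreal (as n - m)"
    by eventually_elim (use s in \<open>simp add: ennreal_less_iff\<close>)
qed

lemma integral_le_lim_of_le_liminf:
  fixes as bs :: "nat \<Rightarrow> 'b \<Rightarrow> real"
  assumes "finite_measure M"
    and [measurable]: "\<And>n. as n \<in> borel_measurable M"
    and as_lower: "\<And>n x. x \<in> space M \<Longrightarrow> m \<le> as n x" and a_lower: "\<And>x. x \<in> space M \<Longrightarrow> m \<le> a x"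
    and a: "integrable M a" and bs: "\<And>n. integrable M (bs n)"
    and as_le: "\<And>n. AE x in M. as n x \<le> bs n x"
    and liminf: "\<And>x. x \<in> space M \<Longrightarrow> ereal (a x) \<le> liminf (\<lambda>n. ereal (as n x))"
    and lim: "(\<lambda>n. LINT x|M. bs n x) \<longlonglongrightarrow> L"
  shows "(LINT x|M. a x) \<le> L"
proof -
  interpret finite_measure M by fact
  define c where "c = m * measure M (space M)"
  have nn_integral_shift: "(\<integral>\<^sup>+x. ennreal (f x - m) \<partial>M) = ennreal ((LINT x|M. f x) - c)"
    and integral_shift_nonneg: "0 \<le> (LINT x|M. f x) - c"
    if f: "integrable M f" and lower: "AE x in M. m \<le> f x" for f
  proof -
    have shift: "(LINT x|M. f x) - c = (LINT x|M. f x - m)" using f by (simp add: c_def)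
    show "(\<integral>\<^sup>+x. ennreal (f x - m) \<partial>M) = ennreal ((LINT x|M. f x) - c)"
      unfolding shift using f lower by (intro nn_integral_eq_integral) auto
    show "0 \<le> (LINT x|M. f x) - c"
      unfolding shift using lower by (intro integral_nonneg_AE) auto
  qed
  have bs_lower: "AE x in M. m \<le> bs n x" for n
    using as_le[of n] AE_space by eventually_elim (use as_lower order_trans in blast)
  have "ennreal ((LINT x|M. a x) - c) = (\<integral>\<^sup>+x. ennreal (a x - m) \<partial>M)"
    by (rule nn_integral_shift[OF a AE_I2[OF a_lower], symmetric])
  also have "\<dots> \<le> (\<integral>\<^sup>+x. liminf (\<lambda>n. ennreal (as n x - m)) \<partial>M)"
    by (intro nn_integral_mono ennreal_diff_le_liminf liminf)
  also have "\<dots> \<le> liminf (\<lambda>n. \<integral>\<^sup>+x. ennreal (as n x - m) \<partial>M)"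
    by (rule nn_integral_liminf) measurable
  also have "\<dots> \<le> liminf (\<lambda>n. ennreal ((LINT x|M. bs n x) - c))"
    unfolding nn_integral_shift[OF bs bs_lower, symmetric]
  proof (intro Liminf_mono[OF always_eventually] allI nn_integral_mono_AE)
    show "AE x in M. ennreal (as n x - m) \<le> ennreal (bs n x - m)" for n
      using as_le[of n] by eventually_elim (simp add: ennreal_leI)
  qed
  also have "\<dots> = ennreal (L - c)"
    by (intro lim_imp_Liminf sequentially_bot tendsto_ennrealI tendsto_diff lim tendsto_const)
  finally have "ennreal ((LINT x|M. a x) - c) \<le> ennreal (L - c)" .
  moreover have "0 \<le> L - c"
    using integral_shift_nonneg[OF bs bs_lower]
      by (intro LIMSEQ_le_const[OF tendsto_diff[OF lim tendsto_const]]) auto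
  ultimately show ?thesis by (simp add: ennreal_le_iff)
qed

lemma AE_le_if_indicator_integrals_le:
  fixes a b :: "'b \<Rightarrow> real"
  assumes a: "integrable M a" and b: "integrable M b"
    and integrals_le: "\<And>A. A \<in> sets M \<Longrightarrow>
      (LINT x|M. indicator A x * a x) \<le> (LINT x|M. indicator A x * b x)"
  shows "AE x in M. a x \<le> b x"
proof -
  note [measurable] = a[THEN borel_measurable_integrable] b[THEN borel_measurable_integrable]
  define A where "A = {x \<in> space M. b x < a x}"
  have A: "A \<in> sets M" unfolding A_def by measurable
  define d where "d x = indicator A x * a x - indicator A x * b x" for x
  have indicator_int: "integrable M (\<lambda>x. indicator A x * a x)"
    "integrable M (\<lambda>x. indicator A x * b x)"
    using integrable_mult_indicator[OF A a] integrable_mult_indicator[OF A b] by simp_all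
  have d_nonneg: "0 \<le> d x" for x by (auto simp: d_def A_def indicator_def)
  have "(LINT x|M. d x) \<le> 0" unfolding d_def using indicator_int integrals_le[OF A] by simp
  then have "(LINT x|M. d x) = 0"
    using Bochner_Integration.integral_nonneg[OF d_nonneg] by (rule antisym)
  moreover have d_int: "integrable M d"
    unfolding d_def by (rule Bochner_Integration.integrable_diff[OF indicator_int])
  ultimately have "AE x in M. d x = 0"
    using integral_nonneg_eq_0_iff_AE[OF d_int] d_nonneg by simp
  then show ?thesis
    using AE_space
      by eventually_elim (auto simp: d_def A_def indicator_def not_less split: if_splits)
qed

lemma AE_le_of_le_liminf:
  fixes as bs :: "nat \<Rightarrow> 'b \<Rightarrow> real"
  assumes fin: "finite_measure M"
    and [measurable]: "\<And>n. as n \<in> borel_measurable M" "a \<in> borel_measurable M"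
    and as_lower: "\<And>n x. x \<in> space M \<Longrightarrow> m \<le> as n x"
    and a_bounds: "\<And>x. x \<in> space M \<Longrightarrow> m \<le> a x" "\<And>x. x \<in> space M \<Longrightarrow> a x \<le> C"
    and bs: "\<And>n. integrable M (bs n)" and b: "integrable M b"
    and as_le: "\<And>n. AE x in M. as n x \<le> bs n x"
    and liminf: "\<And>x. x \<in> space M \<Longrightarrow> ereal (a x) \<le> liminf (\<lambda>n. ereal (as n x))"
    and lim: "\<And>A. A \<in> sets M \<Longrightarrow>
      (\<lambda>n. LINT x|M. indicator A x * bs n x) \<longlonglongrightarrow> (LINT x|M. indicator A x * b x)"
  shows "AE x in M. a x \<le> b x"
proof -
  have a: "integrable M a"
    by (rule finite_measure.integrable_const_bound[OF fin, of _ "\<bar>m\<bar> + \<bar>C\<bar>"])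
      (use a_bounds in \<open>force intro: AE_I2\<close>)+
  show ?thesis
  proof (rule AE_le_if_indicator_integrals_le[OF a b])
    fix A assume A [measurable]: "A \<in> sets M"
    have indicator_int: "integrable M (\<lambda>x. indicator A x * f x)"
      if "integrable M f" for f :: "'b \<Rightarrow> real"
      using integrable_mult_indicator[OF A that] by simp
    show "(LINT x|M. indicator A x * a x) \<le> (LINT x|M. indicator A x * b x)"
    proof (rule integral_le_lim_of_le_liminf[OF fin _ _ _ indicator_int[OF a]
          indicator_int[OF bs] _ _ lim[OF A]])
      show "min m 0 \<le> indicator A x * as n x" if "x \<in> space M" for n x
        using as_lower[OF that, of n] by (auto simp: indicator_def)
      show "min m 0 \<le> indicator A x * a x" if "x \<in> space M" for x
        using a_bounds(1)[OF that] by (auto simp: indicator_def)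
      show "AE x in M. indicator A x * as n x \<le> indicator A x * bs n x" for n
        using as_le[of n] by eventually_elim (simp add: indicator_def)
      show "ereal (indicator A x * a x) \<le> liminf (\<lambda>n. ereal (indicator A x * as n x))"
        if "x \<in> space M" for x
        using liminf[OF that] by (cases "x \<in> A") (simp_all add: Liminf_const)
    qed measurable
  qed
qed

definition displacement :: "'b set \<Rightarrow> 'a::real_normed_vector \<Rightarrow> ('b \<Rightarrow> 'a) \<Rightarrow> 'b \<Rightarrow> 'a" where
  "displacement A w z = (\<lambda>t. indicator A t *\<^sub>R (w - z t))"

lemma displacement_measurable [measurable]:
  fixes z :: "'b \<Rightarrow> 'a::{real_normed_vector,second_countable_topology}"
  assumes [measurable]: "z \<in> borel_measurable M" "A \<in> sets M"
  shows "displacement A w z \<in> borel_measurable M"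
  unfolding displacement_def by measurable

lemma displacement_bounded:
  assumes "bounded K"
  shows "\<exists>R. \<forall>z t. z t \<in> K \<longrightarrow> norm (displacement A w z t) \<le> R"
proof -
  obtain R where R: "\<And>x. x \<in> K \<Longrightarrow> norm x \<le> R" using assms unfolding bounded_iff by blast
  have "norm (displacement A w z t) \<le> norm w + R" if "z t \<in> K" for z t
    using norm_triangle_ineq4[of w "z t"] R[OF that] order_trans[OF norm_ge_zero R[OF that]]
    by (auto simp: displacement_def indicator_def)
  then show ?thesis by blast
qed

lemma displacement_square_integrable:
  fixes z :: "'b \<Rightarrow> 'a::{real_inner,banach,second_countable_topology}"
  assumes "finite_measure M" and [measurable]: "z \<in> borel_measurable M" "A \<in> sets M"
    and K: "compact K" "\<And>t. t \<in> space M \<Longrightarrow> z t \<in> K"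
  shows "displacement A w z \<in> square_integrable M"
proof -
  obtain R where "\<And>z t. z t \<in> K \<Longrightarrow> norm (displacement A w z t) \<le> R"
    using displacement_bounded[OF compact_imp_bounded[OF K(1)]] by blast
  then show ?thesis using K(2) by (intro square_integrable_bounded[OF assms(1)]) auto
qed

lemma displacement_L2_tendsto:
  fixes Y :: "nat \<Rightarrow> 'b \<Rightarrow> 'a::{real_inner,banach,second_countable_topology}"
  assumes fin: "finite_measure M"
    and [measurable]: "\<And>n. Y n \<in> borel_measurable M" "y \<in> borel_measurable M" "A \<in> sets M"
    and K: "compact K" "\<And>n t. t \<in> space M \<Longrightarrow> Y n t \<in> K"
    and lim: "\<And>t. t \<in> space M \<Longrightarrow> (\<lambda>n. Y n t) \<longlonglongrightarrow> y t"
  shows "(\<lambda>n. L2_inner M (displacement A w (Y n) - displacement A w y)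
    (displacement A w (Y n) - displacement A w y)) \<longlonglongrightarrow> 0"
proof -
  obtain R where R: "\<And>z t. z t \<in> K \<Longrightarrow> norm (displacement A w z t) \<le> R"
    using displacement_bounded[OF compact_imp_bounded[OF K(1)]] by blast
  show ?thesis
  proof (rule L2_dominated_convergence[OF fin])
    show "norm (displacement A w (Y n) t) \<le> R" if "t \<in> space M" for n t
      by (intro R K(2) that)
    show "(\<lambda>n. displacement A w (Y n) t) \<longlonglongrightarrow> displacement A w y t" if "t \<in> space M" for t
      unfolding displacement_def by (intro tendsto_intros lim that)
  qed measurable
qed

context perturbed_convex_energy
begin

definition energy :: "'a \<Rightarrow> real" where "energy z = real_of_ereal (\<phi> z)"

lemma energy_measurable [measurable]: "energy \<in> borel_measurable borel"
  unfolding energy_def by measurable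

lemma \<phi>_eq_energy: "\<phi> z \<le> ereal c \<Longrightarrow> \<phi> z = ereal (energy z)"
  using \<phi>_not_MInf[of z] by (cases "\<phi> z") (auto simp: energy_def)

text \<open>A countable dense part of the epigraph makes the exceptional null sets independent of the test
  point.\<close>

lemma AE_subdiff_if_epigraph_bound:
  assumes fin: "\<And>t. t \<in> space M \<Longrightarrow> \<phi> (y t) = ereal (energy (y t))"
    and ineq: "\<And>d. d \<in> epigraph \<Longrightarrow>
      AE t in M. energy (y t) \<le> epigraph_bound d (y t) - inner (\<zeta> t) (fst d - y t)"
  shows "AE t in M. \<zeta> t \<in> frechet_subdiff \<phi> (y t)"
proof -
  obtain D where D: "countable D" "D \<subseteq> epigraph" "epigraph \<subseteq> closure D" by (rule separable)
  have "AE t in M. \<forall>d\<in>D. energy (y t) \<le> epigraph_bound d (y t) - inner (\<zeta> t) (fst d - y t)"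
    unfolding AE_ball_countable[OF D(1)] using ineq D(2) by blast
  then show ?thesis
    using AE_space
  proof eventually_elim
    case (elim t)
    have "closed {d. energy (y t) \<le> epigraph_bound d (y t) - inner (\<zeta> t) (fst d - y t)}"
      unfolding epigraph_bound_def by (intro closed_Collect_le continuous_intros)
    then have "closure D \<subseteq> {d. energy (y t) \<le> epigraph_bound d (y t) - inner (\<zeta> t) (fst d - y t)}"
      using elim(1) by (intro closure_minimal) auto
    then show ?case
      unfolding subdiff_iff_epigraph_bound[OF fin[OF elim(2)]] using D(3) by blast
  qed
qed

lemma epigraph_bound_bounded:
  assumes "compact K"
  shows "\<exists>H. \<forall>z\<in>K. \<bar>epigraph_bound d z\<bar> \<le> H"
proof -
  have "continuous_on K (epigraph_bound d)"
    by (rule continuous_on_subset[OF continuous_epigraph_bound]) simp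
  then have "bounded (epigraph_bound d ` K)"
    by (intro compact_imp_bounded compact_continuous_image assms)
  then show ?thesis by (simp add: bounded_iff)
qed

lemma epigraph_bound_integral_split:
  assumes fin: "finite_measure M" and z [measurable]: "z \<in> borel_measurable M"
    and K: "compact K" "\<And>t. t \<in> space M \<Longrightarrow> z t \<in> K"
    and \<xi>: "\<xi> \<in> square_integrable M" and A [measurable]: "A \<in> sets M"
  shows "integrable M (\<lambda>t. epigraph_bound d (z t) - inner (\<xi> t) (fst d - z t))"
    and "(LINT t|M. indicator A t * (epigraph_bound d (z t) - inner (\<xi> t) (fst d - z t))) =
      (LINT t|M. indicator A t * epigraph_bound d (z t)) - L2_inner M \<xi> (displacement A (fst d) z)"
proof -
  obtain H where H: "\<And>x. x \<in> K \<Longrightarrow> \<bar>epigraph_bound d x\<bar> \<le> H"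
    using epigraph_bound_bounded[OF K(1)] by blast
  have bound_int: "integrable M (\<lambda>t. epigraph_bound d (z t))"
    by (rule finite_measure.integrable_const_bound[OF fin, of _ H]) (use H K(2) in auto)
  have "integrable M (\<lambda>t. inner (\<xi> t) (displacement (space M) (fst d) z t))"
    by (intro integrable_inner[OF \<xi>] displacement_square_integrable[OF fin z _ K]) simp
  then have "integrable M (\<lambda>t. inner (\<xi> t) (fst d - z t))"
    by (rule Bochner_Integration.integrable_cong[THEN iffD1, OF refl, rotated])
      (simp add: displacement_def)
  then show "integrable M (\<lambda>t. epigraph_bound d (z t) - inner (\<xi> t) (fst d - z t))"
    by (intro Bochner_Integration.integrable_diff bound_int)
  have "integrable M (\<lambda>t. indicator A t * epigraph_bound d (z t))"
    using integrable_mult_indicator[OF A bound_int] by simp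
  moreover have "integrable M (\<lambda>t. inner (\<xi> t) (displacement A (fst d) z t))"
    by (rule integrable_inner[OF \<xi> displacement_square_integrable[OF fin z A K]])
  ultimately show
    "(LINT t|M. indicator A t * (epigraph_bound d (z t) - inner (\<xi> t) (fst d - z t))) =
      (LINT t|M. indicator A t * epigraph_bound d (z t)) - L2_inner M \<xi> (displacement A (fst d) z)"
    unfolding L2_inner_def
    by (subst Bochner_Integration.integral_diff[symmetric])
      (auto simp: displacement_def algebra_simps)
qed

lemma indicator_epigraph_bound_integral_tendsto:
  assumes "finite_measure M"
    and [measurable]: "\<And>n. Y n \<in> borel_measurable M" "y \<in> borel_measurable M" "A \<in> sets M"
    and K: "compact K" "\<And>n t. t \<in> space M \<Longrightarrow> Y n t \<in> K"
    and lim: "\<And>t. t \<in> space M \<Longrightarrow> (\<lambda>n. Y n t) \<longlonglongrightarrow> y t"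
  shows "(\<lambda>n. LINT t|M. indicator A t * epigraph_bound d (Y n t))
    \<longlonglongrightarrow> (LINT t|M. indicator A t * epigraph_bound d (y t))"
proof -
  interpret finite_measure M by fact
  obtain H where H: "\<And>x. x \<in> K \<Longrightarrow> \<bar>epigraph_bound d x\<bar> \<le> H"
    using epigraph_bound_bounded[OF K(1)] by blast
  show ?thesis
  proof (rule integral_dominated_convergence[where w = "\<lambda>_. \<bar>H\<bar>"])
    show "AE t in M. (\<lambda>n. indicator A t * epigraph_bound d (Y n t))
        \<longlonglongrightarrow> indicator A t * epigraph_bound d (y t)"
      by (intro AE_I2 tendsto_mult tendsto_const epigraph_bound_tendsto lim)
    show "AE t in M. norm (indicator A t * epigraph_bound d (Y n t)) \<le> \<bar>H\<bar>" for n
    proof (rule AE_I2)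
      fix t assume "t \<in> space M"
      then have "\<bar>epigraph_bound d (Y n t)\<bar> \<le> \<bar>H\<bar>" using H[OF K(2), of t n] by linarith
      then show "norm (indicator A t * epigraph_bound d (Y n t)) \<le> \<bar>H\<bar>"
        by (simp add: indicator_def)
    qed
  qed auto
qed

lemma epigraph_bound_integral_tendsto:
  fixes Y :: "nat \<Rightarrow> 'b \<Rightarrow> 'a"
  assumes fin: "finite_measure M"
    and Y: "\<And>n. Y n \<in> borel_measurable M" and y: "y \<in> borel_measurable M"
    and K: "compact K" and YK: "\<And>n t. t \<in> space M \<Longrightarrow> Y n t \<in> K" and yK: "\<And>t. t \<in> space M \<Longrightarrow> y t \<in> K"
    and lim: "\<And>t. t \<in> space M \<Longrightarrow> (\<lambda>n. Y n t) \<longlonglongrightarrow> y t"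
    and \<Xi>: "\<And>n. \<Xi> n \<in> square_integrable M" and \<zeta>: "\<zeta> \<in> square_integrable M"
    and weak: "semi_hilbert.weak_lim (square_integrable M) (L2_inner M) \<Xi> \<zeta>"
    and bound: "\<And>n. L2_inner M (\<Xi> n) (\<Xi> n) \<le> B" and A: "A \<in> sets M"
  shows "(\<lambda>n. LINT t|M. indicator A t * (epigraph_bound d (Y n t) - inner (\<Xi> n t) (fst d - Y n t)))
      \<longlonglongrightarrow> (LINT t|M. indicator A t * (epigraph_bound d (y t) - inner (\<zeta> t) (fst d - y t)))"
proof -
  interpret L2: semi_hilbert "square_integrable M" "L2_inner M :: ('b \<Rightarrow> 'a) \<Rightarrow> _"
    by (rule semi_hilbert_square_integrable)
  have "L2.strong_lim (\<lambda>n. displacement A (fst d) (Y n)) (displacement A (fst d) y)"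
    unfolding L2.strong_lim_def by (rule displacement_L2_tendsto[OF fin Y y A K YK lim])
  then have "(\<lambda>n. L2_inner M (\<Xi> n) (displacement A (fst d) (Y n)))
      \<longlonglongrightarrow> L2_inner M \<zeta> (displacement A (fst d) y)"
    by (intro L2.weak_lim_ip_strong_lim[OF \<Xi> _ _ bound weak]
        displacement_square_integrable[OF fin _ A K] Y y YK yK)
  from tendsto_diff[OF indicator_epigraph_bound_integral_tendsto[OF fin Y y A K YK lim] this]
  show ?thesis
    by (simp add: epigraph_bound_integral_split(2)[OF fin _ K _ _ A] \<Xi> \<zeta> Y y YK yK)
qed

theorem AE_subdiff_demiclosed:
  fixes Y :: "nat \<Rightarrow> 'b \<Rightarrow> 'a"
  assumes fin: "finite_measure M"
    and Y [measurable]: "\<And>n. Y n \<in> borel_measurable M" and y [measurable]: "y \<in> borel_measurable M"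
    and sublevel: "\<And>n t. t \<in> space M \<Longrightarrow> \<phi> (Y n t) \<le> ereal C"
    and lim: "\<And>t. t \<in> space M \<Longrightarrow> (\<lambda>n. Y n t) \<longlonglongrightarrow> y t"
    and \<Xi>: "\<And>n. \<Xi> n \<in> square_integrable M" and \<zeta>: "\<zeta> \<in> square_integrable M"
    and subdiff: "\<And>n. AE t in M. \<Xi> n t \<in> frechet_subdiff \<phi> (Y n t)"
    and weak: "semi_hilbert.weak_lim (square_integrable M) (L2_inner M) \<Xi> \<zeta>"
    and bound: "\<And>n. L2_inner M (\<Xi> n) (\<Xi> n) \<le> B"
  shows "AE t in M. \<zeta> t \<in> frechet_subdiff \<phi> (y t)"
proof -
  define K where "K = {x. \<phi> x \<le> ereal C}"
  have K: "compact K" unfolding K_def by (rule compact_sublevel)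
  have YK: "Y n t \<in> K" if "t \<in> space M" for n t using sublevel[OF that] by (simp add: K_def)
  have yK: "y t \<in> K" if "t \<in> space M" for t
    using closed_sequentially[OF compact_imp_closed[OF K] _ lim[OF that]] YK[OF that] by blast
  have fin_K: "\<phi> z = ereal (energy z)" if "z \<in> K" for z
    by (rule \<phi>_eq_energy[of z C]) (use that in \<open>simp add: K_def\<close>)
  obtain m where m: "\<And>x. ereal m \<le> \<phi> x" using \<phi>_bounded_below by blast
  have energy_bounds: "m \<le> energy z" "energy z \<le> C" if "z \<in> K" for z
    using m[of z] that fin_K[OF that] by (auto simp: K_def)
  show ?thesis
  proof (rule AE_subdiff_if_epigraph_bound)
    show "\<phi> (y t) = ereal (energy (y t))" if "t \<in> space M" for t by (rule fin_K[OF yK[OF that]])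
    fix d assume d: "d \<in> epigraph"
    show "AE t in M. energy (y t) \<le> epigraph_bound d (y t) - inner (\<zeta> t) (fst d - y t)"
    proof (rule AE_le_of_le_liminf[OF fin, where as = "\<lambda>n t. energy (Y n t)" and m = m and C = C])
      show "AE t in M. energy (Y n t) \<le> epigraph_bound d (Y n t) - inner (\<Xi> n t) (fst d - Y n t)"
        for n
        using subdiff[of n] AE_space
        by eventually_elim (use d subdiff_iff_epigraph_bound[OF fin_K[OF YK]] in blast)
      show "ereal (energy (y t)) \<le> liminf (\<lambda>n. ereal (energy (Y n t)))" if "t \<in> space M" for t
        using closed_sublevels_le_liminf[OF closed_sublevel lim[OF that]]
        by (simp add: fin_K[OF YK[OF that]] fin_K[OF yK[OF that]])
      show "(\<lambda>n. LINT t|M. indicator A t *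
            (epigraph_bound d (Y n t) - inner (\<Xi> n t) (fst d - Y n t)))
          \<longlonglongrightarrow> (LINT t|M. indicator A t * (epigraph_bound d (y t) - inner (\<zeta> t) (fst d - y t)))"
        if "A \<in> sets M" for A
        by (rule epigraph_bound_integral_tendsto[OF fin Y y K YK yK lim \<Xi> \<zeta> weak bound that])
    qed (use energy_bounds YK yK epigraph_bound_integral_split(1)[OF fin Y K YK \<Xi> sets.top]
        epigraph_bound_integral_split(1)[OF fin y K yK \<zeta> sets.top] in auto)
  qed
qed

end

section \<open>The De Giorgi functional\<close>

locale gradient_flow = perturbed_convex_energy +
  fixes T :: real and y0 :: 'a
  assumes T_pos: "T > 0" and chain: "chain_rule T \<phi>" and y0_dom: "y0 \<in> dom_fun \<phi>"
begin

lemma \<phi>_y0: "\<phi> y0 = ereal (energy y0)"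
  using y0_dom \<phi>_not_MInf[of y0] by (cases "\<phi> y0") (auto simp: energy_def dom_fun_def)

definition subgradient_along :: "(real \<Rightarrow> 'a) \<Rightarrow> (real \<Rightarrow> 'a) \<Rightarrow> bool" where
  "subgradient_along y \<xi> \<longleftrightarrow> y \<in> H1fun T \<and> \<xi> \<in> L2fun T \<and>
     (AE t in lebesgue_on {0..T}. \<xi> t \<in> frechet_subdiff \<phi> (y t))"

lemma subgradient_alongD:
  assumes "subgradient_along y \<xi>"
  shows "y \<in> H1fun T" "\<xi> \<in> L2fun T" "h1deriv T y \<in> L2fun T"
  using assms h1deriv_L2fun by (auto simp: subgradient_along_def)

lemma subgradient_along_energy_finite:
  "subgradient_along y \<xi> \<Longrightarrow> t \<in> {0..T} \<Longrightarrow> \<phi> (y t) = ereal (energy (y t))"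
  using chain unfolding chain_rule_def subgradient_along_def energy_def by (metis ereal_real')

lemma energy_increment:
  assumes along: "subgradient_along y \<xi>" and t: "t \<in> {0..T}"
  shows "energy (y t) - energy (y 0) = L2ip T \<xi> (\<lambda>s. indicator {0..t} s *\<^sub>R h1deriv T y s)"
proof -
  note mem = subgradient_alongD[OF along]
  have "abs_cont_on 0 T (\<lambda>t. energy (y t))"
    and "AE t in lebesgue_on {0..T}.
      ((\<lambda>s. energy (y s)) has_real_derivative inner (\<xi> t) (h1deriv T y t)) (at t within {0..T})"
    using chain along unfolding chain_rule_def subgradient_along_def energy_def by blast+
  from abs_cont_on_FTC[OF t this integrable_inner[OF mem(2,3)[unfolded L2fun_eq]]]
  have "energy (y t) - energy (y 0) = (LINT s|lebesgue_on {0..t}. inner (\<xi> s) (h1deriv T y s))" .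
  also have "\<dots> = (LINT s|lebesgue_on {0..T}. indicator {0..t} s *\<^sub>R inner (\<xi> s) (h1deriv T y s))"
    using t by (intro integral_lebesgue_on_subset) auto
  finally show ?thesis by (simp add: L2_inner_def)
qed

lemma energy_increment_final:
  assumes along: "subgradient_along y \<xi>"
  shows "energy (y T) - energy (y 0) = L2ip T \<xi> (h1deriv T y)"
proof -
  have "energy (y T) - energy (y 0) = L2ip T \<xi> (\<lambda>s. indicator {0..T} s *\<^sub>R h1deriv T y s)"
    using energy_increment[OF along, of T] T_pos by simp
  also have "\<dots> = L2ip T \<xi> (h1deriv T y)"
    unfolding L2_inner_def by (intro Bochner_Integration.integral_cong) auto
  finally show ?thesis .
qed

lemma nn_integral_dissipation:
  assumes u: "u \<in> L2fun T" and along: "subgradient_along y \<xi>"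
  shows "(\<integral>\<^sup>+ t. ennreal ((norm (h1deriv T y t))\<^sup>2 / 2 + (norm (subdiff_fun \<phi> (y t) - u t))\<^sup>2 / 2)
      \<partial>lebesgue_on {0..T}) =
    ennreal (L2ip T (h1deriv T y) (h1deriv T y) / 2 + L2ip T (\<xi> - u) (\<xi> - u) / 2)"
proof -
  let ?M = "lebesgue_on {0..T}"
  note mem = subgradient_alongD[OF along]
  have ae: "AE t in ?M. \<xi> t \<in> frechet_subdiff \<phi> (y t)"
    using along by (simp add: subgradient_along_def)
  have square_int: "integrable ?M (\<lambda>t. (norm (h1deriv T y t))\<^sup>2)"
    "integrable ?M (\<lambda>t. (norm ((\<xi> - u) t))\<^sup>2)"
    using mem(3) L2.diff_mem[OF mem(2) u] by (simp_all only: L2fun_eq integrable_norm_square)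
  have "(\<integral>\<^sup>+ t. ennreal ((norm (h1deriv T y t))\<^sup>2 / 2 + (norm (subdiff_fun \<phi> (y t) - u t))\<^sup>2 / 2)
        \<partial>?M)
      = (\<integral>\<^sup>+ t. ennreal ((norm (h1deriv T y t))\<^sup>2 / 2 + (norm ((\<xi> - u) t))\<^sup>2 / 2) \<partial>?M)"
    by (rule nn_integral_cong_AE, rule eventually_mono[OF ae]) (simp add: subdiff_fun_eq)
  also have "\<dots> = ennreal (LINT t|?M. (norm (h1deriv T y t))\<^sup>2 / 2 + (norm ((\<xi> - u) t))\<^sup>2 / 2)"
    using square_int
    by (intro nn_integral_eq_integral Bochner_Integration.integrable_add integrable_divide) auto
  also have "(LINT t|?M. (norm (h1deriv T y t))\<^sup>2 / 2 + (norm ((\<xi> - u) t))\<^sup>2 / 2)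
      = L2ip T (h1deriv T y) (h1deriv T y) / 2 + L2ip T (\<xi> - u) (\<xi> - u) / 2"
    unfolding L2_inner_self using square_int
    by (subst Bochner_Integration.integral_add) (auto simp del: minus_apply)
  finally show ?thesis .
qed

lemma G_DG_eq:
  assumes u: "u \<in> L2fun T" and along: "subgradient_along y \<xi>" and y0: "y 0 = y0"
  shows "G_DG T \<phi> y0 (u, y) = ereal (L2ip T (h1deriv T y) (h1deriv T y) / 2
    + L2ip T (\<xi> - u) (\<xi> - u) / 2 - L2ip T u (h1deriv T y) + energy (y T) - energy y0)"
proof -
  have "AE t in lebesgue_on {0..T}. y t \<in> dom_subdiff \<phi>"
    using along by (auto simp: subgradient_along_def dom_subdiff_def elim: eventually_mono)
  moreover have "\<phi> (y T) = ereal (energy (y T))"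
    using subgradient_along_energy_finite[OF along, of T] T_pos by simp
  moreover have "0 \<le> L2ip T (h1deriv T y) (h1deriv T y) / 2 + L2ip T (\<xi> - u) (\<xi> - u) / 2"
    using subgradient_alongD[OF along] u
    by (intro add_nonneg_nonneg divide_nonneg_nonneg L2.ip_nonneg L2.diff_mem) auto
  ultimately show ?thesis
    unfolding G_DG_def Let_def fst_conv snd_conv nn_integral_dissipation[OF u along]
    using y0 \<phi>_y0 by (simp add: enn2ereal_ennreal L2_inner_def del: ennreal_plus)
qed

theorem G_DG_eq_residual:
  assumes u: "u \<in> L2fun T" and along: "subgradient_along y \<xi>" and y0: "y 0 = y0"
  defines "r \<equiv> h1deriv T y + (\<xi> - u)"
  shows "G_DG T \<phi> y0 (u, y) = ereal (L2ip T r r / 2)"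
proof -
  note mem = subgradient_alongD[OF along]
  note \<xi>u = L2.diff_mem[OF mem(2) u]
  have "energy (y T) - energy y0 - L2ip T u (h1deriv T y) = L2ip T (h1deriv T y) (\<xi> - u)"
    using energy_increment_final[OF along] y0 L2.ip_diff_right[OF mem(2) u mem(3)]
      L2.ip_commute[OF mem(2,3)] L2.ip_commute[OF u mem(3)] by simp
  moreover have "L2ip T r r =
      L2ip T (h1deriv T y) (h1deriv T y) + 2 * L2ip T (h1deriv T y) (\<xi> - u)
      + L2ip T (\<xi> - u) (\<xi> - u)"
    unfolding r_def by (rule L2.ip_add_self[OF mem(3) \<xi>u])
  ultimately show ?thesis unfolding G_DG_eq[OF u along y0] by simp
qed

lemma G_DG_finite_imp_subgradient_along:
  assumes u: "u \<in> L2fun T" and y: "y \<in> H1fun T" and G: "G_DG T \<phi> y0 (u, y) < \<infinity>"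
  shows "\<exists>\<xi>. subgradient_along y \<xi> \<and> y 0 = y0"
proof -
  let ?M = "lebesgue_on {0..T}"
  have dom: "AE t in ?M. y t \<in> dom_subdiff \<phi>" and y0: "y 0 = y0"
    using G by (auto simp: G_DG_def Let_def split: if_splits)
  define \<xi> where "\<xi> t = subgradient (y t)" for t
  note [measurable] = L2fun_measurable[OF u] L2fun_measurable[OF H1fun_L2fun[OF y]]
  have [measurable]: "\<xi> \<in> borel_measurable ?M" unfolding \<xi>_def by measurable
  define I where "I = (\<integral>\<^sup>+ t. ennreal ((norm (h1deriv T y t))\<^sup>2 / 2
      + (norm (subdiff_fun \<phi> (y t) - u t))\<^sup>2 / 2) \<partial>?M)"
  have "I \<noteq> \<infinity>"
  proof
    assume "I = \<infinity>"
    then have "G_DG T \<phi> y0 (u, y) = \<infinity> + \<phi> (y T) - ereal (energy y0)"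
      unfolding G_DG_def Let_def fst_conv snd_conv I_def[symmetric] using dom y0 by (simp add: \<phi>_y0)
    then show False using G \<phi>_not_MInf[of "y T"] by simp
  qed
  moreover have "(\<integral>\<^sup>+ t. ennreal ((norm ((\<xi> - u) t))\<^sup>2 / 2) \<partial>?M) \<le> I"
    unfolding I_def
    by (rule nn_integral_mono_AE, rule eventually_mono[OF dom])
      (auto simp: \<xi>_def subgradient_def intro!: ennreal_leI)
  ultimately have "(\<integral>\<^sup>+ t. ennreal ((norm ((\<xi> - u) t))\<^sup>2 / 2) \<partial>?M) < \<infinity>"
    by (simp add: less_top le_less_trans)
  then have "integrable ?M (\<lambda>t. (norm ((\<xi> - u) t))\<^sup>2 / 2)" by (intro integrableI_bounded) auto
  from integrable_mult_right[OF this, of 2] have "\<xi> - u \<in> L2fun T"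
    by (simp add: L2fun_def fun_diff_def)
  from L2.add_mem[OF this u] have "\<xi> \<in> L2fun T" by simp
  moreover have "AE t in ?M. \<xi> t \<in> frechet_subdiff \<phi> (y t)"
    using dom by (rule eventually_mono) (simp add: \<xi>_def subgradient_mem)
  ultimately show ?thesis using y y0 by (auto simp: subgradient_along_def)
qed

lemma G_DG_nonneg:
  assumes "x \<in> Xset T"
  shows "0 \<le> G_DG T \<phi> y0 x"
proof (cases "G_DG T \<phi> y0 x < \<infinity>")
  case True
  obtain u y where x: "x = (u, y)" "u \<in> L2fun T" "y \<in> H1fun T" using assms by (auto simp: Xset_def)
  then obtain \<xi> where \<xi>: "subgradient_along y \<xi>" "y 0 = y0"
    using G_DG_finite_imp_subgradient_along True by blast
  note mem = subgradient_alongD[OF \<xi>(1)]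
  show ?thesis
    unfolding x(1) G_DG_eq_residual[OF x(2) \<xi>]
    using L2.ip_nonneg[OF L2.add_mem[OF mem(3) L2.diff_mem[OF mem(2) x(2)]]] by simp
qed auto

lemma energy_along_le:
  assumes along: "subgradient_along y \<xi>" and t: "t \<in> {0..T}"
  shows "energy (y t) \<le> energy (y 0) + L2ip T \<xi> \<xi> + L2ip T (h1deriv T y) (h1deriv T y) / 4"
proof -
  note mem = subgradient_alongD[OF along]
  let ?v = "\<lambda>s. indicator {0..t} s *\<^sub>R h1deriv T y s"
  have v: "?v \<in> L2fun T" "L2ip T ?v ?v \<le> L2ip T (h1deriv T y) (h1deriv T y)"
    using square_integrable_indicator[OF _ initial_interval_sets[OF t]] mem(3)
    by (auto simp: L2fun_eq)
  have "energy (y t) - energy (y 0) = L2ip T \<xi> ?v" by (rule energy_increment[OF along t])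
  also have "\<dots> \<le> L2ip T \<xi> \<xi> + L2ip T ?v ?v / 4" by (rule L2.ip_le_ip_self[OF mem(2) v(1)])
  finally show ?thesis using v(2) by linarith
qed

lemma G_DG_apriori_bounds:
  "\<exists>M. \<forall>u y \<xi>. u \<in> L2fun T \<and> subgradient_along y \<xi> \<and> y 0 = y0 \<and>
     L2ip T u u \<le> B \<and> G_DG T \<phi> y0 (u, y) \<le> ereal C \<longrightarrow>
     L2ip T (h1deriv T y) (h1deriv T y) \<le> M \<and> L2ip T \<xi> \<xi> \<le> M \<and> (\<forall>t\<in>{0..T}. \<phi> (y t) \<le> ereal M)"
proof -
  obtain m where m: "\<And>x. ereal m \<le> \<phi> x" using \<phi>_bounded_below by blast
  define K where "K = C + B - m + energy y0"
  define M where "M = \<bar>energy y0\<bar> + (4 * K + 2 * B) + K"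
  have "L2ip T (h1deriv T y) (h1deriv T y) \<le> M \<and> L2ip T \<xi> \<xi> \<le> M \<and> (\<forall>t\<in>{0..T}. \<phi> (y t) \<le> ereal M)"
    if u: "u \<in> L2fun T" and along: "subgradient_along y \<xi>" and y0: "y 0 = y0"
      and B: "L2ip T u u \<le> B" and C: "G_DG T \<phi> y0 (u, y) \<le> ereal C" for u y \<xi>
  proof -
    note mem = subgradient_alongD[OF along]
    note \<xi>u = L2.diff_mem[OF mem(2) u]
    define v where "v = h1deriv T y"
    have v: "v \<in> L2fun T" unfolding v_def by (rule mem(3))
    note nonneg = L2.ip_nonneg[OF v] L2.ip_nonneg[OF \<xi>u] L2.ip_nonneg[OF u]
    have "m \<le> energy (y T)"
      using m[of "y T"] subgradient_along_energy_finite[OF along, of T] T_pos by simp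
    moreover have "L2ip T v v / 2 + L2ip T (\<xi> - u) (\<xi> - u) / 2 - L2ip T u v
        + energy (y T) - energy y0 \<le> C"
      using C unfolding G_DG_eq[OF u along y0] v_def by simp
    ultimately have "L2ip T v v / 4 + L2ip T (\<xi> - u) (\<xi> - u) / 2 \<le> K"
      using L2.ip_le_ip_self[OF u v] B unfolding K_def by linarith
    then have v_bound: "L2ip T v v \<le> 4 * K" and \<xi>u_bound: "L2ip T (\<xi> - u) (\<xi> - u) \<le> 2 * K"
      using nonneg by linarith+
    have \<xi>_bound: "L2ip T \<xi> \<xi> \<le> 4 * K + 2 * B"
      using L2.ip_add_self_le[OF \<xi>u u] \<xi>u_bound B by simp
    have "\<phi> (y t) \<le> ereal M" if t: "t \<in> {0..T}" for t
      using energy_along_le[OF along t] \<xi>_bound v_bound y0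
        subgradient_along_energy_finite[OF along t]
      unfolding M_def v_def by simp
    moreover have "L2ip T v v \<le> M" "L2ip T \<xi> \<xi> \<le> M"
      using v_bound \<xi>_bound nonneg B unfolding M_def by linarith+
    ultimately show ?thesis by (simp add: v_def)
  qed
  then show ?thesis by blast
qed

lemma weak_lim_h1deriv_imp_pointwise:
  assumes Y: "\<And>n. Y n \<in> H1fun T" and y: "y \<in> H1fun T" and start: "\<And>n. Y n 0 = y 0"
    and weak: "L2.weak_lim T (\<lambda>n. h1deriv T (Y n)) (h1deriv T y)" and t: "t \<in> {0..T}"
  shows "(\<lambda>n. inner (Y n t) w) \<longlonglongrightarrow> inner (y t) w"
proof -
  have "(\<lambda>s. indicator {0..t} s *\<^sub>R w) \<in> L2fun T"
    by (rule L2fun_indicator_const[OF initial_interval_sets[OF t]])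
  then have "(\<lambda>n. inner (y 0) w + L2ip T (h1deriv T (Y n)) (\<lambda>s. indicator {0..t} s *\<^sub>R w)) \<longlonglongrightarrow>
      inner (y 0) w + L2ip T (h1deriv T y) (\<lambda>s. indicator {0..t} s *\<^sub>R w)"
    using weak by (intro tendsto_intros) (simp add: L2.weak_lim_def)
  then show ?thesis using inner_H1fun[OF Y t] inner_H1fun[OF y t] start by simp
qed

lemma limitin_H1w_top_if_weak_lim:
  assumes Y: "\<And>n. Y n \<in> H1fun T" and y: "y \<in> H1fun T" and weak: "L2.weak_lim T Y y"
    and deriv: "L2.weak_lim T (\<lambda>n. h1deriv T (Y n)) (h1deriv T y)"
  shows "limitin (H1w_top T) Y y sequentially"
  unfolding limitin_H1w_top_iff H1inner_L2ip using weak deriv unfolding L2.weak_lim_def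
  by (auto intro!: tendsto_add y Y always_eventually dest: H1fun_L2fun h1deriv_L2fun)

text \<open>The weak limit of the velocities determines the weak limit of every \<open>Y n t\<close>, and these points
  lie in a compact sublevel set.\<close>

lemma trajectories_converge:
  assumes Y: "\<And>n. Y n \<in> H1fun T" and y0: "\<And>n. Y n 0 = y0"
    and v: "v \<in> L2fun T" and weak: "L2.weak_lim T (\<lambda>n. h1deriv T (Y n)) v"
    and sublevel: "\<And>n t. t \<in> {0..T} \<Longrightarrow> \<phi> (Y n t) \<le> ereal M"
  obtains y where "y \<in> H1fun T" "y 0 = y0" "limitin (H1w_top T) Y y sequentially"
    "\<And>t. t \<in> {0..T} \<Longrightarrow> (\<lambda>n. Y n t) \<longlonglongrightarrow> y t"
    "L2.weak_lim T (\<lambda>n. h1deriv T (Y n)) (h1deriv T y)"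
proof -
  define y where "y = (\<lambda>t. if t \<in> {0..T} then y0 + integral\<^sup>L (lebesgue_on {0..t}) v else 0)"
  have y: "y \<in> H1fun T" "y 0 = y0" "AE t in lebesgue_on {0..T}. h1deriv T y t = v t"
    unfolding y_def using indefinite_integral_H1fun[OF less_imp_le[OF T_pos] v, of y0] by auto
  have "L2ip T (h1deriv T y) z = L2ip T v z" if "z \<in> L2fun T" for z
    using y v that h1deriv_L2fun by (intro L2_inner_AE_cong) (auto simp: L2fun_eq)
  then have deriv: "L2.weak_lim T (\<lambda>n. h1deriv T (Y n)) (h1deriv T y)"
    using weak by (simp add: L2.weak_lim_def)
  have K: "compact {x. \<phi> x \<le> ereal M}" by (rule compact_sublevel)
  have pointwise: "(\<lambda>n. Y n t) \<longlonglongrightarrow> y t" if t: "t \<in> {0..T}" for t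
  proof (rule compact_weak_imp_strong[OF K])
    show "Y n t \<in> {x. \<phi> x \<le> ereal M}" for n using sublevel[OF t] by simp
    show "(\<lambda>n. inner (Y n t) w) \<longlonglongrightarrow> inner (y t) w" for w
      by (rule weak_lim_h1deriv_imp_pointwise[OF Y y(1) _ deriv t]) (simp add: y0 y(2))
  qed
  obtain R where R: "\<And>z. \<phi> z \<le> ereal M \<Longrightarrow> norm z \<le> R"
    using compact_imp_bounded[OF K] unfolding bounded_iff by auto
  have "L2.strong_lim T Y y"
    unfolding L2.strong_lim_def
  proof (rule L2_dominated_convergence[OF finite_measure_interval])
    show "norm (Y n t) \<le> R" if "t \<in> space (lebesgue_on {0..T})" for n t
      using R sublevel that by simp
  qed (use pointwise in \<open>auto intro!: L2fun_measurable H1fun_L2fun Y y(1)\<close>)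
  then have "L2.weak_lim T Y y"
    by (rule L2.strong_imp_weak_lim[OF H1fun_L2fun[OF Y] H1fun_L2fun[OF y(1)]])
  then have "limitin (H1w_top T) Y y sequentially"
    by (rule limitin_H1w_top_if_weak_lim[OF Y y(1) _ deriv])
  with y pointwise deriv show ?thesis using that by blast
qed

lemma weakly_convergent_velocities_subgradients:
  fixes v \<xi> :: "nat \<Rightarrow> real \<Rightarrow> 'a"
  assumes "\<And>n. v n \<in> L2fun T" "\<And>n. L2ip T (v n) (v n) \<le> M"
    and "\<And>n. \<xi> n \<in> L2fun T" "\<And>n. L2ip T (\<xi> n) (\<xi> n) \<le> M"
  obtains r v' \<xi>' where "strict_mono r" "v' \<in> L2fun T" "\<xi>' \<in> L2fun T"
    "L2.weak_lim T (\<lambda>n. v (r n)) v'" "L2.weak_lim T (\<lambda>n. \<xi> (r n)) \<xi>'"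
proof -
  obtain r1 v' where r1: "strict_mono r1" "v' \<in> L2fun T" "L2.weak_lim T (v \<circ> r1) v'"
    using L2.bounded_imp_weakly_convergent_subsequence[of v T M] assms by blast
  obtain r2 \<xi>' where r2: "strict_mono r2" "\<xi>' \<in> L2fun T" "L2.weak_lim T (\<xi> \<circ> r1 \<circ> r2) \<xi>'"
    using L2.bounded_imp_weakly_convergent_subsequence[of "\<xi> \<circ> r1" T M] assms by auto
  show ?thesis
  proof (rule that)
    show "strict_mono (r1 \<circ> r2)" by (rule strict_mono_o[OF r1(1) r2(1)])
    show "L2.weak_lim T (\<lambda>n. v ((r1 \<circ> r2) n)) v'"
      using L2.weak_lim_subseq[OF r1(3) r2(1)] by (simp add: o_def)
  qed (use r1(2) r2(2,3) in \<open>simp_all add: o_def\<close>)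
qed

lemma G_DG_le_of_weak_lim:
  assumes us: "\<And>n. us n \<in> L2fun T" and u: "u \<in> L2fun T" "L2.strong_lim T us u"
    and \<xi>: "\<And>n. subgradient_along (ys n) (\<xi> n)" "\<And>n. ys n 0 = y0"
    and \<zeta>: "subgradient_along y \<zeta>" "y 0 = y0"
    and weak: "L2.weak_lim T (\<lambda>n. h1deriv T (ys n)) (h1deriv T y)" "L2.weak_lim T \<xi> \<zeta>"
    and G: "\<And>n. G_DG T \<phi> y0 (us n, ys n) \<le> ereal C"
  shows "G_DG T \<phi> y0 (u, y) \<le> ereal C"
proof -
  note mem = subgradient_alongD[OF \<xi>(1)] subgradient_alongD[OF \<zeta>(1)]
  define r where "r n = h1deriv T (ys n) + (\<xi> n - us n)" for n
  have "L2.weak_lim T us u" by (rule L2.strong_imp_weak_lim[OF us u])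
  then have r_lim: "L2.weak_lim T r (h1deriv T y + (\<zeta> - u))"
    unfolding r_def by (intro L2.weak_lim_add L2.weak_lim_diff L2.diff_mem mem us u(1) weak)
  have "L2ip T (h1deriv T y + (\<zeta> - u)) (h1deriv T y + (\<zeta> - u)) \<le> 2 * C"
  proof (rule L2.weak_lim_ip_self_le[OF _ _ r_lim])
    show "L2ip T (r n) (r n) \<le> 2 * C" for n
      using G[of n] unfolding G_DG_eq_residual[OF us \<xi>] r_def by simp
  qed (auto simp: r_def intro!: L2.add_mem L2.diff_mem mem us u(1))
  then show ?thesis unfolding G_DG_eq_residual[OF u(1) \<zeta>] by simp
qed

theorem G_DG_sublevel_compact:
  assumes lim: "limitin (L2_top T) us u sequentially" and us: "\<And>n. us n \<in> L2fun T"
    and ys: "\<And>n. ys n \<in> H1fun T" and G: "\<And>n. G_DG T \<phi> y0 (us n, ys n) \<le> ereal C"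
  obtains r y where "strict_mono r" "limitin (H1w_top T) (ys \<circ> r) y sequentially"
    "G_DG T \<phi> y0 (u, y) \<le> ereal C"
proof -
  have u: "u \<in> L2fun T" using lim by (simp add: limitin_L2_top_iff)
  have us_lim: "L2.strong_lim T us u" by (rule limitin_L2_top_imp_strong_lim[OF lim])
  have "G_DG T \<phi> y0 (us n, ys n) < \<infinity>" for n by (rule le_less_trans[OF G]) simp
  then have "\<exists>\<xi>. subgradient_along (ys n) \<xi> \<and> ys n 0 = y0" for n
    by (rule G_DG_finite_imp_subgradient_along[OF us ys])
  then obtain \<xi> where \<xi>: "\<And>n. subgradient_along (ys n) (\<xi> n)" and y0: "\<And>n. ys n 0 = y0" by metis
  note mem = subgradient_alongD[OF \<xi>]
  have "Bseq (\<lambda>n. L2ip T (us n) (us n))"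
    by (rule convergent_imp_Bseq[OF convergentI[OF L2.strong_lim_ip_self[OF us u us_lim]]])
  then obtain B where B: "\<And>n. L2ip T (us n) (us n) \<le> B"
    unfolding Bseq_def by (auto simp: abs_le_iff)
  obtain M where M: "\<And>n. L2ip T (h1deriv T (ys n)) (h1deriv T (ys n)) \<le> M"
    "\<And>n. L2ip T (\<xi> n) (\<xi> n) \<le> M" "\<And>n t. t \<in> {0..T} \<Longrightarrow> \<phi> (ys n t) \<le> ereal M"
    using G_DG_apriori_bounds[of B C] us \<xi> y0 B G by meson
  obtain r v \<zeta> where r: "strict_mono r" and v: "v \<in> L2fun T" and \<zeta>: "\<zeta> \<in> L2fun T"
    and weak: "L2.weak_lim T (\<lambda>n. h1deriv T (ys (r n))) v" "L2.weak_lim T (\<lambda>n. \<xi> (r n)) \<zeta>"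
    using weakly_convergent_velocities_subgradients[of "\<lambda>n. h1deriv T (ys n)" M \<xi>] mem M(1,2)
    by blast
  obtain y where y: "y \<in> H1fun T" "y 0 = y0" "limitin (H1w_top T) (\<lambda>n. ys (r n)) y sequentially"
    "\<And>t. t \<in> {0..T} \<Longrightarrow> (\<lambda>n. ys (r n) t) \<longlonglongrightarrow> y t"
    "L2.weak_lim T (\<lambda>n. h1deriv T (ys (r n))) (h1deriv T y)"
    using trajectories_converge[of "\<lambda>n. ys (r n)" v M] ys y0 v weak(1) M(3) by blast
  have "AE t in lebesgue_on {0..T}. \<zeta> t \<in> frechet_subdiff \<phi> (y t)"
  proof (rule AE_subdiff_demiclosed[OF finite_measure_interval,
        of "\<lambda>n. ys (r n)" _ _ y M "\<lambda>n. \<xi> (r n)" \<zeta> M])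
    show "AE t in lebesgue_on {0..T}. \<xi> (r n) t \<in> frechet_subdiff \<phi> (ys (r n) t)" for n
      using \<xi> by (simp add: subgradient_along_def)
  qed (use mem y \<zeta> weak(2) M in \<open>auto simp: H1fun_L2fun L2fun_measurable simp flip: L2fun_eq\<close>)
  then have along: "subgradient_along y \<zeta>" using y \<zeta> by (simp add: subgradient_along_def)
  have "L2.strong_lim T (\<lambda>n. us (r n)) u"
    using L2.strong_lim_subseq[OF us_lim r] by (simp add: o_def)
  then have "G_DG T \<phi> y0 (u, y) \<le> ereal C"
    by (rule G_DG_le_of_weak_lim[OF us u _ \<xi> y0 along y(2,5) weak(2) G])
  with r y(3) that show ?thesis by (simp add: o_def)
qed

lemma G_DG_le_liminf:
  assumes lim: "limitin (tau T) xs x sequentially" and xs: "\<And>n. xs n \<in> Xset T"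
  shows "G_DG T \<phi> y0 x \<le> liminf (\<lambda>n. G_DG T \<phi> y0 (xs n))"
proof (rule ccontr)
  assume "\<not> ?thesis"
  then obtain c where c: "liminf (\<lambda>n. G_DG T \<phi> y0 (xs n)) < ereal c" "ereal c < G_DG T \<phi> y0 x"
    using ereal_dense2 by (metis not_le)
  obtain k where k: "strict_mono k"
    "((\<lambda>n. G_DG T \<phi> y0 (xs n)) \<circ> k) \<longlonglongrightarrow> liminf (\<lambda>n. G_DG T \<phi> y0 (xs n))"
    using liminf_subseq_lim by blast
  obtain N where N: "\<And>n. n \<ge> N \<Longrightarrow> G_DG T \<phi> y0 (xs (k n)) < ereal c"
    using order_tendstoD(2)[OF k(2) c(1)] by (auto simp: eventually_sequentially)
  define s where "s n = k (n + N)" for n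
  have s: "strict_mono s" using k(1) by (simp add: s_def strict_mono_def)
  have lim_s: "limitin (L2_top T) (\<lambda>n. fst (xs (s n))) (fst x) sequentially"
    "limitin (H1w_top T) (\<lambda>n. snd (xs (s n))) (snd x) sequentially"
    using limitin_subsequence[OF s lim] by (simp_all add: limitin_tau_iff o_def)
  have "fst (xs n) \<in> L2fun T" "snd (xs n) \<in> H1fun T" for n using xs[of n] by (auto simp: Xset_def)
  moreover have "G_DG T \<phi> y0 (fst (xs (s n)), snd (xs (s n))) \<le> ereal c" for n
    using less_imp_le[OF N[of "n + N"]] by (simp add: s_def)
  ultimately obtain r y where r: "strict_mono r"
    "limitin (H1w_top T) ((\<lambda>n. snd (xs (s n))) \<circ> r) y sequentially"
    "G_DG T \<phi> y0 (fst x, y) \<le> ereal c"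
    using G_DG_sublevel_compact[OF lim_s(1), of "\<lambda>n. snd (xs (s n))" c] by blast
  have "y = snd x"
    by (rule limitin_H1w_top_unique[OF T_pos r(2) limitin_subsequence[OF r(1) lim_s(2)]])
  then show False using r(3) c(2) by (simp add: leD)
qed

end

section \<open>Penalization\<close>

lemma minimizing_sequence:
  fixes f :: "'c \<Rightarrow> ereal"
  assumes "S \<noteq> {}"
  obtains xs where "\<And>n::nat. xs n \<in> S" "(\<lambda>n. f (xs n)) \<longlonglongrightarrow> (INF x\<in>S. f x)"
proof -
  obtain u where u: "range u \<subseteq> f ` S" "u \<longlonglongrightarrow> Inf (f ` S)"
    using Inf_as_limit[of "f ` S"] assms by auto
  then have "\<forall>n. \<exists>x\<in>S. u n = f x" by blast
  then obtain xs where xs: "\<And>n. xs n \<in> S" and u_eq: "\<And>n. u n = f (xs n)" by metis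
  from u(2) have "(\<lambda>n. f (xs n)) \<longlonglongrightarrow> (INF x\<in>S. f x)" by (simp flip: u_eq)
  with xs show ?thesis by (rule that)
qed

lemma quasimin_seq_subseq:
  assumes "quasimin_seq S E \<epsilon> xs" and r: "strict_mono r"
  shows "quasimin_seq S E (\<epsilon> \<circ> r) (xs \<circ> r)"
  using assms(1) LIMSEQ_subseq_LIMSEQ[OF _ r, of \<epsilon> 0]
    LIMSEQ_subseq_LIMSEQ[OF _ r, of "\<lambda>n. E (\<epsilon> n) (xs n) - (INF x\<in>S. E (\<epsilon> n) x)" 0]
    eventually_subseq[OF r, of "\<lambda>n. E (\<epsilon> n) (xs n) < \<infinity>"]
  by (simp add: quasimin_seq_def o_def)

locale penalization =
  fixes X :: "'b topology" and F :: "'b \<Rightarrow> ennreal" and G :: "'b \<Rightarrow> ereal"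
  assumes topspace_nonempty: "topspace X \<noteq> {}"
    and F_lsc: "lsc_top X F"
    and G_nonneg: "x \<in> topspace X \<Longrightarrow> 0 \<le> G x"
    and G_le_liminf: "limitin X xs x sequentially \<Longrightarrow> (\<And>n::nat. xs n \<in> topspace X) \<Longrightarrow>
        G x \<le> liminf (\<lambda>n. G (xs n))"
    and sublevel_compact: "(\<And>n::nat. xs n \<in> topspace X) \<Longrightarrow> (\<And>n. F (xs n) < \<infinity>) \<Longrightarrow>
        (\<And>n. G (xs n) \<le> ereal C) \<Longrightarrow> \<exists>r x. strict_mono r \<and> limitin X (xs \<circ> r) x sequentially"
begin

definition penalized :: "real \<Rightarrow> 'b \<Rightarrow> ereal" where
  "penalized \<epsilon> x = enn2ereal (F x) + ereal (1 / \<epsilon>) * G x"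

definition gamma_limit :: "'b \<Rightarrow> ereal" where
  "gamma_limit x = (if G x = 0 then enn2ereal (F x) else \<infinity>)"

lemma limitin_topspace: "limitin X xs x sequentially \<Longrightarrow> x \<in> topspace X"
  by (simp add: limitin_def)

lemma F_le_penalized: "x \<in> topspace X \<Longrightarrow> \<epsilon> > 0 \<Longrightarrow> enn2ereal (F x) \<le> penalized \<epsilon> x"
  unfolding penalized_def using G_nonneg[of x] by (simp add: ereal_le_add_self)

lemma penalized_nonneg: "x \<in> topspace X \<Longrightarrow> \<epsilon> > 0 \<Longrightarrow> 0 \<le> penalized \<epsilon> x"
  using F_le_penalized order_trans enn2ereal_nonneg by blast

lemma mult_penalized:
  assumes "\<epsilon> > 0" "x \<in> topspace X"
  shows "ereal \<epsilon> * penalized \<epsilon> x = ereal \<epsilon> * enn2ereal (F x) + G x"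
proof -
  have "ereal \<epsilon> * (ereal (1 / \<epsilon>) * G x) = G x" using assms by (simp add: mult.assoc[symmetric])
  then show ?thesis
    unfolding penalized_def using assms G_nonneg[OF assms(2)] by (subst ereal_pos_distrib) auto
qed

lemma G_le_penalized:
  assumes "\<epsilon> > 0" "x \<in> topspace X" "penalized \<epsilon> x \<le> ereal c"
  shows "G x \<le> ereal (\<epsilon> * c)"
proof -
  have "G x \<le> ereal \<epsilon> * penalized \<epsilon> x"
    unfolding mult_penalized[OF assms(1,2)]
      using assms(1) by (intro add_increasing) (auto simp: enn2ereal_nonneg)
  also have "\<dots> \<le> ereal \<epsilon> * ereal c" using assms by (intro ereal_mult_left_mono) auto
  finally show ?thesis by simp
qed

lemma F_less_top:
  assumes "\<epsilon> > 0" "x \<in> topspace X" "penalized \<epsilon> x < \<infinity>"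
  shows "F x < \<infinity>"
proof -
  have "enn2ereal (F x) < \<infinity>" using F_le_penalized[OF assms(2,1)] assms(3) by (rule le_less_trans)
  then show ?thesis by (simp add: less_ennreal.rep_eq top_ennreal.rep_eq)
qed

lemma penalized_le_liminf:
  assumes "\<epsilon> > 0" and lim: "limitin X xs x sequentially" and xs: "\<And>n. xs n \<in> topspace X"
  shows "penalized \<epsilon> x \<le> liminf (\<lambda>n. penalized \<epsilon> (xs n))"
proof -
  have "ereal (1 / \<epsilon>) * G x \<le> ereal (1 / \<epsilon>) * liminf (\<lambda>n. G (xs n))"
    using assms(1) by (intro ereal_mult_left_mono G_le_liminf lim xs) auto
  also have "\<dots> = liminf (\<lambda>n. ereal (1 / \<epsilon>) * G (xs n))"
    using assms(1) by (intro Liminf_ereal_mult_left[symmetric]) auto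
  finally have "penalized \<epsilon> x \<le>
      liminf (\<lambda>n. enn2ereal (F (xs n))) + liminf (\<lambda>n. ereal (1 / \<epsilon>) * G (xs n))"
    (is "_ \<le> ?F + ?G")
    unfolding penalized_def by (intro add_mono lsc_top_liminf[OF F_lsc lim])
  also have "\<dots> \<le> liminf (\<lambda>n. penalized \<epsilon> (xs n))"
    unfolding penalized_def
  proof (rule ereal_liminf_add_mono)
    have "0 \<le> ?F" "0 \<le> ?G"
      using assms(1) G_nonneg[OF xs] by (auto intro!: Liminf_bounded simp: enn2ereal_nonneg)
    then show "\<not> ((?F = \<infinity> \<and> ?G = -\<infinity>) \<or> (?F = -\<infinity> \<and> ?G = \<infinity>))" by auto
  qed
  finally show ?thesis .
qed

theorem minimizer_exists:
  assumes \<epsilon>: "\<epsilon> > 0"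
  shows "\<exists>x. is_minimizer (topspace X) (penalized \<epsilon>) x"
proof -
  define I where "I = (INF x\<in>topspace X. penalized \<epsilon> x)"
  have I_le: "I \<le> penalized \<epsilon> x" if "x \<in> topspace X" for x
    unfolding I_def using that by (rule INF_lower)
  show ?thesis
  proof (cases "I = \<infinity>")
    case True
    then show ?thesis using topspace_nonempty I_le
      unfolding is_minimizer_def by (metis all_not_in_conv ereal_infty_less_eq(1))
  next
    case False
    have "0 \<le> I" unfolding I_def by (intro INF_greatest penalized_nonneg \<epsilon>)
    with False obtain i where i: "I = ereal i" by (cases I) auto
    obtain ys where ys: "\<And>n::nat. ys n \<in> topspace X" "(\<lambda>n. penalized \<epsilon> (ys n)) \<longlonglongrightarrow> I"
      using minimizing_sequence[OF topspace_nonempty] unfolding I_def by metis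
    then obtain N where N: "\<And>n. n \<ge> N \<Longrightarrow> penalized \<epsilon> (ys n) < ereal (i + 1)"
      using order_tendstoD(2)[OF ys(2), of "ereal (i + 1)"] i
      by (auto simp: eventually_sequentially)
    define xs where "xs n = ys (n + N)" for n
    have xs: "xs n \<in> topspace X" "penalized \<epsilon> (xs n) < ereal (i + 1)" for n
      using ys(1) N by (auto simp: xs_def)
    have "F (xs n) < \<infinity>" for n by (rule F_less_top[OF \<epsilon> xs(1)]) (rule less_trans[OF xs(2)], simp)
    then obtain r x where r: "strict_mono r" "limitin X (xs \<circ> r) x sequentially"
      using sublevel_compact[of xs] xs(1) G_le_penalized[OF \<epsilon> xs(1) less_imp_le[OF xs(2)]] by blast
    have "(\<lambda>n. penalized \<epsilon> ((xs \<circ> r) n)) \<longlonglongrightarrow> I"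
      using LIMSEQ_subseq_LIMSEQ[OF LIMSEQ_ignore_initial_segment[OF ys(2), of N] r(1)]
      by (simp add: xs_def o_def)
    then have "liminf (\<lambda>n. penalized \<epsilon> ((xs \<circ> r) n)) = I"
      by (rule lim_imp_Liminf[OF sequentially_bot])
    moreover have "penalized \<epsilon> x \<le> liminf (\<lambda>n. penalized \<epsilon> ((xs \<circ> r) n))"
      by (rule penalized_le_liminf[OF \<epsilon> r(2)]) (simp add: xs)
    ultimately show ?thesis
      unfolding is_minimizer_def using limitin_topspace[OF r(2)] I_le order_trans by metis
  qed
qed

lemma gamma_limit_le_liminf:
  assumes \<epsilon>: "\<And>n. \<epsilon> n > 0" "\<epsilon> \<longlonglongrightarrow> 0" and xs: "\<And>n. xs n \<in> topspace X"
    and lim: "limitin X xs x sequentially"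
  shows "gamma_limit x \<le> liminf (\<lambda>n. penalized (\<epsilon> n) (xs n))"
proof (rule ccontr)
  assume "\<not> ?thesis"
  then obtain c where c: "liminf (\<lambda>n. penalized (\<epsilon> n) (xs n)) < ereal c" "ereal c < gamma_limit x"
    using ereal_dense2 by (metis not_le)
  obtain k where k: "strict_mono k"
    "((\<lambda>n. penalized (\<epsilon> n) (xs n)) \<circ> k) \<longlonglongrightarrow> liminf (\<lambda>n. penalized (\<epsilon> n) (xs n))"
    using liminf_subseq_lim by blast
  have le_c: "\<forall>\<^sub>F n in sequentially. penalized (\<epsilon> (k n)) (xs (k n)) \<le> ereal c"
    using order_tendstoD(2)[OF k(2) c(1)] by eventually_elim simp
  have lim_k: "limitin X (\<lambda>n. xs (k n)) x sequentially"
    using limitin_subsequence[OF k(1) lim] by (simp add: o_def)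
  have "\<forall>\<^sub>F n in sequentially. enn2ereal (F (xs (k n))) \<le> ereal c"
    using le_c by eventually_elim (rule order_trans[OF F_le_penalized[OF xs \<epsilon>(1)]])
  then have "liminf (\<lambda>n. enn2ereal (F (xs (k n)))) \<le> liminf (\<lambda>n. ereal c)" by (rule Liminf_mono)
  then have Fx: "enn2ereal (F x) \<le> ereal c"
    using lsc_top_liminf[OF F_lsc lim_k] by (simp add: Liminf_const)
  have "(\<lambda>n. \<epsilon> (k n) * c) \<longlonglongrightarrow> 0"
    using LIMSEQ_subseq_LIMSEQ[OF \<epsilon>(2) k(1)] by (intro tendsto_mult_left_zero) (simp add: o_def)
  then have "liminf (\<lambda>n. ereal (\<epsilon> (k n) * c)) = 0"
    using lim_imp_Liminf[OF sequentially_bot tendsto_ereal] by (metis zero_ereal_def)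
  moreover have "liminf (\<lambda>n. G (xs (k n))) \<le> liminf (\<lambda>n. ereal (\<epsilon> (k n) * c))"
    by (rule Liminf_mono, rule eventually_mono[OF le_c]) (rule G_le_penalized[OF \<epsilon>(1) xs])
  ultimately have "G x \<le> 0" using G_le_liminf[OF lim_k xs] by simp
  then have "G x = 0" using G_nonneg[OF limitin_topspace[OF lim]] by (rule antisym)
  then show False using Fx c(2) by (simp add: gamma_limit_def)
qed

lemma penalized_eq_gamma_limit: "gamma_limit x < \<infinity> \<Longrightarrow> penalized \<epsilon> x = gamma_limit x"
  by (auto simp: gamma_limit_def penalized_def split: if_splits)

theorem gamma_convergence: "gamma_conv X penalized gamma_limit"
  unfolding gamma_conv_def
proof (intro allI impI conjI ballI)
  fix \<epsilon> :: "nat \<Rightarrow> real" and x xs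
  assume "(\<forall>n. 0 < \<epsilon> n) \<and> \<epsilon> \<longlonglongrightarrow> 0" "(\<forall>n. xs n \<in> topspace X) \<and> limitin X xs x sequentially"
  then show "gamma_limit x \<le> liminf (\<lambda>n. penalized (\<epsilon> n) (xs n))"
    using gamma_limit_le_liminf by blast
next
  fix \<epsilon> :: "nat \<Rightarrow> real" and x assume x: "x \<in> topspace X"
  show "\<exists>xs. (\<forall>n. xs n \<in> topspace X) \<and> limitin X xs x sequentially \<and>
      limsup (\<lambda>n. penalized (\<epsilon> n) (xs n)) \<le> gamma_limit x"
  proof (intro exI[of _ "\<lambda>_. x"] conjI allI x)
    show "limitin X (\<lambda>_. x) x sequentially" using x by (simp add: limitin_def)
    show "limsup (\<lambda>n. penalized (\<epsilon> n) x) \<le> gamma_limit x"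
      by (cases "gamma_limit x = \<infinity>") (auto simp: penalized_eq_gamma_limit Limsup_const)
  qed
qed

lemma quasiminimizers_eventually_le:
  assumes quasi: "quasimin_seq (topspace X) penalized \<epsilon> xs" and x: "x \<in> topspace X" and d: "d > 0"
  shows "\<forall>\<^sub>F n in sequentially. penalized (\<epsilon> n) (xs n) \<le> penalized (\<epsilon> n) x + ereal d"
proof -
  define I where "I n = (INF x\<in>topspace X. penalized (\<epsilon> n) x)" for n
  have \<epsilon>: "\<And>n. \<epsilon> n > 0" and xs: "\<And>n. xs n \<in> topspace X"
    and fin: "\<forall>\<^sub>F n in sequentially. penalized (\<epsilon> n) (xs n) < \<infinity>"
    and gap: "(\<lambda>n. penalized (\<epsilon> n) (xs n) - I n) \<longlonglongrightarrow> 0"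
    using quasi by (auto simp: quasimin_seq_def I_def)
  have I_le: "I n \<le> penalized (\<epsilon> n) z" if "z \<in> topspace X" for z n
    unfolding I_def using that by (rule INF_lower)
  have "\<forall>\<^sub>F n in sequentially. penalized (\<epsilon> n) (xs n) - I n < ereal d"
    using order_tendstoD(2)[OF gap, of "ereal d"] d by simp
  with fin show ?thesis
  proof eventually_elim
    case (elim n)
    have "0 \<le> I n" unfolding I_def by (intro INF_greatest penalized_nonneg \<epsilon>)
    moreover have "I n < \<infinity>" using I_le[OF xs, of n n] elim(1) by (rule le_less_trans)
    ultimately obtain i where "I n = ereal i" by (cases "I n") auto
    then have "penalized (\<epsilon> n) (xs n) \<le> I n + ereal d"
      using elim by (cases "penalized (\<epsilon> n) (xs n)") auto
    then show ?case using add_right_mono[OF I_le[OF x], of n "ereal d"] by (rule order_trans)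
  qed
qed

text \<open>Comparison with one point of finite energy bounds \<open>\<epsilon> * penalized \<epsilon>\<close>, hence \<open>G\<close>, along
  quasiminimizers even if \<open>gamma_limit\<close> is identically infinite.\<close>

lemma quasiminimizers_bounded:
  assumes quasi: "quasimin_seq (topspace X) penalized \<epsilon> xs"
  shows "\<exists>C. \<forall>\<^sub>F n in sequentially. F (xs n) < \<infinity> \<and> G (xs n) \<le> ereal C"
proof -
  have \<epsilon>: "\<And>n. \<epsilon> n > 0" "\<epsilon> \<longlonglongrightarrow> 0" and xs: "\<And>n. xs n \<in> topspace X"
    and fin: "\<forall>\<^sub>F n in sequentially. penalized (\<epsilon> n) (xs n) < \<infinity>"
    using quasi by (auto simp: quasimin_seq_def)
  obtain N where "penalized (\<epsilon> N) (xs N) < \<infinity>" using fin by (auto simp: eventually_sequentially)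
  moreover define z where "z = xs N"
  ultimately have z: "z \<in> topspace X" and z_fin: "penalized (\<epsilon> N) z < \<infinity>" by (simp_all add: xs)
  obtain f where f: "enn2ereal (F z) = ereal f" "0 \<le> f"
    using le_less_trans[OF F_le_penalized[OF z \<epsilon>(1)] z_fin] enn2ereal_nonneg[of "F z"]
    by (cases "enn2ereal (F z)") auto
  have "G z < \<infinity>" using z_fin \<epsilon>(1)[of N] by (cases "G z") (auto simp: penalized_def f)
  then obtain b where b: "G z = ereal b" using G_nonneg[OF z] by (cases "G z") auto
  have "\<forall>\<^sub>F n in sequentially. \<epsilon> n < 1" using order_tendstoD(2)[OF \<epsilon>(2), of 1] by simp
  then have "\<forall>\<^sub>F n in sequentially. F (xs n) < \<infinity> \<and> G (xs n) \<le> ereal (f + b + 1)"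
    using quasiminimizers_eventually_le[OF quasi z zero_less_one] fin
  proof eventually_elim
    case (elim n)
    have "penalized (\<epsilon> n) (xs n) \<le> ereal (f + b / \<epsilon> n + 1)"
      using elim(2) by (simp add: penalized_def[of "\<epsilon> n" z] f b)
    then have "G (xs n) \<le> ereal (\<epsilon> n * (f + b / \<epsilon> n + 1))" by (rule G_le_penalized[OF \<epsilon>(1) xs])
    also have "\<epsilon> n * (f + b / \<epsilon> n + 1) = \<epsilon> n * (f + 1) + b"
      using \<epsilon>(1)[of n] by (simp add: field_simps)
    also have "\<dots> \<le> f + b + 1" using mult_right_mono[of "\<epsilon> n" 1 "f + 1"] elim(1) f(2) by simp
    finally show ?case using F_less_top[OF \<epsilon>(1) xs elim(3)] by simp
  qed
  then show ?thesis by blast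
qed

theorem quasiminimizers_convergent_subsequence:
  assumes quasi: "quasimin_seq (topspace X) penalized \<epsilon> xs"
  shows "\<exists>r x. strict_mono r \<and> is_minimizer (topspace X) gamma_limit x \<and>
    limitin X (xs \<circ> r) x sequentially"
proof -
  have \<epsilon>: "\<And>n. \<epsilon> n > 0" "\<epsilon> \<longlonglongrightarrow> 0" and xs: "\<And>n. xs n \<in> topspace X"
    using quasi by (auto simp: quasimin_seq_def)
  obtain C N where "\<And>n. n \<ge> N \<Longrightarrow> F (xs n) < \<infinity> \<and> G (xs n) \<le> ereal C"
    using quasiminimizers_bounded[OF quasi] by (auto simp: eventually_sequentially)
  then obtain r x where r: "strict_mono r" "limitin X ((\<lambda>n. xs (n + N)) \<circ> r) x sequentially"
    using sublevel_compact[of "\<lambda>n. xs (n + N)" C] xs by auto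
  define k where "k n = r n + N" for n
  have k: "strict_mono k" using r(1) by (simp add: k_def strict_mono_def)
  have lim: "limitin X (xs \<circ> k) x sequentially" using r(2) by (simp add: k_def o_def)
  have "gamma_limit x \<le> gamma_limit x'" if x': "x' \<in> topspace X" for x'
  proof (cases "gamma_limit x' < \<infinity>")
    case True
    have "gamma_limit x \<le> gamma_limit x' + ereal d" if d: "d > 0" for d
    proof -
      have "\<forall>\<^sub>F n in sequentially. penalized (\<epsilon> (k n)) (xs (k n)) \<le> gamma_limit x' + ereal d"
        using eventually_compose_filterlim[OF quasiminimizers_eventually_le[OF quasi x' d]
            filterlim_subseq[OF k]]
        by (simp add: penalized_eq_gamma_limit[OF True])
      then have "liminf (\<lambda>n. penalized (\<epsilon> (k n)) (xs (k n))) \<le>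
          liminf (\<lambda>n. gamma_limit x' + ereal d)"
        by (rule Liminf_mono)
      moreover have "gamma_limit x \<le> liminf (\<lambda>n. penalized (\<epsilon> (k n)) (xs (k n)))"
        using gamma_limit_le_liminf[of "\<epsilon> \<circ> k" "xs \<circ> k" x] \<epsilon>(1)
          LIMSEQ_subseq_LIMSEQ[OF \<epsilon>(2) k] xs lim
        by (simp add: o_def)
      ultimately show ?thesis by (simp add: Liminf_const)
    qed
    then show ?thesis by (rule ereal_le_epsilon2)
  qed simp
  then have "is_minimizer (topspace X) gamma_limit x"
    using limitin_topspace[OF lim] by (simp add: is_minimizer_def)
  with k lim show ?thesis by blast
qed

theorem quasiminimizers_converge:
  assumes x: "x \<in> topspace X"
    and unique: "\<And>x' ys. is_minimizer (topspace X) gamma_limit x' \<Longrightarrow> limitin X ys x' sequentially \<Longrightarrow>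
      limitin X ys x sequentially"
    and quasi: "quasimin_seq (topspace X) penalized \<epsilon> xs"
  shows "limitin X xs x sequentially"
proof (rule limitin_if_subsequences_limitin[OF x])
  fix r :: "nat \<Rightarrow> nat" assume "strict_mono r"
  from quasiminimizers_convergent_subsequence[OF quasimin_seq_subseq[OF quasi this]]
  show "\<exists>s. strict_mono s \<and> limitin X (xs \<circ> r \<circ> s) x sequentially"
    using unique by blast
qed

end

lemma penalization_G_DG:
  assumes "gradient_flow \<phi> \<phi>1 \<phi>2 g T y0" and U: "compactin (L2_top T) U"
    and F_lsc: "lsc_top (tau T) F"
    and F_fin: "\<And>u y. (u, y) \<in> Xset T \<Longrightarrow> F (u, y) < \<infinity> \<Longrightarrow> u \<in> U"
  shows "penalization (tau T) F (G_DG T \<phi> y0)"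
proof
  interpret gradient_flow \<phi> \<phi>1 \<phi>2 g T y0 by fact
  show "topspace (tau T) \<noteq> {}"
    using subspace_0[OF L2.subspace[of T]] zero_H1fun[of T] by (auto simp: topspace_tau Xset_def)
  show "0 \<le> G_DG T \<phi> y0 x" if "x \<in> topspace (tau T)" for x
    using that G_DG_nonneg by (simp add: topspace_tau)
  show "G_DG T \<phi> y0 x \<le> liminf (\<lambda>n. G_DG T \<phi> y0 (xs n))"
    if "limitin (tau T) xs x sequentially" "\<And>n::nat. xs n \<in> topspace (tau T)" for xs x
    using that G_DG_le_liminf by (simp add: topspace_tau)
  fix xs C
  assume xs: "\<And>n::nat. xs n \<in> topspace (tau T)" and F: "\<And>n. F (xs n) < \<infinity>"
    and G: "\<And>n. G_DG T \<phi> y0 (xs n) \<le> ereal C"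
  have us: "fst (xs n) \<in> L2fun T" and ys: "snd (xs n) \<in> H1fun T" and usU: "fst (xs n) \<in> U" for n
    using xs[of n] F_fin[of "fst (xs n)" "snd (xs n)"] F[of n] by (auto simp: topspace_tau Xset_def)
  obtain r u where r: "strict_mono r" "limitin (L2_top T) ((\<lambda>n. fst (xs n)) \<circ> r) u sequentially"
    using compactin_L2_top_convergent_subsequence[OF U, of "\<lambda>n. fst (xs n)"] usU by blast
  obtain s y where s: "strict_mono s"
    "limitin (H1w_top T) ((\<lambda>n. snd (xs (r n))) \<circ> s) y sequentially"
    by (rule G_DG_sublevel_compact[OF r(2), of "\<lambda>n. snd (xs (r n))" C]) (use us ys G in auto)
  have "limitin (tau T) (xs \<circ> (r \<circ> s)) (u, y) sequentially"
    using limitin_subsequence[OF s(1) r(2)] s(2) by (simp add: limitin_tau_iff o_def)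
  then show "\<exists>r x. strict_mono r \<and> limitin (tau T) (xs \<circ> r) x sequentially"
    using strict_mono_o[OF r(1) s(1)] by blast
qed (fact F_lsc)

lemma Xeq_sym_trans: "Xeq T x z \<Longrightarrow> Xeq T y z \<Longrightarrow> Xeq T x y"
  unfolding Xeq_def by (auto elim: eventually_elim2)

theorem theorem4p1:
  fixes \<phi> \<phi>1 :: "'a::{real_inner,banach,second_countable_topology} \<Rightarrow> ereal"
    and \<phi>2 :: "'a \<Rightarrow> real"
    and T :: real and y0 :: 'a
    and U :: "(real \<Rightarrow> 'a) set"
    and F :: "(real \<Rightarrow> 'a) \<times> (real \<Rightarrow> 'a) \<Rightarrow> ennreal"
  assumes T_pos: "T > 0"
    and phi_def: "\<phi> = (\<lambda>x. \<phi>1 x + ereal (\<phi>2 x))"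
    and phi1_proper: "proper_fun \<phi>1"
    and phi1_convex: "convex_fun \<phi>1"
    and phi1_lsc: "lsc_fun \<phi>1"
    and phi1_single: "\<forall>y \<xi> \<eta>. \<xi> \<in> frechet_subdiff \<phi>1 y \<and> \<eta> \<in> frechet_subdiff \<phi>1 y \<longrightarrow> \<xi> = \<eta>"
    and phi2_C11: "C11 \<phi>2"
    and compact_sublevel: "\<forall>c::real. compact {x. \<phi> x \<le> ereal c}"
    and chain: "chain_rule T \<phi>"
    and y0_dom: "y0 \<in> dom_fun \<phi>"
    and U_ne: "U \<noteq> {}"
    and U_compact: "compactin (L2_top T) U"
    and F_lsc: "lsc_top (tau T) F"
    and F_fin: "\<forall>u y. (u, y) \<in> Xset T \<and> F (u, y) < \<infinity> \<longrightarrow> u \<in> U"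
  shows "(\<forall>\<epsilon>>0. \<exists>x. is_minimizer (Xset T) (E_eps T \<phi> y0 F \<epsilon>) x)
     \<and> gamma_conv (tau T) (E_eps T \<phi> y0 F) (E_0 T \<phi> y0 F)
     \<and> (\<forall>\<epsilon> xs. quasimin_seq (Xset T) (E_eps T \<phi> y0 F) \<epsilon> xs \<longrightarrow>
          (\<exists>r x. strict_mono r \<and> is_minimizer (Xset T) (E_0 T \<phi> y0 F) x \<and>
                 limitin (tau T) (xs \<circ> r) x sequentially))
     \<and> ((\<exists>x. is_minimizer (Xset T) (E_0 T \<phi> y0 F) x \<and>
            (\<forall>x'. is_minimizer (Xset T) (E_0 T \<phi> y0 F) x' \<longrightarrow> Xeq T x' x)) \<longrightarrow>
        (\<forall>x \<epsilon> xs. is_minimizer (Xset T) (E_0 T \<phi> y0 F) x \<and>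
                   quasimin_seq (Xset T) (E_eps T \<phi> y0 F) \<epsilon> xs \<longrightarrow>
                   limitin (tau T) xs x sequentially))"
proof -
  obtain g where g: "\<And>x. (\<phi>2 has_derivative inner (g x)) (at x)" "continuous_on UNIV g"
    using C11_gradient[OF phi2_C11] by blast
  have "gradient_flow \<phi> \<phi>1 \<phi>2 g T y0"
    by (intro gradient_flow.intro perturbed_convex_energy.intro gradient_flow_axioms.intro)
      (use assms g in \<open>auto simp: proper_fun_def\<close>)
  then interpret penalization "tau T" F "G_DG T \<phi> y0"
    using U_compact F_lsc F_fin by (intro penalization_G_DG) auto
  have E_eps: "penalized = E_eps T \<phi> y0 F" and E_0: "gamma_limit = E_0 T \<phi> y0 F"
    by (simp_all add: fun_eq_iff penalized_def gamma_limit_def E_eps_def E_0_def)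
  note abstract_results = minimizer_exists gamma_convergence quasiminimizers_convergent_subsequence
    quasiminimizers_converge
  note results = abstract_results[unfolded E_eps E_0 topspace_tau]
  show ?thesis
  proof (intro conjI allI impI)
    fix x \<epsilon> xs
    assume "\<exists>x. is_minimizer (Xset T) (E_0 T \<phi> y0 F) x \<and>
        (\<forall>x'. is_minimizer (Xset T) (E_0 T \<phi> y0 F) x' \<longrightarrow> Xeq T x' x)"
      and x: "is_minimizer (Xset T) (E_0 T \<phi> y0 F) x \<and> quasimin_seq (Xset T) (E_eps T \<phi> y0 F) \<epsilon> xs"
    then have "Xeq T x' x" if "is_minimizer (Xset T) (E_0 T \<phi> y0 F) x'" for x'
      using that Xeq_sym_trans by blast
    moreover have "x \<in> Xset T" using x by (simp add: is_minimizer_def)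
    ultimately show "limitin (tau T) xs x sequentially"
      using x limitin_tau_Xeq results(4)[of x \<epsilon> xs] by blast
  qed (use results(1-3) in blast)+
qed

end
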